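(* Let $M\ge 1$ be an integer, $\Delta>0$ a real number, and let $F\in\mathbb{D}_\infty([0,M\Delta])$ be of the form $F=g(W(\Delta),W(2\Delta),\ldots,W(M\Delta))$ with $g:\mathbb{R}^M\to\mathbb{R}$ a deterministic infinitely differentiable function. Suppose that for each $m\in\{0,\ldots,M-1\}$, $$\sum_{i=0}^{L}\left\|D_{(m+1)\Delta}^{2L-i}F\right\|_{L^2(\Omega)}^{2}\binom{L}{i}^{4}\frac{i!}{(L!)^{2}}\Delta^{2L-i}\longrightarrow 0\quad\text{as } L\to\infty .$$ Then for each $m\in\{0,\ldots,M-1\}$, $$E[F|\mathcal{F}_{m\Delta}]=\sum_{l=0}^{\infty}\gamma(m,l)\,E\big[D_{(m+1)\Delta}^{l}F\,\big|\,\mathcal{F}_{(m+1)\Delta}\big]\quad\text{in } L^2(\Omega),$$ where $\gamma(m,0)=1$ and for $l\ge 1$, $$\gamma(m,l)=(-1)^{l}\Delta^{l/2}\sum_{j=0}^{\lfloor l/2\rfloor}\frac{1}{j!\,(l-2j)!}\,h_{l-2j}\!\left(\frac{W((m+1)\Delta)-W(m\Delta)}{\sqrt{\Delta}}\right).$$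
   Context: $(\Omega,\{\mathcal{F}_t\}_{t\ge0},P)$ is a complete filtered probability space, where $\{\mathcal{F}_t\}$ is the usual augmentation of the filtration generated by a one-dimensional standard Brownian motion $W$ on $\mathbb{R}_+$. $\|F\|_{L^2(\Omega)}=\sqrt{E[F^2]}$. $D_tF$ is the Malliavin derivative of $F$ at time $t$; $D_t^lF=D_t\cdots D_tF$ ($l$ times), with $D_t^0F=F$. For a smooth cylindrical random variable $F=g(W(t_1),\ldots,W(t_n))$ it is evaluated pointwise by $D_sF=\sum_{i=1}^n\frac{\partial g}{\partial x_i}(W(t_1),\ldots,W(t_n))\chi_{[0,t_i]}(s)$, where $\chi$ denotes the indicator function (so in particular $D_{t}W(t)=1$). $\mathbb{D}_\infty([0,T])$ is the set of $\mathcal{F}_T$-measurable random variables $F\in L^2(\Omega)$ that are infinitely Malliavin differentiable in the sense that for every integer $n\ge1$, $\big\|\sup_{s_1,\ldots,s_n\in[0,T]}|D_{s_n}\cdots D_{s_1}F|\big\|_{L^2(\Omega)}<\infty$. $h_n$ is the Hermite polynomial of degree $n$: $h_0\equiv1$, $h_n(x)=(-1)^n e^{x^2/2}\frac{d^n}{dx^n}e^{-x^2/2}$ for $n\ge1$. $\lfloor x\rfloor$ is the largest integer $\le x$. *)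

theory Defs
  imports "HOL-Probability.Probability"
begin

section \<open>Brownian motion and its filtration\<close>

definition brownian_motion :: "'a measure \<Rightarrow> (real \<Rightarrow> 'a \<Rightarrow> real) \<Rightarrow> bool" where
  "brownian_motion P W \<longleftrightarrow>
     prob_space P \<and>
     (\<forall>t\<ge>0. W t \<in> borel_measurable P) \<and>
     (AE \<omega> in P. W 0 \<omega> = 0) \<and>
     (AE \<omega> in P. continuous_on {0..} (\<lambda>t. W t \<omega>)) \<and>
     (\<forall>s t. 0 \<le> s \<and> s < t \<longrightarrow>
        distributed P lborel (\<lambda>\<omega>. W t \<omega> - W s \<omega>) (normal_density 0 (sqrt (t - s)))) \<and>
     (\<forall>(n::nat) t. 0 \<le> t 0 \<and> (\<forall>i<n. t i < t (Suc i)) \<longrightarrow>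
        prob_space.indep_vars P (\<lambda>_. borel) (\<lambda>i \<omega>. W (t (Suc i)) \<omega> - W (t i) \<omega>) {..<n})"

definition generated_filtration :: "'a measure \<Rightarrow> (real \<Rightarrow> 'a \<Rightarrow> real) \<Rightarrow> real \<Rightarrow> 'a measure" where
  "generated_filtration P W t =
     sigma (space P) {W s -` B \<inter> space P | s B. 0 \<le> s \<and> s \<le> t \<and> B \<in> sets borel}"

text \<open>The usual augmentation adjoins all null sets and makes the filtration right-continuous.\<close>

definition usual_augmentation :: "'a measure \<Rightarrow> (real \<Rightarrow> 'a measure) \<Rightarrow> real \<Rightarrow> 'a measure" where
  "usual_augmentation P G t =
     sigma (space P) (\<Inter>u\<in>{t<..}. sigma_sets (space P) (sets (G u) \<union> null_sets P))"

definition brownian_filtration :: "'a measure \<Rightarrow> (real \<Rightarrow> 'a \<Rightarrow> real) \<Rightarrow> real \<Rightarrow> 'a measure" where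
  "brownian_filtration P W = usual_augmentation P (generated_filtration P W)"


section \<open>Square-integrable random variables\<close>

definition L2_space :: "'a measure \<Rightarrow> ('a \<Rightarrow> real) set" where
  "L2_space P = {f \<in> borel_measurable P. integrable P (\<lambda>\<omega>. (f \<omega>)\<^sup>2)}"

definition L2_norm :: "'a measure \<Rightarrow> ('a \<Rightarrow> real) \<Rightarrow> real" where
  "L2_norm P f = sqrt (\<integral>\<omega>. (f \<omega>)\<^sup>2 \<partial>P)"

definition sums_in_L2 :: "'a measure \<Rightarrow> (nat \<Rightarrow> 'a \<Rightarrow> real) \<Rightarrow> ('a \<Rightarrow> real) \<Rightarrow> bool" where
  "sums_in_L2 P f S \<longleftrightarrow>
     (\<forall>l. f l \<in> L2_space P) \<and> S \<in> L2_space P \<and>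
     (\<lambda>n. L2_norm P (\<lambda>\<omega>. S \<omega> - (\<Sum>l<n. f l \<omega>))) \<longlonglongrightarrow> 0"


section \<open>Smooth functions of finitely many real variables\<close>

text \<open>
  A function on \<open>n\<close>-dimensional Euclidean space is encoded as a function of a sequence
  \<open>x :: nat \<Rightarrow> real\<close> that only depends on \<open>x 0, \<dots>, x (n - 1)\<close>; for such functions, continuity
  with respect to the product topology on \<open>nat \<Rightarrow> real\<close> is continuity in these \<open>n\<close> variables.
\<close>

definition partial_deriv :: "nat \<Rightarrow> ((nat \<Rightarrow> real) \<Rightarrow> real) \<Rightarrow> (nat \<Rightarrow> real) \<Rightarrow> real" where
  "partial_deriv i g x = deriv (\<lambda>y. g (x(i := y))) (x i)"

definition smooth_fun :: "nat \<Rightarrow> ((nat \<Rightarrow> real) \<Rightarrow> real) \<Rightarrow> bool" where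
  "smooth_fun n g \<longleftrightarrow>
     (\<forall>x y. (\<forall>i<n. x i = y i) \<longrightarrow> g x = g y) \<and>
     (\<forall>is. set is \<subseteq> {..<n} \<longrightarrow>
        continuous_on UNIV (foldr partial_deriv is g) \<and>
        (\<forall>i<n. \<forall>x. (\<lambda>y. foldr partial_deriv is g (x(i := y))) field_differentiable at (x i)))"


section \<open>Malliavin derivative\<close>

text \<open>
  \<open>F = g(W(t\<^sub>0), \<dots>, W(t\<^sub>n\<^sub>-\<^sub>1))\<close>.  The times are positive because \<open>W 0\<close> vanishes almost
  surely: with \<open>t\<^sub>i = 0\<close> allowed, \<open>D\<^sub>0 F\<close> would depend on the representation of \<open>F\<close>.
\<close>

definition cylindrical_rep ::
  "'a measure \<Rightarrow> (real \<Rightarrow> 'a \<Rightarrow> real) \<Rightarrow> nat \<Rightarrow> (nat \<Rightarrow> real) \<Rightarrow> ((nat \<Rightarrow> real) \<Rightarrow> real) \<Rightarrow>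
     ('a \<Rightarrow> real) \<Rightarrow> bool" where
  "cylindrical_rep P W n t g F \<longleftrightarrow>
     smooth_fun n g \<and> (\<forall>i<n. 0 < t i) \<and> (\<forall>\<omega>\<in>space P. F \<omega> = g (\<lambda>i. W (t i) \<omega>))"

definition smooth_cylindrical :: "'a measure \<Rightarrow> (real \<Rightarrow> 'a \<Rightarrow> real) \<Rightarrow> ('a \<Rightarrow> real) \<Rightarrow> bool" where
  "smooth_cylindrical P W F \<longleftrightarrow> (\<exists>n t g. cylindrical_rep P W n t g F)"

text \<open>
  \<open>malliavin_deriv P W s F\<close> is \<open>D\<^sub>s F\<close>, evaluated pointwise, for smooth cylindrical \<open>F\<close>; it is
  unspecified for other \<open>F\<close>.  Lemma \<open>malliavin_deriv_eq\<close> below shows that it does not depend on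
  the representation of \<open>F\<close>, and \<open>cylindrical_rep_malliavin_deriv\<close> that \<open>D\<^sub>s F\<close> is again
  smooth cylindrical, so that iterated derivatives are given by the same formula.
\<close>

definition malliavin_deriv ::
  "'a measure \<Rightarrow> (real \<Rightarrow> 'a \<Rightarrow> real) \<Rightarrow> real \<Rightarrow> ('a \<Rightarrow> real) \<Rightarrow> 'a \<Rightarrow> real" where
  "malliavin_deriv P W s F \<omega> =
     (THE d. \<exists>n t g. cylindrical_rep P W n t g F \<and>
        d = (\<Sum>i<n. partial_deriv i g (\<lambda>j. W (t j) \<omega>) * indicator {0..t i} s))"

lemma smooth_fun_partialD:
  assumes "smooth_fun n g" "i < n"
  shows "continuous_on UNIV (partial_deriv i g)"
    and "((\<lambda>y. g (x(i := y))) has_real_derivative partial_deriv i g (x(i := z))) (at z)"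
proof -
  have "set [i] \<subseteq> {..<n}" using assms by auto
  with assms(1) have "continuous_on UNIV (foldr partial_deriv [i] g)"
    unfolding smooth_fun_def by blast
  then show "continuous_on UNIV (partial_deriv i g)" by simp
  have "set [] \<subseteq> {..<n}" by auto
  with assms have "(\<lambda>y. foldr partial_deriv [] g ((x(i := z))(i := y)))
      field_differentiable at ((x(i := z)) i)"
    unfolding smooth_fun_def by blast
  then have "(\<lambda>y. g (x(i := y))) field_differentiable at z" by simp
  then have "((\<lambda>y. g (x(i := y))) has_real_derivative deriv (\<lambda>y. g (x(i := y))) z) (at z)"
    by (simp add: DERIV_deriv_iff_field_differentiable)
  then show "((\<lambda>y. g (x(i := y))) has_real_derivative partial_deriv i g (x(i := z))) (at z)"
    by (simp add: partial_deriv_def)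
qed

lemma smooth_fun_directional_deriv:
  assumes g: "smooth_fun n g"
  shows "((\<lambda>e. g (\<lambda>i. x i + e * v i)) has_real_derivative
           (\<Sum>i<n. partial_deriv i g x * v i)) (at 0)"
proof -
  define X where "X k e = (\<lambda>i. if i < k then x i + e * v i else x i)" for k :: nat and e :: real
  have main: "((\<lambda>e. g (X k e)) has_real_derivative (\<Sum>i<k. partial_deriv i g x * v i)) (at 0)"
    if "k \<le> n" for k
    using that
  proof (induction k)
    case 0
    then show ?case by (simp add: X_def)
  next
    case (Suc k)
    then have k: "k < n" by simp
    note IH = Suc.IH[OF less_imp_le[OF k]]
    define H where "H e = g (X (Suc k) e) - g (X k e)" for e
    define Z where "Z e c = (X k e)(k := x k + c * v k)" for e c
    have Zs: "g (X (Suc k) e) = g (Z e e)" "g (X k e) = g (Z e 0)" for e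
      by (auto simp: Z_def X_def fun_eq_iff less_Suc_eq intro!: arg_cong[of _ _ g])
    have dZ: "((\<lambda>c. g (Z e c)) has_real_derivative partial_deriv k g (Z e c) * v k) (at c)" for e c
      unfolding Z_def
      by (rule DERIV_chain2[OF smooth_fun_partialD(2)[OF g k]])
         (auto intro!: derivative_eq_intros)
    have "\<exists>c. \<bar>c\<bar> \<le> \<bar>e\<bar> \<and> H e = e * (partial_deriv k g (Z e c) * v k)" for e
    proof (cases e "0::real" rule: linorder_cases)
      case less
      from MVT2[OF less dZ] obtain c where "e < c" "c < 0"
        "g (Z e 0) - g (Z e e) = (0 - e) * (partial_deriv k g (Z e c) * v k)" by blast
      then show ?thesis by (intro exI[of _ c]) (auto simp: H_def Zs algebra_simps)
    next
      case greater
      from MVT2[OF greater dZ] obtain c where "0 < c" "c < e"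
        "g (Z e e) - g (Z e 0) = (e - 0) * (partial_deriv k g (Z e c) * v k)" by blast
      then show ?thesis by (intro exI[of _ c]) (auto simp: H_def Zs algebra_simps)
    next
      case equal
      then show ?thesis by (intro exI[of _ 0]) (auto simp: H_def Zs)
    qed
    then obtain c where c: "\<And>e. \<bar>c e\<bar> \<le> \<bar>e\<bar>"
      and He: "\<And>e. H e = e * (partial_deriv k g (Z e (c e)) * v k)" by metis
    have c0: "(c \<longlongrightarrow> 0) (at 0)"
    proof (rule Lim_null_comparison[where g = "\<lambda>e. \<bar>e\<bar>"])
      show "\<forall>\<^sub>F e in at 0. norm (c e) \<le> \<bar>e\<bar>" using c by simp
      show "((\<lambda>e::real. \<bar>e\<bar>) \<longlongrightarrow> 0) (at 0)" by (auto intro!: tendsto_eq_intros)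
    qed
    have Zc: "continuous_on UNIV (\<lambda>p. partial_deriv k g (Z (fst p) (snd p)))"
    proof (rule continuous_on_compose2[OF smooth_fun_partialD(1)[OF g k]])
      show "continuous_on UNIV (\<lambda>p. Z (fst p) (snd p))"
      proof (rule continuous_on_coordinatewise_then_product)
        fix i
        show "continuous_on UNIV (\<lambda>p. Z (fst p) (snd p) i)"
          by (cases "i = k"; cases "i < k")
             (auto simp: Z_def X_def intro!: continuous_intros)
      qed
    qed auto
    have "((\<lambda>e. (e, c e)) \<longlongrightarrow> (0, 0)) (at 0)"
      by (intro tendsto_Pair c0 tendsto_ident_at)
    then have "((\<lambda>e. partial_deriv k g (Z (fst (e, c e)) (snd (e, c e))))
        \<longlongrightarrow> partial_deriv k g (Z (fst (0::real, 0::real)) (snd (0::real, 0::real)))) (at 0)"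
      by (rule continuous_on_tendsto_compose[OF Zc]) auto
    moreover have "Z 0 0 = x" by (auto simp: Z_def X_def)
    ultimately have lim: "((\<lambda>e. partial_deriv k g (Z e (c e)) * v k) \<longlongrightarrow> partial_deriv k g x * v k) (at 0)"
      by (auto intro!: tendsto_intros)
    have "\<forall>\<^sub>F e in at 0. partial_deriv k g (Z e (c e)) * v k = (H (0 + e) - H 0) / e"
      by (auto simp: eventually_at_filter He)
    then have "((\<lambda>e. (H (0 + e) - H 0) / e) \<longlongrightarrow> partial_deriv k g x * v k) (at 0)"
      by (rule Lim_transform_eventually[OF lim])
    then have "(H has_real_derivative partial_deriv k g x * v k) (at 0)"
      by (simp add: DERIV_def)
    from DERIV_add[OF IH this] show ?case
      by (simp add: H_def)
  qed
  have "g (X n e) = g (\<lambda>i. x i + e * v i)" for e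
    using g by (auto simp: smooth_fun_def X_def)
  with main[of n] show ?thesis by simp
qed

lemma brownian_motion_dense:
  assumes W: "brownian_motion P W" and U: "finite U" "\<And>u. u \<in> U \<Longrightarrow> 0 < u" and e: "e > 0"
  shows "\<exists>\<omega>\<in>space P. \<forall>u\<in>U. \<bar>W u \<omega> - w u\<bar> < e"
proof -
  interpret prob_space P using W by (simp add: brownian_motion_def)
  define w' where "w' = w(0 := 0)"
  define us where "us = sorted_list_of_set (insert 0 U)"
  define N where "N = card U"
  have "0 \<notin> U" using U(2) by auto
  then have len: "length us = Suc N" using U(1) by (simp add: us_def N_def)
  have set_us: "set us = insert 0 U" unfolding us_def by (rule set_sorted_list_of_set) (use U(1) in simp)
  have sorted: "sorted_wrt (<) us" unfolding us_def by simp
  have lt: "us ! i < us ! Suc i" if "i < N" for i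
    using sorted that len by (simp add: sorted_wrt_iff_nth_less)
  have ge: "0 \<le> us ! i" if "i \<le> N" for i
  proof -
    have "us ! i \<in> set us" using that len by simp
    then show ?thesis using set_us U(2) by (auto simp: less_imp_le)
  qed
  have us0: "us ! 0 = 0"
  proof -
    have "us ! 0 \<le> 0"
    proof -
      have "0 \<in> set us" using set_us by simp
      then obtain j where j: "j < length us" "us ! j = 0" by (auto simp: in_set_conv_nth)
      then have "us ! 0 \<le> us ! j" using sorted_wrt_nth_less[OF sorted, of 0 j] by (cases "j = 0") (auto simp: less_imp_le)
      with j show ?thesis by simp
    qed
    with ge[of 0] show ?thesis by simp
  qed
  define d where "d = e / real (Suc N)"
  have d: "d > 0" using e by (simp add: d_def)
  define X where "X i \<omega> = W (us ! Suc i) \<omega> - W (us ! i) \<omega>" for i \<omega>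
  define y where "y i = w' (us ! Suc i) - w' (us ! i)" for i
  have "indep_vars (\<lambda>_. borel) X {..<N}"
    using W lt us0 unfolding brownian_motion_def X_def by auto
  have Xd: "distributed P lborel (X i) (normal_density 0 (sqrt (us ! Suc i - us ! i)))" if "i < N" for i
    using W ge[of i] lt[OF that] that unfolding brownian_motion_def X_def by auto
  have pos: "prob (X i -` {y i - d<..<y i + d} \<inter> space P) > 0" if i: "i < N" for i
  proof -
    let ?f = "normal_density 0 (sqrt (us ! Suc i - us ! i))"
    let ?A = "{y i - d<..<y i + d}"
    have "emeasure P (X i -` ?A \<inter> space P) = (\<integral>\<^sup>+x. ennreal (?f x) * indicator ?A x \<partial>lborel)"
      by (rule distributed_emeasure[OF Xd[OF i]]) auto
    moreover have "(\<integral>\<^sup>+x. ennreal (?f x) * indicator ?A x \<partial>lborel) \<noteq> 0"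
    proof
      assume "(\<integral>\<^sup>+x. ennreal (?f x) * indicator ?A x \<partial>lborel) = 0"
      then have "AE x in lborel. ennreal (?f x) * indicator ?A x = 0"
        by (subst (asm) nn_integral_0_iff_AE) auto
      then have "AE x in lborel. x \<notin> ?A"
      proof eventually_elim
        case (elim x)
        have "?f x > 0" using lt[OF i] by (intro normal_density_pos) auto
        with elim show ?case by (auto simp: indicator_def split: if_splits)
      qed
      then have "emeasure lborel ?A = 0"
        by (subst (asm) AE_iff_measurable[where N = ?A]) auto
      then show False using d by simp
    qed
    ultimately have "emeasure P (X i -` ?A \<inter> space P) \<noteq> 0" by metis
    then show ?thesis
      using measure_nonneg[of P "X i -` ?A \<inter> space P"] by (auto simp: emeasure_eq_measure less_le)
  qed
  have prodpos: "prob (\<Inter>i\<in>{..<N}. X i -` {y i - d<..<y i + d} \<inter> space P) > 0" if "N > 0"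
  proof -
    have "prob (\<Inter>i\<in>{..<N}. X i -` {y i - d<..<y i + d} \<inter> space P) =
        (\<Prod>i\<in>{..<N}. prob (X i -` {y i - d<..<y i + d} \<inter> space P))"
      by (rule indep_varsD[OF \<open>indep_vars (\<lambda>_. borel) X {..<N}\<close>]) (use that in auto)
    also have "\<dots> > 0" by (rule prod_pos) (use pos in auto)
    finally show ?thesis .
  qed
  let ?E = "{\<omega>\<in>space P. \<forall>i<N. X i \<omega> \<in> {y i - d<..<y i + d}}"
  have "prob ?E > 0"
  proof (cases "N = 0")
    case True then show ?thesis by (simp add: prob_space)
  next
    case False
    then have "?E = (\<Inter>i\<in>{..<N}. X i -` {y i - d<..<y i + d} \<inter> space P)" by auto
    with prodpos False show ?thesis by simp
  qed
  have "\<exists>\<omega>\<in>?E. W 0 \<omega> = 0"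
  proof (rule ccontr)
    assume "\<not> (\<exists>\<omega>\<in>?E. W 0 \<omega> = 0)"
    then have *: "\<forall>\<omega>\<in>?E. W 0 \<omega> \<noteq> 0" by blast
    have "AE \<omega> in P. W 0 \<omega> = 0" using W by (simp add: brownian_motion_def)
    then have "AE \<omega> in P. \<omega> \<notin> ?E" by eventually_elim (use * in blast)
    then have "prob ?E = 0"
    proof (cases "?E \<in> events")
      case True
      show ?thesis by (rule prob_eq_0[OF True, THEN iffD2]) fact
    next
      case False
      then show ?thesis by (rule measure_notin_sets)
    qed
    with \<open>prob ?E > 0\<close> show False by simp
  qed
  then obtain \<omega> where om: "\<omega> \<in> space P" "W 0 \<omega> = 0"
    and XI: "\<And>i. i < N \<Longrightarrow> X i \<omega> \<in> {y i - d<..<y i + d}" by blast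
  have X: "\<bar>X i \<omega> - y i\<bar> < d" if "i < N" for i
    using XI[OF that] by (simp add: abs_less_iff)
  have bnd: "\<bar>W (us ! j) \<omega> - w' (us ! j)\<bar> \<le> real j * d" if "j \<le> N" for j
    using that
  proof (induction j)
    case 0
    then show ?case using om us0 by (simp add: w'_def)
  next
    case (Suc j)
    then have "\<bar>W (us ! j) \<omega> - w' (us ! j)\<bar> \<le> real j * d" by simp
    moreover have "\<bar>X j \<omega> - y j\<bar> < d" using X Suc by simp
    ultimately show ?case unfolding X_def y_def by (simp add: algebra_simps)
  qed
  have "\<bar>W u \<omega> - w u\<bar> < e" if "u \<in> U" for u
  proof -
    have "u \<in> set us" using that set_us by simp
    then obtain j where j: "j \<le> N" "us ! j = u" using len by (auto simp: in_set_conv_nth less_Suc_eq_le)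
    have "real j * d < real (Suc N) * d" using j d by (intro mult_strict_right_mono) auto
    also have "\<dots> = e" by (simp add: d_def)
    finally have "\<bar>W u \<omega> - w' u\<bar> < e" using bnd[OF j(1)] j(2) by simp
    moreover have "w' u = w u" using U(2)[OF that] by (simp add: w'_def)
    ultimately show ?thesis by simp
  qed
  with om show ?thesis by blast
qed

lemma cylindrical_rep_agree:
  assumes W: "brownian_motion P W"
    and r: "cylindrical_rep P W n t g F" and r': "cylindrical_rep P W n' t' g' F"
  shows "g (\<lambda>i. w (t i)) = g' (\<lambda>i. w (t' i))"
proof -
  define U where "U = t ` {..<n} \<union> t' ` {..<n'}"
  have U: "finite U" "\<And>u. u \<in> U \<Longrightarrow> 0 < u"
    using r r' by (auto simp: U_def cylindrical_rep_def)
  have "\<exists>\<omega>\<in>space P. \<forall>u\<in>U. \<bar>W u \<omega> - w u\<bar> < inverse (real (Suc k))" for k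
    by (rule brownian_motion_dense[OF W U]) auto
  then obtain om where om: "\<And>k. om k \<in> space P"
    and omW: "\<And>k u. u \<in> U \<Longrightarrow> \<bar>W u (om k) - w u\<bar> < inverse (real (Suc k))" by metis
  have conv: "(\<lambda>k. W u (om k)) \<longlonglongrightarrow> w u" if "u \<in> U" for u
  proof (rule LIM_zero_cancel, rule Lim_null_comparison)
    show "\<forall>\<^sub>F k in sequentially. norm (W u (om k) - w u) \<le> inverse (real (Suc k))"
      using omW[OF that] by (auto intro!: always_eventually less_imp_le)
    show "(\<lambda>k. inverse (real (Suc k))) \<longlonglongrightarrow> 0" by (rule LIMSEQ_inverse_real_of_nat)
  qed
  have lim: "(\<lambda>k. F (om k)) \<longlonglongrightarrow> h (\<lambda>i. w (q i))"
    if rep: "cylindrical_rep P W p q h F" and qU: "q ` {..<p} \<subseteq> U" for p q h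
  proof -
    define Y where "Y k i = (if i < p then W (q i) (om k) else w (q i))" for k i
    have dep: "\<And>x y. (\<forall>i<p. x i = y i) \<Longrightarrow> h x = h y"
      and "continuous_on UNIV (foldr partial_deriv [] h)"
      using rep unfolding cylindrical_rep_def smooth_fun_def by (blast, metis empty_set empty_subsetI)
    then have cont: "continuous_on UNIV h" by simp
    have "limitin (product_topology (\<lambda>_. euclidean) UNIV) Y (\<lambda>i. w (q i)) sequentially"
      unfolding limitin_componentwise
    proof (intro conjI ballI)
      fix i
      show "limitin euclidean (\<lambda>k. Y k i) (w (q i)) sequentially"
        using conv[of "q i"] qU by (cases "i < p") (auto simp: Y_def limitin_canonical_iff)
    qed (auto simp: extensional_def)
    then have "Y \<longlonglongrightarrow> (\<lambda>i. w (q i))"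
      by (simp add: euclidean_product_topology limitin_canonical_iff)
    then have "(\<lambda>k. h (Y k)) \<longlonglongrightarrow> h (\<lambda>i. w (q i))"
      by (rule continuous_on_tendsto_compose[OF cont]) auto
    moreover have "h (Y k) = F (om k)" for k
    proof -
      have "h (Y k) = h (\<lambda>i. W (q i) (om k))" by (rule dep) (simp add: Y_def)
      then show ?thesis using rep om by (simp add: cylindrical_rep_def)
    qed
    ultimately show ?thesis by simp
  qed
  show ?thesis
    by (rule LIMSEQ_unique[OF lim[OF r] lim[OF r']]) (auto simp: U_def)
qed

lemma malliavin_deriv_eq:
  assumes W: "brownian_motion P W" and r: "cylindrical_rep P W n t g F"
  shows "malliavin_deriv P W s F \<omega> =
    (\<Sum>i<n. partial_deriv i g (\<lambda>j. W (t j) \<omega>) * indicator {0..t i} s)"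
  unfolding malliavin_deriv_def
proof (rule the_equality)
  fix d
  assume "\<exists>n t g. cylindrical_rep P W n t g F \<and>
    d = (\<Sum>i<n. partial_deriv i g (\<lambda>j. W (t j) \<omega>) * indicator {0..t i} s)"
  then obtain n' t' g' where r': "cylindrical_rep P W n' t' g' F"
    and d: "d = (\<Sum>i<n'. partial_deriv i g' (\<lambda>j. W (t' j) \<omega>) * indicator {0..t' i} s)" by blast
  let ?w = "\<lambda>e u. W u \<omega> + e * indicator {0..u} s"
  have eq: "(\<lambda>e. g (\<lambda>i. ?w e (t i))) = (\<lambda>e. g' (\<lambda>i. ?w e (t' i)))"
    by (rule ext) (rule cylindrical_rep_agree[OF W r r'])
  have "((\<lambda>e. g (\<lambda>i. ?w e (t i))) has_real_derivative
      (\<Sum>i<n. partial_deriv i g (\<lambda>j. W (t j) \<omega>) * indicator {0..t i} s)) (at 0)"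
    using r by (intro smooth_fun_directional_deriv) (simp add: cylindrical_rep_def)
  moreover have "((\<lambda>e. g (\<lambda>i. ?w e (t i))) has_real_derivative d) (at 0)"
    unfolding d eq using r' by (intro smooth_fun_directional_deriv) (simp add: cylindrical_rep_def)
  ultimately show "d = (\<Sum>i<n. partial_deriv i g (\<lambda>j. W (t j) \<omega>) * indicator {0..t i} s)"
    by (rule DERIV_unique[symmetric])
qed (rule exI[of _ n], rule exI[of _ t], rule exI[of _ g], rule conjI[OF r refl])

lemma smooth_fun_derivation:
  assumes g: "smooth_fun n g"
  shows "smooth_fun n (\<lambda>x. \<Sum>i<n. partial_deriv i g x * c i)"
proof -
  let ?G = "\<lambda>x. \<Sum>i<n. partial_deriv i g x * c i"
  have cont: "continuous_on UNIV (foldr partial_deriv is g)"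
    and diff: "\<And>i x. i < n \<Longrightarrow>
      (\<lambda>y. foldr partial_deriv is g (x(i := y))) field_differentiable at (x i)"
    if "set is \<subseteq> {..<n}" for "is"
    using g that unfolding smooth_fun_def by blast+
  have rep: "foldr partial_deriv is ?G = (\<lambda>x. \<Sum>i<n. foldr partial_deriv (is @ [i]) g x * c i)"
    if "set is \<subseteq> {..<n}" for "is"
    using that
  proof (induction "is")
    case Nil
    then show ?case by simp
  next
    case (Cons j js)
    then have js: "set js \<subseteq> {..<n}" and j: "j < n" by auto
    have "partial_deriv j (\<lambda>x. \<Sum>i<n. foldr partial_deriv (js @ [i]) g x * c i) x =
        (\<Sum>i<n. partial_deriv j (foldr partial_deriv (js @ [i]) g) x * c i)" for x
      unfolding partial_deriv_def[of j]
    proof (rule DERIV_imp_deriv, rule DERIV_sum, rule DERIV_cmult_right)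
      fix i assume "i \<in> {..<n}"
      with js have "set (js @ [i]) \<subseteq> {..<n}" by auto
      from diff[OF this j, of x]
      show "((\<lambda>y. foldr partial_deriv (js @ [i]) g (x(j := y))) has_real_derivative
          deriv (\<lambda>y. foldr partial_deriv (js @ [i]) g (x(j := y))) (x j)) (at (x j))"
        by (simp only: DERIV_deriv_iff_field_differentiable)
    qed
    then show ?case by (simp add: Cons.IH[OF js] fun_eq_iff del: foldr_append)
  qed
  show ?thesis
    unfolding smooth_fun_def
  proof (intro conjI allI impI)
    fix x y :: "nat \<Rightarrow> real" assume xy: "\<forall>i<n. x i = y i"
    have "partial_deriv i g x = partial_deriv i g y" if "i < n" for i
    proof -
      have "(\<lambda>z. g (x(i := z))) = (\<lambda>z. g (y(i := z)))"
      proof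
        fix z
        have "\<forall>j<n. (x(i := z)) j = (y(i := z)) j" using xy by simp
        then show "g (x(i := z)) = g (y(i := z))" using g unfolding smooth_fun_def by blast
      qed
      then show ?thesis using xy that by (simp add: partial_deriv_def)
    qed
    then show "?G x = ?G y" by simp
  next
    fix "is" :: "nat list" assume is_n: "set is \<subseteq> {..<n}"
    have snoc: "set (is @ [i]) \<subseteq> {..<n}" if "i < n" for i using is_n that by auto
    show "continuous_on UNIV (foldr partial_deriv is ?G)"
      unfolding rep[OF is_n]
      by (intro continuous_on_sum continuous_on_mult_right cont snoc) simp
    fix j x assume j: "j < n"
    have "((\<lambda>y. \<Sum>i<n. foldr partial_deriv (is @ [i]) g (x(j := y)) * c i) has_real_derivative
        (\<Sum>i<n. deriv (\<lambda>y. foldr partial_deriv (is @ [i]) g (x(j := y))) (x j) * c i)) (at (x j))"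
    proof (rule DERIV_sum, rule DERIV_cmult_right)
      fix i assume "i \<in> {..<n}"
      then have "set (is @ [i]) \<subseteq> {..<n}" by (intro snoc) simp
      from diff[OF this j, of x]
      show "((\<lambda>y. foldr partial_deriv (is @ [i]) g (x(j := y))) has_real_derivative
          deriv (\<lambda>y. foldr partial_deriv (is @ [i]) g (x(j := y))) (x j)) (at (x j))"
        by (simp only: DERIV_deriv_iff_field_differentiable)
    qed
    then show "(\<lambda>y. foldr partial_deriv is ?G (x(j := y))) field_differentiable at (x j)"
      unfolding rep[OF is_n] field_differentiable_def by (rule exI)
  qed
qed

lemma cylindrical_rep_malliavin_deriv:
  assumes W: "brownian_motion P W" and r: "cylindrical_rep P W n t g F"
  shows "cylindrical_rep P W n t
    (\<lambda>x. \<Sum>i<n. partial_deriv i g x * indicator {0..t i} s) (malliavin_deriv P W s F)"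
  unfolding cylindrical_rep_def malliavin_deriv_eq[OF W r]
  using r by (intro conjI smooth_fun_derivation) (simp_all add: cylindrical_rep_def)

text \<open>
  \<open>\<bbbD>\<^sub>\<infinity>([0,T])\<close>, for smooth cylindrical random variables.  A list \<open>[s\<^sub>n, \<dots>, s\<^sub>1]\<close> stands for
  \<open>D\<^sub>s\<^sub>n \<dots> D\<^sub>s\<^sub>1 F\<close>.  Supremum and norm are taken in \<open>ennreal\<close>, where they always exist.
\<close>

definition malliavin_D_infty :: "'a measure \<Rightarrow> (real \<Rightarrow> 'a \<Rightarrow> real) \<Rightarrow> real \<Rightarrow> ('a \<Rightarrow> real) set" where
  "malliavin_D_infty P W T =
     {F. F \<in> borel_measurable (brownian_filtration P W T) \<and> F \<in> L2_space P \<and>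
         smooth_cylindrical P W F \<and>
         (\<forall>n\<ge>1. (\<integral>\<^sup>+\<omega>. (SUP ss\<in>{ss. length ss = n \<and> set ss \<subseteq> {0..T}}.
                     ennreal \<bar>foldr (malliavin_deriv P W) ss F \<omega>\<bar>)\<^sup>2 \<partial>P) < \<infinity>)}"


section \<open>Hermite polynomials and the coefficients of the expansion\<close>

definition hermite :: "nat \<Rightarrow> real \<Rightarrow> real" where
  "hermite n x =
     (if n = 0 then 1
      else (-1) ^ n * exp (x\<^sup>2 / 2) * (deriv ^^ n) (\<lambda>y. exp (- y\<^sup>2 / 2)) x)"

definition bte_gamma :: "(real \<Rightarrow> 'a \<Rightarrow> real) \<Rightarrow> real \<Rightarrow> nat \<Rightarrow> nat \<Rightarrow> 'a \<Rightarrow> real" where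
  "bte_gamma W \<Delta> m l \<omega> =
     (if l = 0 then 1
      else (-1) ^ l * \<Delta> powr (real l / 2) *
        (\<Sum>j=0..l div 2. 1 / (fact j * fact (l - 2 * j)) *
           hermite (l - 2 * j) ((W (real (m + 1) * \<Delta>) \<omega> - W (real m * \<Delta>) \<omega>) / sqrt \<Delta>)))"

end

(* Condition on the increment X = W((m+1)Delta) - W(m Delta).  In direction of X, the iterated
   Malliavin derivatives D^l F are ordinary derivatives f^(l)(X), and
     gamma(m,l) = E_Z (Z - X)^l / l!
   for an independent copy Z of X.  The claimed series is therefore the Taylor expansion of f(Z)
   about X, averaged over Z, and then projected by E[. | F_((m+1)Delta)], which is an L2 contraction.
   Convergence in L2: choosing i close to L/2 in the hypothesis gives ||f^(n)||^2 <= C n! (2/15)^n.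
   By the shift formula E e^(sX) h(X)^2 = e^(s^2/2) E h(X+s)^2 and another Taylor expansion, this
   makes the norms of the terms decay geometrically. *)
theory Submission
  imports Defs "HOL-Real_Asymp.Real_Asymp"
begin

section \<open>Gaussian integrals and Taylor series\<close>

text \<open>The weight gamma(m,l) is an unbounded polynomial in X, and X is also the argument of
  f^(l), so the norm of a term is not a product of norms. The weight is therefore dominated by
  exponentials in s X with a free s > 0; the shift formula trades them for translations of f^(l),
  and the translates are expanded again in derivatives of known norm. For X of variance 1 and
  ||f^(n)||^2 <= C n! r^n, this leaves n! r^n (1 - 2 r)^(-n-1) exp(5 s^2) / s^(2 n) up to a
  constant, and s^2 = n/5 gives the rate 5 r / (1 - 2 r). It is below 1 exactly for r < 1/7 =
  0.1428..., while the hypothesis gives every r > 432^(-1/3) = 0.1322.... So r = 2/15 leaves little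
  room, and crude constants in these estimates would spoil the proof. F may depend on increments
  after (m+1)\<Delta>, so D^l F is not measurable at that time. All estimates therefore keep the
  other coordinates as a parameter, and the conditioning comes last. Independence from the
  right-continuous filtration is obtained as a limit of shifted increments.\<close>

lemma fact_le_stirling:
  assumes "n \<ge> 1"
  shows "fact n \<le> exp 1 * real n * (real n / exp 1) ^ n"
  using assms
proof (induction n rule: dec_induct)
  case base
  then show ?case by simp
next
  case (step n)
  let ?x = "real n"
  have n: "?x > 0" using step by simp
  \<comment> \<open>The logarithmic form of e <= (1 + 1/n)^(n+1), the only analytic input of the
    induction. The extra factor n in the bound costs nothing against geometric decay.\<close>
  have "1 / (?x + 1) \<le> ln (1 + 1 / ?x)"
  proof -
    have "ln (?x / (?x + 1)) \<le> ?x / (?x + 1) - 1"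
      using n by (intro ln_le_minus_one) auto
    moreover have "ln (?x / (?x + 1)) = - ln (1 + 1 / ?x)"
      using n by (subst ln_inverse[symmetric]) (auto simp: field_simps)
    moreover have "?x / (?x + 1) - 1 = - (1 / (?x + 1))" using n by (simp add: field_simps)
    ultimately show ?thesis by simp
  qed
  then have "1 \<le> real (Suc n) * ln (1 + 1 / ?x)" using n by (simp add: field_simps)
  then have "exp 1 \<le> exp (real (Suc n) * ln (1 + 1 / ?x))" by simp
  also have "\<dots> = (1 + 1 / ?x) ^ Suc n"
    using n by (subst exp_of_nat_mult) (simp add: add_pos_pos)
  finally have e: "exp 1 \<le> (1 + 1 / ?x) ^ Suc n" .
  have "fact (Suc n) = real (Suc n) * fact n" by simp
  also have "\<dots> \<le> real (Suc n) * (exp 1 * ?x * (?x / exp 1) ^ n)"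
    using step by (intro mult_left_mono) auto
  also have "\<dots> = real (Suc n) * ?x ^ Suc n / exp 1 ^ n * exp 1"
    by (simp add: power_divide)
  also have "\<dots> \<le> real (Suc n) * ?x ^ Suc n / exp 1 ^ n * (1 + 1 / ?x) ^ Suc n"
    by (intro mult_left_mono e) auto
  also have "\<dots> = real (Suc n) * (?x * (1 + 1 / ?x)) ^ Suc n / exp 1 ^ n"
    by (simp add: power_mult_distrib)
  also have "?x * (1 + 1 / ?x) = real (Suc n)" using n by (simp add: field_simps)
  also have "real (Suc n) * real (Suc n) ^ Suc n / exp 1 ^ n =
      exp 1 * real (Suc n) * (real (Suc n) / exp 1) ^ Suc n"
    by (simp add: power_divide del: of_nat_Suc)
  finally show ?case .
qed

text \<open>Cauchy-Schwarz with weights, passed from partial sums to the limit. The series of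
  \<open>a\<close> live in \<open>ennreal\<close>, so the estimate applies before any convergence is
  known. The weights are exponential in one application and geometric in the other.\<close>

lemma suminf_square_le:
  fixes a w :: "nat \<Rightarrow> real"
  assumes a: "\<And>k. a k \<ge> 0" and w: "\<And>k. w k > 0" "summable w"
  shows "(\<Sum>k. ennreal (a k))\<^sup>2 \<le> ennreal (suminf w) * (\<Sum>k. ennreal ((a k)\<^sup>2 / w k))"
proof (rule LIMSEQ_le_const2)
  show "(\<lambda>n. (\<Sum>k<n. ennreal (a k))\<^sup>2) \<longlonglongrightarrow> (\<Sum>k. ennreal (a k))\<^sup>2"
    unfolding power2_eq_square
    by (intro tendsto_mult_ennreal summable_LIMSEQ) auto
  show "\<exists>N. \<forall>n\<ge>N. (\<Sum>k<n. ennreal (a k))\<^sup>2 \<le> ennreal (suminf w) * (\<Sum>k. ennreal ((a k)\<^sup>2 / w k))"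
  proof (intro exI allI impI)
    fix n
    have "(\<Sum>k<n. ennreal (a k))\<^sup>2 = ennreal ((\<Sum>k<n. a k)\<^sup>2)"
      using a by (simp add: ennreal_power sum_nonneg)
    also have "(\<Sum>k<n. a k)\<^sup>2 = (\<Sum>k<n. sqrt (w k) * (a k / sqrt (w k)))\<^sup>2"
      using w(1) by (intro arg_cong[where f="\<lambda>x. x\<^sup>2"] sum.cong) (auto simp: less_imp_neq[symmetric])
    also have "\<dots> \<le> (\<Sum>k<n. (sqrt (w k))\<^sup>2) * (\<Sum>k<n. (a k / sqrt (w k))\<^sup>2)"
      by (rule Cauchy_Schwarz_ineq_sum)
    also have "\<dots> = (\<Sum>k<n. w k) * (\<Sum>k<n. (a k)\<^sup>2 / w k)"
      using w(1) by (simp add: power_divide less_imp_le)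
    also have "\<dots> \<le> suminf w * (\<Sum>k<n. (a k)\<^sup>2 / w k)"
      using w by (intro mult_right_mono sum_le_suminf sum_nonneg) (auto simp: less_imp_le)
    also have "ennreal \<dots> = ennreal (suminf w) * (\<Sum>k<n. ennreal ((a k)\<^sup>2 / w k))"
      using w by (simp add: ennreal_mult' sum_nonneg less_imp_le suminf_nonneg)
    also have "\<dots> \<le> ennreal (suminf w) * (\<Sum>k. ennreal ((a k)\<^sup>2 / w k))"
      by (intro mult_left_mono sum_le_suminf) auto
    finally show "(\<Sum>k<n. ennreal (a k))\<^sup>2 \<le> ennreal (suminf w) * (\<Sum>k. ennreal ((a k)\<^sup>2 / w k))"
      by (simp add: ennreal_leI)
  qed
qed

section \<open>Gaussian measure: shift formula and absolute moments\<close>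

abbreviation std_normal :: "real measure" where
  "std_normal \<equiv> density lborel (\<lambda>x. ennreal (std_normal_density x))"

lemma prob_space_std_normal: "prob_space std_normal"
  by (rule prob_space_normal_density) simp

text \<open>Completing the square: the weight exp(s x) turns the standard normal density into
  exp(s^2/2) times its translate by s. This is the Cameron-Martin formula in dimension one.\<close>

lemma nn_integral_std_normal_exp:
  assumes [measurable]: "f \<in> borel_measurable borel"
  shows "(\<integral>\<^sup>+x. ennreal (exp (s * x)) * f x \<partial>std_normal) =
    ennreal (exp (s\<^sup>2 / 2)) * (\<integral>\<^sup>+x. f (x + s) \<partial>std_normal)"
proof -
  have eq: "std_normal_density (s + x) * exp (s * (s + x)) = exp (s\<^sup>2 / 2) * std_normal_density x" for x
    by (simp add: std_normal_density_def exp_add[symmetric])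
       (simp add: power2_eq_square field_simps)
  have "(\<integral>\<^sup>+x. ennreal (exp (s * x)) * f x \<partial>std_normal) =
      (\<integral>\<^sup>+x. ennreal (std_normal_density x * exp (s * x)) * f x \<partial>lborel)"
    by (subst nn_integral_density) (auto simp: ennreal_mult' mult.assoc)
  also have "\<dots> = (\<integral>\<^sup>+x. ennreal (std_normal_density (s + x) * exp (s * (s + x))) * f (s + x) \<partial>lborel)"
    by (subst nn_integral_real_affine[where c=1 and t=s]) auto
  also have "\<dots> = (\<integral>\<^sup>+x. ennreal (exp (s\<^sup>2 / 2)) * (ennreal (std_normal_density x) * f (x + s)) \<partial>lborel)"
    unfolding eq by (simp add: ennreal_mult' mult.assoc add.commute)
  also have "\<dots> = ennreal (exp (s\<^sup>2 / 2)) * (\<integral>\<^sup>+x. f (x + s) \<partial>std_normal)"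
    by (subst nn_integral_cmult) (auto simp: nn_integral_density)
  finally show ?thesis .
qed

lemma nn_integral_exp_abs_std_normal:
  assumes s: "s > 0"
  shows "(\<integral>\<^sup>+z. ennreal (exp (s * \<bar>z - x\<bar>)) \<partial>std_normal) \<le>
    ennreal (exp (s\<^sup>2 / 2) * (exp (s * x) + exp (- (s * x))))"
proof -
  have *: "(\<integral>\<^sup>+z. ennreal (exp (c * z)) \<partial>std_normal) = ennreal (exp (c\<^sup>2 / 2))" for c
    using nn_integral_std_normal_exp[of "\<lambda>_. 1" c] prob_space.emeasure_space_1[OF prob_space_std_normal]
    by simp
  have "(\<integral>\<^sup>+z. ennreal (exp (s * \<bar>z - x\<bar>)) \<partial>std_normal) \<le>
      (\<integral>\<^sup>+z. ennreal (exp (- (s * x))) * ennreal (exp (s * z)) + ennreal (exp (s * x)) * ennreal (exp ((- s) * z)) \<partial>std_normal)"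
  proof (rule nn_integral_mono)
    fix z
    have "exp (s * \<bar>z - x\<bar>) \<le> exp (s * (z - x)) + exp (s * (x - z))"
      by (cases "z \<ge> x") auto
    also have "\<dots> = exp (- (s * x)) * exp (s * z) + exp (s * x) * exp ((- s) * z)"
      by (simp add: exp_add[symmetric] algebra_simps)
    finally show "ennreal (exp (s * \<bar>z - x\<bar>)) \<le>
        ennreal (exp (- (s * x))) * ennreal (exp (s * z)) + ennreal (exp (s * x)) * ennreal (exp ((- s) * z))"
      by (simp add: ennreal_mult'[symmetric] ennreal_plus[symmetric] del: ennreal_plus)
  qed
  also have "\<dots> = ennreal (exp (- (s * x))) * ennreal (exp (s\<^sup>2 / 2)) + ennreal (exp (s * x)) * ennreal (exp ((-s)\<^sup>2 / 2))"
    unfolding *[symmetric]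
    by (subst nn_integral_add) (auto intro!: arg_cong2[where f="(+)"] nn_integral_cmult)
  also have "\<dots> = ennreal (exp (s\<^sup>2 / 2) * (exp (s * x) + exp (- (s * x))))"
    by (simp add: ennreal_mult'[symmetric] ennreal_plus[symmetric] algebra_simps del: ennreal_plus)
  finally show ?thesis .
qed

text \<open>The absolute value stands inside the integral, so this dominates the signed moment and
  also supplies the majorant for exchanging the sum over n with the integral over z.\<close>

definition abs_moment :: "nat \<Rightarrow> real \<Rightarrow> ennreal" where
  "abs_moment n x = (\<integral>\<^sup>+z. ennreal (\<bar>z - x\<bar> ^ n / fact n) \<partial>std_normal)"

text \<open>One term of the exponential series: (s y)^n / n! <= exp(s y). The parameter s stays free
  and is optimised later in terms of n.\<close>

lemma abs_moment_le:
  assumes s: "s > 0"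
  shows "abs_moment n x \<le> ennreal (exp (s\<^sup>2 / 2) / s ^ n * (exp (s * x) + exp (- (s * x))))"
proof -
  have "abs_moment n x \<le> (\<integral>\<^sup>+z. ennreal (1 / s ^ n) * ennreal (exp (s * \<bar>z - x\<bar>)) \<partial>std_normal)"
    unfolding abs_moment_def
  proof (rule nn_integral_mono)
    fix z
    have "(s * \<bar>z - x\<bar>) ^ n / fact n \<le> exp (s * \<bar>z - x\<bar>)"
    proof -
      have "summable (\<lambda>k. (s * \<bar>z - x\<bar>) ^ k /\<^sub>R fact k)" by (rule summable_exp_generic)
      then have "sum (\<lambda>k. (s * \<bar>z - x\<bar>) ^ k /\<^sub>R fact k) {n} \<le> exp (s * \<bar>z - x\<bar>)"
        unfolding exp_def using s by (intro sum_le_suminf) auto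
      then show ?thesis by (simp add: field_simps)
    qed
    then have "\<bar>z - x\<bar> ^ n / fact n \<le> 1 / s ^ n * exp (s * \<bar>z - x\<bar>)"
      using s by (simp add: power_mult_distrib field_simps)
    then show "ennreal (\<bar>z - x\<bar> ^ n / fact n) \<le> ennreal (1 / s ^ n) * ennreal (exp (s * \<bar>z - x\<bar>))"
      using s by (simp add: ennreal_mult'[symmetric] ennreal_leI)
  qed
  also have "\<dots> = ennreal (1 / s ^ n) * (\<integral>\<^sup>+z. ennreal (exp (s * \<bar>z - x\<bar>)) \<partial>std_normal)"
    by (rule nn_integral_cmult) auto
  also have "\<dots> \<le> ennreal (1 / s ^ n) * ennreal (exp (s\<^sup>2 / 2) * (exp (s * x) + exp (- (s * x))))"
    by (intro mult_left_mono nn_integral_exp_abs_std_normal s) auto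
  also have "\<dots> = ennreal (exp (s\<^sup>2 / 2) / s ^ n * (exp (s * x) + exp (- (s * x))))"
    using s by (simp add: ennreal_mult'[symmetric])
  finally show ?thesis .
qed

text \<open>On the interval the normal density is at least its value at the largest modulus, so a
  Gaussian bound becomes a Lebesgue bound.\<close>

lemma integral_square_le_std_normal:
  fixes f :: "real \<Rightarrow> real"
  assumes f: "continuous_on UNIV f" and K: "(\<integral>\<^sup>+x. ennreal ((f x)\<^sup>2) \<partial>std_normal) \<le> ennreal K" "0 \<le> K"
  shows "integral {a..b} (\<lambda>x. (f x)\<^sup>2) \<le> K / std_normal_density (max \<bar>a\<bar> \<bar>b\<bar>)"
proof -
  define m where "m = std_normal_density (max \<bar>a\<bar> \<bar>b\<bar>)"
  have m: "m > 0" unfolding m_def by (rule normal_density_pos) simp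
  have [measurable]: "f \<in> borel_measurable borel" using f by (rule borel_measurable_continuous_onI)
  have md: "m \<le> std_normal_density x" if "x \<in> {a..b}" for x
  proof -
    have "\<bar>x\<bar> \<le> max \<bar>a\<bar> \<bar>b\<bar>" using that by auto
    then have "x\<^sup>2 \<le> (max \<bar>a\<bar> \<bar>b\<bar>)\<^sup>2" by (simp add: abs_le_square_iff[symmetric])
    then show ?thesis by (simp add: m_def std_normal_density_def divide_right_mono)
  qed
  have "(\<integral>\<^sup>+x\<in>{a..b}. ennreal ((f x)\<^sup>2) \<partial>lborel) \<le>
      (\<integral>\<^sup>+x. ennreal (1 / m) * (ennreal (std_normal_density x) * ennreal ((f x)\<^sup>2)) \<partial>lborel)"
  proof (rule nn_integral_mono)
    fix x
    have "(f x)\<^sup>2 \<le> 1 / m * (std_normal_density x * (f x)\<^sup>2)" if "x \<in> {a..b}"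
      using mult_right_mono[OF md[OF that], of "(f x)\<^sup>2"] m by (simp add: field_simps)
    then show "ennreal ((f x)\<^sup>2) * indicator {a..b} x \<le>
        ennreal (1 / m) * (ennreal (std_normal_density x) * ennreal ((f x)\<^sup>2))"
      using m by (auto simp: ennreal_mult'[symmetric] ennreal_leI indicator_def)
  qed
  also have "\<dots> = ennreal (1 / m) * (\<integral>\<^sup>+x. ennreal ((f x)\<^sup>2) \<partial>std_normal)"
    by (subst nn_integral_cmult) (auto simp: nn_integral_density)
  also have "\<dots> \<le> ennreal (1 / m) * ennreal K" by (intro mult_left_mono K) auto
  also have "\<dots> = ennreal (K / m)" using m K by (simp add: ennreal_mult'[symmetric])
  finally have le: "(\<integral>\<^sup>+x\<in>{a..b}. ennreal ((f x)\<^sup>2) \<partial>lborel) \<le> ennreal (K / m)" .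
  have "(\<integral>\<^sup>+x\<in>{a..b}. ennreal ((f x)\<^sup>2) \<partial>lborel) = integral {a..b} (\<lambda>x. (f x)\<^sup>2)"
    by (rule set_nn_integral_lborel_eq_integral)
       (use le in \<open>auto simp: set_borel_measurable_def order.strict_trans1\<close>)
  with le have "ennreal (integral {a..b} (\<lambda>x. (f x)\<^sup>2)) \<le> ennreal (K / m)" by simp
  then show ?thesis using m K by (simp add: m_def ennreal_le_iff)
qed

section \<open>Pointwise Taylor series from Gaussian L2 bounds\<close>

text \<open>Only L2 information on the derivatives is available, so the remainder is taken in
  integral form, which asks for an integral bound on \<open>v (Suc q)\<close> and not for a
  pointwise one. The factorial in the remainder beats the norms, which grow like the square root of
  a factorial.\<close>

lemma taylor_sums_right:
  fixes v :: "nat \<Rightarrow> real \<Rightarrow> real"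
  assumes v: "\<And>k x. (v k has_real_derivative v (Suc k) x) (at x)"
    and bd: "\<And>k. (\<integral>\<^sup>+x. ennreal ((v k x)\<^sup>2) \<partial>std_normal) \<le> ennreal (C * fact k * A ^ k)"
    and C: "C \<ge> 0" and A: "A > 0" and ab: "a \<le> b"
  shows "(\<lambda>k. v k a * (b - a) ^ k / fact k) sums v 0 b"
proof -
  have cont: "continuous_on S (v k)" for k S
    using v by (meson DERIV_continuous_on has_field_derivative_at_within)
  define m where "m = std_normal_density (max \<bar>a\<bar> \<bar>b\<bar>)"
  have m: "m > 0" unfolding m_def by (rule normal_density_pos) simp
  define D where "D = b - a"
  have D: "D \<ge> 0" using ab by (simp add: D_def)
  \<comment> \<open>The threshold \<open>e = B ^ Suc q\<close> below balances two errors: (D B)^q /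
    q! tends to 0 for every \<open>B\<close>, and the factor 2 makes D^q A^(q+1) / e at most
    2^(-q-1), which beats the factor q + 1. Using D + 1 keeps \<open>B\<close> positive when a =
    b.\<close>
  define B where "B = 2 * (D + 1) * A"
  have B: "B > 0" using D A by (simp add: B_def)
  define r where "r q = v 0 b - (\<Sum>k<Suc q. v k a * (b - a) ^ k / fact k)" for q
  have r: "\<bar>r q\<bar> \<le> D * B * ((D * B) ^ q / fact q) + C / m * (real (Suc q) * (1/2) ^ Suc q)" for q
  proof -
    define e where "e = B ^ Suc q"
    have e: "e > 0" using B by (simp add: e_def)
    define h where "h x = ((b - x) ^ q / fact q) *\<^sub>R v (Suc q) x" for x
    define H where "H x = D ^ q / fact q * (e + (v (Suc q) x)\<^sup>2 / e)" for x
    have "v 0 b = (\<Sum>i<Suc q. ((b - a) ^ i / fact i) *\<^sub>R v i a) + integral {a..b} h"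
      unfolding h_def
      using Taylor_integral[of "Suc q" v "v 0" a b] v ab
      by (simp add: has_real_derivative_iff_has_vector_derivative has_vector_derivative_at_within)
    then have "r q = integral {a..b} h" by (simp add: r_def mult.commute)
    also have "norm (integral {a..b} h) \<le> integral {a..b} H"
    proof (rule integral_norm_bound_integral)
      show "h integrable_on {a..b}" unfolding h_def
        by (intro integrable_continuous_real continuous_intros cont) auto
      show "H integrable_on {a..b}" unfolding H_def using e
        by (intro integrable_continuous_real continuous_intros cont) auto
      fix x assume x: "x \<in> {a..b}"
      \<comment> \<open>The bound |y| <= e + y^2 / e stands in for Cauchy-Schwarz and keeps the
        estimate linear in the integral of the square.\<close>
      let ?y = "\<bar>v (Suc q) x\<bar>"
      have "0 \<le> (e - ?y)\<^sup>2" by simp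
      then have "2 * (e * ?y) \<le> e\<^sup>2 + ?y\<^sup>2" by (simp add: power2_diff algebra_simps)
      moreover have "0 \<le> e * ?y" using e by simp
      ultimately have "?y * e \<le> e\<^sup>2 + ?y\<^sup>2" by (simp add: algebra_simps)
      then have "?y \<le> e + (v (Suc q) x)\<^sup>2 / e" using e by (simp add: field_simps power2_eq_square)
      moreover have "(b - x) ^ q / fact q \<le> D ^ q / fact q"
        using x by (intro divide_right_mono power_mono) (auto simp: D_def)
      moreover have "norm (h x) = (b - x) ^ q / fact q * ?y"
        using x by (simp add: h_def abs_mult)
      ultimately show "norm (h x) \<le> H x"
        using x D unfolding H_def by (simp only:) (intro mult_mono, auto)
    qed
    also have "integral {a..b} H = D ^ q / fact q * (e * D + integral {a..b} (\<lambda>x. (v (Suc q) x)\<^sup>2) / e)"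
    proof -
      have "integral {a..b} (\<lambda>x. e + (v (Suc q) x)\<^sup>2 / e) =
          integral {a..b} (\<lambda>x. e) + integral {a..b} (\<lambda>x. (v (Suc q) x)\<^sup>2 / e)"
        by (intro Henstock_Kurzweil_Integration.integral_add integrable_continuous_real continuous_intros cont) (use e in auto)
      then show ?thesis using ab unfolding H_def D_def by (simp add: mult.commute)
    qed
    also have "\<dots> \<le> D ^ q / fact q * (e * D + C * fact (Suc q) * A ^ Suc q / m / e)"
      unfolding m_def using A C e D
      by (intro mult_left_mono add_left_mono divide_right_mono integral_square_le_std_normal bd cont) auto
    also have "\<dots> = D * B * ((D * B) ^ q / fact q) + C / m * (real (Suc q) * (D ^ q * A ^ Suc q / e))"
      using m B unfolding e_def by (simp add: power_mult_distrib field_simps)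
    also have "\<dots> \<le> D * B * ((D * B) ^ q / fact q) + C / m * (real (Suc q) * (1/2) ^ Suc q)"
    proof -
      have "D ^ q \<le> (D + 1) ^ q" using D by (intro power_mono) auto
      also have "\<dots> \<le> (D + 1) ^ Suc q" using D by (intro power_increasing) auto
      finally have "D ^ q * A ^ Suc q \<le> (D + 1) ^ Suc q * A ^ Suc q" using A by (intro mult_right_mono) auto
      also have "\<dots> = (1/2) ^ Suc q * e" 
      proof -
        have "(D + 1) * A = 1/2 * B" by (simp add: B_def)
        then show ?thesis by (simp only: e_def power_mult_distrib[symmetric])
      qed
      finally have "D ^ q * A ^ Suc q / e \<le> (1/2) ^ Suc q" using e by (simp add: field_simps)
      then show ?thesis using C m by (intro add_left_mono mult_left_mono) auto
    qed
    finally show ?thesis by simp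
  qed
  have "r \<longlonglongrightarrow> 0"
  proof (rule Lim_null_comparison)
    show "\<forall>\<^sub>F q in sequentially. norm (r q) \<le>
        D * B * ((D * B) ^ q / fact q) + C / m * (real (Suc q) * (1/2) ^ Suc q)"
      using r by simp
    have 1: "(\<lambda>q. (D * B) ^ q / fact q) \<longlonglongrightarrow> 0"
      using summable_LIMSEQ_zero[OF summable_exp[of "D * B"]] by (simp add: divide_inverse mult.commute)
    have 2: "(\<lambda>q. real (Suc q) * (1/2) ^ Suc q) \<longlonglongrightarrow> 0" by real_asymp
    show "(\<lambda>q. D * B * ((D * B) ^ q / fact q) + C / m * (real (Suc q) * (1/2) ^ Suc q)) \<longlonglongrightarrow> 0"
      by (rule tendsto_add_zero[OF tendsto_mult_right_zero[OF 1] tendsto_mult_right_zero[OF 2]])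
  qed
  then have "(\<lambda>q. v 0 b - r q) \<longlonglongrightarrow> v 0 b" by (auto intro!: tendsto_eq_intros)
  then have "(\<lambda>q. \<Sum>k<Suc q. v k a * (b - a) ^ k / fact k) \<longlonglongrightarrow> v 0 b" by (simp add: r_def)
  then show ?thesis unfolding sums_def by (rule LIMSEQ_imp_Suc)
qed

lemma nn_integral_std_normal_uminus:
  assumes [measurable]: "f \<in> borel_measurable borel"
  shows "(\<integral>\<^sup>+x. f (- x) \<partial>std_normal) = (\<integral>\<^sup>+x. f x \<partial>std_normal)"
proof -
  have "(\<integral>\<^sup>+x. f x \<partial>std_normal) = (\<integral>\<^sup>+x. ennreal (std_normal_density x) * f x \<partial>lborel)"
    by (simp add: nn_integral_density)
  also have "\<dots> = (\<integral>\<^sup>+x. ennreal (std_normal_density (- x)) * f (- x) \<partial>lborel)"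
    by (subst nn_integral_real_affine[where c="-1" and t=0]) auto
  also have "\<dots> = (\<integral>\<^sup>+x. f (- x) \<partial>std_normal)"
    by (simp add: nn_integral_density std_normal_density_def)
  finally show ?thesis by simp
qed

text \<open>Points to the left of a are reached by reflection: (-1)^k v k (-x) is again a chain of
  derivatives, and the Gaussian measure is symmetric.\<close>

lemma taylor_sums:
  fixes v :: "nat \<Rightarrow> real \<Rightarrow> real"
  assumes v: "\<And>k x. (v k has_real_derivative v (Suc k) x) (at x)"
    and bd: "\<And>k. (\<integral>\<^sup>+x. ennreal ((v k x)\<^sup>2) \<partial>std_normal) \<le> ennreal (C * fact k * A ^ k)"
    and C: "C \<ge> 0" and A: "A > 0"
  shows "(\<lambda>k. v k a * (b - a) ^ k / fact k) sums v 0 b"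
proof (cases "a \<le> b")
  case True
  then show ?thesis using taylor_sums_right[OF assms] by blast
next
  case False
  have [measurable]: "v k \<in> borel_measurable borel" for k
    using v by (intro borel_measurable_continuous_onI DERIV_continuous_on) (auto intro: has_field_derivative_at_within)
  define v' where "v' k x = (-1) ^ k * v k (- x)" for k x
  have "(\<lambda>k. v' k (-a) * (- b - (- a)) ^ k / fact k) sums v' 0 (- b)"
  proof (rule taylor_sums_right[OF _ _ C A])
    fix k x
    have "((\<lambda>x. v k (- x)) has_real_derivative v (Suc k) (- x) * (-1)) (at x)"
      by (rule DERIV_chain2[OF v]) (auto intro!: derivative_eq_intros)
    from DERIV_cmult[OF this, of "(-1) ^ k"]
    show "(v' k has_real_derivative v' (Suc k) x) (at x)" unfolding v'_def by simp
    have "(\<integral>\<^sup>+x. ennreal ((v' k x)\<^sup>2) \<partial>std_normal) = (\<integral>\<^sup>+x. ennreal ((v k (- x))\<^sup>2) \<partial>std_normal)"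
      by (simp add: v'_def power_mult_distrib power_mult[symmetric])
    also have "\<dots> = (\<integral>\<^sup>+x. ennreal ((v k x)\<^sup>2) \<partial>std_normal)"
      by (rule nn_integral_std_normal_uminus) measurable
    finally show "(\<integral>\<^sup>+x. ennreal ((v' k x)\<^sup>2) \<partial>std_normal) \<le> ennreal (C * fact k * A ^ k)"
      using bd by simp
  qed (use False in auto)
  moreover have "v' k (-a) * (- b - (- a)) ^ k = v k a * (b - a) ^ k" for k
  proof -
    have "(-1) ^ k * (- b - (- a)) ^ k = (b - a) ^ k"
      unfolding power_mult_distrib[symmetric] by simp
    moreover have "v' k (-a) * (- b - (- a)) ^ k = v k a * ((-1) ^ k * (- b - (- a)) ^ k)"
      by (simp only: v'_def minus_minus ac_simps)
    ultimately show ?thesis by (simp only:)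
  qed
  moreover have "v' 0 (- b) = v 0 b" by (simp add: v'_def)
  ultimately show ?thesis by (simp only:)
qed

interpretation std_normal: prob_space std_normal
  by (rule prob_space_std_normal)

lemma ennreal_abs_sums_le:
  fixes f :: "nat \<Rightarrow> real"
  assumes "f sums s"
  shows "ennreal \<bar>s\<bar> \<le> (\<Sum>k. ennreal \<bar>f k\<bar>)"
proof (rule LIMSEQ_le_const2)
  show "(\<lambda>n. ennreal \<bar>\<Sum>k<n. f k\<bar>) \<longlonglongrightarrow> ennreal \<bar>s\<bar>"
    using assms unfolding sums_def by (intro tendsto_ennrealI tendsto_rabs)
  show "\<exists>N. \<forall>n\<ge>N. ennreal \<bar>\<Sum>k<n. f k\<bar> \<le> (\<Sum>k. ennreal \<bar>f k\<bar>)"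
  proof (intro exI allI impI)
    fix n
    have "ennreal \<bar>\<Sum>k<n. f k\<bar> \<le> (\<Sum>k<n. ennreal \<bar>f k\<bar>)"
      by (simp add: sum_abs ennreal_leI)
    also have "\<dots> \<le> (\<Sum>k. ennreal \<bar>f k\<bar>)" by (rule sum_le_suminf) auto
    finally show "ennreal \<bar>\<Sum>k<n. f k\<bar> \<le> (\<Sum>k. ennreal \<bar>f k\<bar>)" .
  qed
qed

text \<open>These are partial sums of the negative binomial series. Pascal's rule gives S (n+1) <= S
  n + y * S (n+1), so each step of the induction costs a factor 1 / (1 - y).\<close>

lemma sum_choose_power_le:
  fixes y :: real
  assumes y: "0 \<le> y" "y < 1"
  shows "(\<Sum>k<K. real ((n + k) choose n) * y ^ k) \<le> (1 / (1 - y)) ^ Suc n"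
proof (induction n arbitrary: K)
  case 0
  have "(\<Sum>k<K. y ^ k) = (1 - y ^ K) / (1 - y)"
    using y geometric_sum[of y K] by (simp add: field_simps)
  also have "\<dots> \<le> 1 / (1 - y)" using y by (intro divide_right_mono) auto
  finally show ?case by simp
next
  case (Suc n)
  let ?S = "\<lambda>n K. \<Sum>k<K. real ((n + k) choose n) * y ^ k"
  have *: "?S (Suc n) K \<le> ?S n K + y * ?S (Suc n) K"
  proof (cases K)
    case (Suc J)
    have "?S (Suc n) K = ?S n K + (\<Sum>k<K. real ((n + k) choose Suc n) * y ^ k)"
      by (simp add: sum.distrib[symmetric] algebra_simps)
    also have "(\<Sum>k<K. real ((n + k) choose Suc n) * y ^ k) = y * ?S (Suc n) J"
      unfolding Suc sum.lessThan_Suc_shift by (simp add: sum_distrib_left algebra_simps)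
    also have "\<dots> \<le> y * ?S (Suc n) K"
      unfolding Suc using y by (intro mult_left_mono) auto
    finally show ?thesis by simp
  qed simp
  have "(1 - y) * ?S (Suc n) K \<le> ?S n K" using * by (simp add: algebra_simps)
  also have "\<dots> \<le> (1 / (1 - y)) ^ Suc n" by (rule Suc.IH)
  finally have "?S (Suc n) K \<le> (1 / (1 - y)) ^ Suc n / (1 - y)"
    using y by (subst pos_le_divide_eq) (auto simp: mult.commute)
  then show ?case by simp
qed

lemma fact_add_le: "(fact (n + k) :: real) \<le> 2 ^ (n + k) * fact n * fact k"
proof -
  have "(fact (n + k) :: real) = real ((n + k) choose n) * fact n * fact k"
    by (subst binomial_fact) auto
  also have "\<dots> \<le> 2 ^ (n + k) * fact n * fact k"
    using binomial_le_pow2[of "n + k" n] by (intro mult_right_mono) (auto simp flip: of_nat_le_iff)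
  finally show ?thesis .
qed

section \<open>Square-integrable chains of derivatives\<close>

lemma borel_measurable_abs_moment [measurable]: "abs_moment n \<in> borel_measurable borel"
  unfolding abs_moment_def by measurable

text \<open>The argument works for every rate below \<open>1/7\<close> in place of \<open>2/15\<close>.\<close>
locale derivative_chain = prob_space \<nu> for \<nu> :: "'s measure" +
  fixes u :: "nat \<Rightarrow> real \<Rightarrow> 's \<Rightarrow> real" and C :: real
  assumes u_measurable: "(\<lambda>p. u l (fst p) (snd p)) \<in> borel_measurable (borel \<Otimes>\<^sub>M \<nu>)"
    and u_deriv: "((\<lambda>x. u l x r) has_real_derivative u (Suc l) x r) (at x)"
    and u_bound: "(\<integral>\<^sup>+r. \<integral>\<^sup>+x. ennreal ((u l x r)\<^sup>2) \<partial>std_normal \<partial>\<nu>) \<le> ennreal (C * fact l * (2/15) ^ l)"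
    and C_nonneg: "C \<ge> 0"
begin

lemma measurable_u [measurable (raw)]:
  "f \<in> borel_measurable M \<Longrightarrow> h \<in> measurable M \<nu> \<Longrightarrow> (\<lambda>z. u l (f z) (h z)) \<in> borel_measurable M"
  using measurable_compose[OF measurable_Pair u_measurable[of l], of f M h] by simp

lemma measurable_u_section: "(\<lambda>x. u l x r) \<in> borel_measurable borel"
  using u_deriv by (intro borel_measurable_continuous_onI DERIV_continuous_on) (auto intro: has_field_derivative_at_within)

text \<open>Dividing the squared norms by l! and summing over l gives a function of r with finite
  integral, since the rate 2/15 is below 1. Hence almost every r has its own constant K with squared
  norms at most K l!, and one null set serves all n, a and b.\<close>

lemma AE_taylor_sums:
  "AE r in \<nu>. \<forall>n a b. (\<lambda>k. u (n + k) a r * (b - a) ^ k / fact k) sums u n b r"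
proof -
  define b where "b l r = (\<integral>\<^sup>+x. ennreal ((u l x r)\<^sup>2) \<partial>std_normal)" for l r
  have [measurable]: "b l \<in> borel_measurable \<nu>" for l unfolding b_def by measurable
  have "(\<integral>\<^sup>+r. (\<Sum>l. b l r / ennreal (fact l)) \<partial>\<nu>) = (\<Sum>l. \<integral>\<^sup>+r. b l r / ennreal (fact l) \<partial>\<nu>)"
    by (rule nn_integral_suminf) measurable
  also have "\<dots> \<le> (\<Sum>l. ennreal (C * (2/15) ^ l))"
  proof (intro suminf_le)
    fix l
    have "(\<integral>\<^sup>+r. b l r / ennreal (fact l) \<partial>\<nu>) = (\<integral>\<^sup>+r. b l r \<partial>\<nu>) / ennreal (fact l)"
      by (rule nn_integral_divide) measurable
    also have "\<dots> \<le> ennreal (C * fact l * (2/15) ^ l) / ennreal (fact l)"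
      unfolding b_def by (intro divide_right_mono_ennreal u_bound)
    also have "\<dots> = ennreal (C * (2/15) ^ l)"
      using C_nonneg by (subst divide_ennreal) auto
    finally show "(\<integral>\<^sup>+r. b l r / ennreal (fact l) \<partial>\<nu>) \<le> ennreal (C * (2/15) ^ l)" .
  qed auto
  also have "\<dots> < \<infinity>"
    using C_nonneg by (subst suminf_ennreal_eq) (auto intro!: sums_mult geometric_sums)
  finally have "(\<integral>\<^sup>+r. (\<Sum>l. b l r / ennreal (fact l)) \<partial>\<nu>) \<noteq> \<infinity>" by simp
  then have "AE r in \<nu>. (\<Sum>l. b l r / ennreal (fact l)) \<noteq> \<infinity>"
    by (intro nn_integral_PInf_AE) measurable
  then show ?thesis
  proof eventually_elim
    case (elim r)
    then obtain K where K: "K \<ge> 0" "(\<Sum>l. b l r / ennreal (fact l)) = ennreal K"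
      by (metis ennreal_cases infinity_ennreal_def)
    have bl: "b l r \<le> ennreal (K * fact l)" for l
    proof -
      have "sum (\<lambda>l. b l r / ennreal (fact l)) {l} \<le> ennreal K"
        unfolding K(2)[symmetric] by (rule sum_le_suminf) auto
      then have "b l r / ennreal (fact l) * ennreal (fact l) \<le> ennreal K * ennreal (fact l)"
        by (intro mult_right_mono) auto
      then show ?thesis using K by (simp add: ennreal_divide_times ennreal_mult ennreal_divide_self)
    qed
    show ?case
    proof (intro allI)
      fix n x y
      show "(\<lambda>k. u (n + k) x r * (y - x) ^ k / fact k) sums u n y r"
      \<comment> \<open>For the chain started at n, (n+k)! <= 2^(n+k) n! k! raises the rate from 1
        to 2. This is harmless, because the pointwise Taylor series tolerates any
        \<open>A\<close>.\<close>
      proof (rule taylor_sums[where v="\<lambda>k x. u (n + k) x r" and C="K * 2 ^ n * fact n" and A=2, simplified])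
        show "((\<lambda>x. u (n + k) x r) has_real_derivative u (Suc (n + k)) x r) (at x)" for k x
          by (rule u_deriv)
        fix k
        have "b (n + k) r \<le> ennreal (K * fact (n + k))" by (rule bl)
        also have "\<dots> \<le> ennreal (K * (2 ^ (n + k) * fact n * fact k))"
          by (intro ennreal_leI mult_left_mono fact_add_le K)
        also have "K * (2 ^ (n + k) * fact n * fact k) = K * 2 ^ n * fact n * fact k * 2 ^ k"
          by (simp add: power_add)
        finally show "(\<integral>\<^sup>+x. ennreal ((u (n + k) x r)\<^sup>2) \<partial>std_normal) \<le> ennreal (K * 2 ^ n * fact n * fact k * 2 ^ k)"
          by (simp add: b_def)
      qed (use K in auto)
    qed
  qed
qed

text \<open>The sum over k of C n! (2/15)^n binom(n+k,n) (4/15)^k, where 15/11 = 1 / (1 -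
  4/15).\<close>

definition tail_const :: "nat \<Rightarrow> real" where
  "tail_const n = C * fact n * (2/15) ^ n * (15/11) ^ Suc n"

text \<open>Taylor expansion about x followed by weighted Cauchy-Schwarz. The weights (s^2/2)^k / k!
  cancel the powers of s, so s survives only in their sum exp(s^2/2); they are positive because s is
  nonzero. What remains is 2^k / k! times the squared norm of \<open>u (n + k)\<close>.\<close>

lemma nn_integral_shift_le:
  assumes s: "s \<noteq> 0"
  shows "(\<integral>\<^sup>+r. \<integral>\<^sup>+x. ennreal ((u n (x + s) r)\<^sup>2) \<partial>std_normal \<partial>\<nu>) \<le>
    ennreal (exp (s\<^sup>2 / 2) * tail_const n)"
proof -
  \<comment> \<open>The exponential weights turn the bound into the series \<open>\<Sum>k. binom(n+k,n) (4/15)^k\<close>.\<close>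
  define w where "w k = (s\<^sup>2 / 2) ^ k / fact k" for k
  have w: "w k > 0" for k using s by (simp add: w_def)
  have ws: "w sums exp (s\<^sup>2 / 2)"
    unfolding w_def using exp_converges[of "s\<^sup>2 / 2"] by (simp add: field_simps)
  define T where "T k x r = \<bar>u (n + k) x r\<bar> * \<bar>s\<bar> ^ k / fact k" for k x r
  have T_nonneg: "T k x r \<ge> 0" for k x r by (simp add: T_def)
  have [measurable]: "(\<lambda>x. u k x r) \<in> borel_measurable borel" for k r by (rule measurable_u_section)
  have "AE r in \<nu>. \<forall>x. ennreal ((u n (x + s) r)\<^sup>2) \<le> ennreal (exp (s\<^sup>2 / 2)) * (\<Sum>k. ennreal ((T k x r)\<^sup>2 / w k))"
    using AE_taylor_sums
  proof eventually_elim
    case (elim r)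
    show ?case
    proof
      fix x
      have "(\<lambda>k. u (n + k) x r * (x + s - x) ^ k / fact k) sums u n (x + s) r"
        using elim by blast
      then have "ennreal \<bar>u n (x + s) r\<bar> \<le> (\<Sum>k. ennreal \<bar>u (n + k) x r * (x + s - x) ^ k / fact k\<bar>)"
        by (rule ennreal_abs_sums_le)
      also have "\<dots> = (\<Sum>k. ennreal (T k x r))"
        by (simp add: T_def abs_mult power_abs)
      finally have "(ennreal \<bar>u n (x + s) r\<bar>)\<^sup>2 \<le> (\<Sum>k. ennreal (T k x r))\<^sup>2"
        by (intro power_mono) auto
      also have "\<dots> \<le> ennreal (suminf w) * (\<Sum>k. ennreal ((T k x r)\<^sup>2 / w k))"
        by (rule suminf_square_le) (use w ws T_nonneg in \<open>auto simp: sums_iff\<close>)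
      finally show "ennreal ((u n (x + s) r)\<^sup>2) \<le> ennreal (exp (s\<^sup>2 / 2)) * (\<Sum>k. ennreal ((T k x r)\<^sup>2 / w k))"
        using ws by (simp add: sums_iff ennreal_power)
    qed
  qed
  then have "(\<integral>\<^sup>+r. \<integral>\<^sup>+x. ennreal ((u n (x + s) r)\<^sup>2) \<partial>std_normal \<partial>\<nu>) \<le>
      (\<integral>\<^sup>+r. \<integral>\<^sup>+x. ennreal (exp (s\<^sup>2 / 2)) * (\<Sum>k. ennreal ((T k x r)\<^sup>2 / w k)) \<partial>std_normal \<partial>\<nu>)"
    by (intro nn_integral_mono_AE) (auto elim!: eventually_mono intro!: nn_integral_mono)
  also have "\<dots> = ennreal (exp (s\<^sup>2 / 2)) * (\<Sum>k. \<integral>\<^sup>+r. \<integral>\<^sup>+x. ennreal ((T k x r)\<^sup>2 / w k) \<partial>std_normal \<partial>\<nu>)"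
    unfolding T_def by (simp add: nn_integral_cmult nn_integral_suminf)
  also have "\<dots> \<le> ennreal (exp (s\<^sup>2 / 2)) * ennreal (tail_const n)"
  proof (rule mult_left_mono)
    have "(\<integral>\<^sup>+r. \<integral>\<^sup>+x. ennreal ((T k x r)\<^sup>2 / w k) \<partial>std_normal \<partial>\<nu>) \<le>
        ennreal (C * fact n * (2/15) ^ n * (real ((n + k) choose n) * (4/15) ^ k))" for k
    proof -
      have s2: "(\<bar>s\<bar> ^ k)\<^sup>2 = (s\<^sup>2) ^ k" by (simp add: power_mult[symmetric] mult.commute power_even_abs)
      have "(T k x r)\<^sup>2 / w k = 2 ^ k / fact k * (u (n + k) x r)\<^sup>2" for x r
        unfolding T_def w_def power_divide power_mult_distrib s2 using s
        by (simp add: power2_eq_square)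
      moreover have "(0::real) \<le> 2 ^ k / fact k" by simp
      ultimately have "(\<integral>\<^sup>+r. \<integral>\<^sup>+x. ennreal ((T k x r)\<^sup>2 / w k) \<partial>std_normal \<partial>\<nu>) =
          (\<integral>\<^sup>+r. \<integral>\<^sup>+x. ennreal (2 ^ k / fact k) * ennreal ((u (n + k) x r)\<^sup>2) \<partial>std_normal \<partial>\<nu>)"
        by (simp only: ennreal_mult')
      also have "\<dots> = ennreal (2 ^ k / fact k) * (\<integral>\<^sup>+r. \<integral>\<^sup>+x. ennreal ((u (n + k) x r)\<^sup>2) \<partial>std_normal \<partial>\<nu>)"
        by (simp add: nn_integral_cmult)
      also have "\<dots> \<le> ennreal (2 ^ k / fact k) * ennreal (C * fact (n + k) * (2/15) ^ (n + k))"
        by (intro mult_left_mono u_bound) auto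
      also have "\<dots> = ennreal (2 ^ k / fact k * (C * fact (n + k) * (2/15) ^ (n + k)))"
        by (rule ennreal_mult'[symmetric]) auto
      also have "2 ^ k / fact k * (C * fact (n + k) * (2/15) ^ (n + k)) =
          C * fact n * (2/15) ^ n * (real ((n + k) choose n) * (4/15) ^ k)"
      proof -
        have "(4/15 :: real) ^ k = 2 ^ k * (2/15) ^ k" by (simp add: power_mult_distrib[symmetric])
        then show ?thesis by (subst binomial_fact) (auto simp: power_add)
      qed
      finally show ?thesis .
    qed
    then have "(\<Sum>k. \<integral>\<^sup>+r. \<integral>\<^sup>+x. ennreal ((T k x r)\<^sup>2 / w k) \<partial>std_normal \<partial>\<nu>) \<le>
        (\<Sum>k. ennreal (C * fact n * (2/15) ^ n * (real ((n + k) choose n) * (4/15) ^ k)))"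
      by (intro suminf_le) auto
    also have "\<dots> \<le> ennreal (tail_const n)"
    proof (rule suminf_le_const)
      fix K
      have "(\<Sum>k<K. ennreal (C * fact n * (2/15) ^ n * (real ((n + k) choose n) * (4/15) ^ k))) =
          ennreal (C * fact n * (2/15) ^ n * (\<Sum>k<K. real ((n + k) choose n) * (4/15) ^ k))"
        using C_nonneg by (simp add: sum_distrib_left)
      also have "\<dots> \<le> ennreal (tail_const n)"
        unfolding tail_const_def
        using sum_choose_power_le[of "4/15" n K] C_nonneg by (intro ennreal_leI mult_left_mono) auto
      finally show "(\<Sum>k<K. ennreal (C * fact n * (2/15) ^ n * (real ((n + k) choose n) * (4/15) ^ k))) \<le>
          ennreal (tail_const n)" .
    qed auto
    finally show "(\<Sum>k. \<integral>\<^sup>+r. \<integral>\<^sup>+x. ennreal ((T k x r)\<^sup>2 / w k) \<partial>std_normal \<partial>\<nu>) \<le> ennreal (tail_const n)" .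
  qed auto
  also have "\<dots> = ennreal (exp (s\<^sup>2 / 2) * tail_const n)" by (rule ennreal_mult'[symmetric]) auto
  finally show ?thesis .
qed

text \<open>One factor exp(s^2/2) comes from moving the Gaussian, the other from the weights in the
  expansion of the translate.\<close>

lemma nn_integral_exp_weight_le:
  assumes s: "s \<noteq> 0"
  shows "(\<integral>\<^sup>+r. \<integral>\<^sup>+x. ennreal (exp (s * x)) * ennreal ((u n x r)\<^sup>2) \<partial>std_normal \<partial>\<nu>) \<le>
    ennreal (exp (s\<^sup>2) * tail_const n)"
proof -
  have [measurable]: "(\<lambda>x. u k x r) \<in> borel_measurable borel" for k r by (rule measurable_u_section)
  have "(\<integral>\<^sup>+r. \<integral>\<^sup>+x. ennreal (exp (s * x)) * ennreal ((u n x r)\<^sup>2) \<partial>std_normal \<partial>\<nu>) =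
      (\<integral>\<^sup>+r. ennreal (exp (s\<^sup>2 / 2)) * (\<integral>\<^sup>+x. ennreal ((u n (x + s) r)\<^sup>2) \<partial>std_normal) \<partial>\<nu>)"
    by (intro nn_integral_cong nn_integral_std_normal_exp) measurable
  also have "\<dots> = ennreal (exp (s\<^sup>2 / 2)) * (\<integral>\<^sup>+r. \<integral>\<^sup>+x. ennreal ((u n (x + s) r)\<^sup>2) \<partial>std_normal \<partial>\<nu>)"
    by (rule nn_integral_cmult) measurable
  also have "\<dots> \<le> ennreal (exp (s\<^sup>2 / 2)) * ennreal (exp (s\<^sup>2 / 2) * tail_const n)"
    by (intro mult_left_mono nn_integral_shift_le s) auto
  also have "\<dots> = ennreal (exp (s\<^sup>2 / 2) * exp (s\<^sup>2 / 2) * tail_const n)"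
    by (simp add: ennreal_mult'[symmetric] mult.assoc)
  finally show ?thesis by (simp add: exp_add[symmetric])
qed

text \<open>Squaring the exponential bound on \<open>abs_moment\<close> gives exp(s^2) and the
  weights exp(2 s x) and exp(-2 s x). The weighted estimate at 2 s and -2 s contributes exp(4 s^2),
  whence the exponent 5 s^2.\<close>

lemma nn_integral_abs_moment_le:
  assumes s: "s > 0"
  shows "(\<integral>\<^sup>+r. \<integral>\<^sup>+x. (abs_moment n x)\<^sup>2 * ennreal ((u n x r)\<^sup>2) \<partial>std_normal \<partial>\<nu>) \<le>
    ennreal (4 * exp (5 * s\<^sup>2) / s ^ (2 * n) * tail_const n)"
proof -
  have [measurable]: "(\<lambda>x. u k x r) \<in> borel_measurable borel" for k r by (rule measurable_u_section)
  define c where "c = 2 * exp (s\<^sup>2) / s ^ (2 * n)"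
  have c: "c \<ge> 0" using s by (simp add: c_def)
  have "(abs_moment n x)\<^sup>2 \<le> ennreal c * (ennreal (exp (2 * s * x)) + ennreal (exp (- (2 * s) * x)))" for x
  proof -
    have "(abs_moment n x)\<^sup>2 \<le> (ennreal (exp (s\<^sup>2 / 2) / s ^ n * (exp (s * x) + exp (- (s * x)))))\<^sup>2"
      by (intro power_mono abs_moment_le s) auto
    also have "\<dots> = ennreal ((exp (s\<^sup>2 / 2) / s ^ n * (exp (s * x) + exp (- (s * x))))\<^sup>2)"
      using s by (intro ennreal_power) (auto intro!: mult_nonneg_nonneg add_nonneg_nonneg)
    also have "(exp (s\<^sup>2 / 2) / s ^ n * (exp (s * x) + exp (- (s * x))))\<^sup>2 =
        exp (s\<^sup>2) / s ^ (2 * n) * (exp (s * x) + exp (- (s * x)))\<^sup>2"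
      by (simp add: power_mult_distrib power_divide exp_double[symmetric] power_mult[symmetric] mult.commute)
    also have "\<dots> \<le> exp (s\<^sup>2) / s ^ (2 * n) * (2 * (exp (2 * s * x) + exp (- (2 * s) * x)))"
    proof (intro mult_left_mono)
      have "(exp (s * x) + exp (- (s * x)))\<^sup>2 \<le> 2 * ((exp (s * x))\<^sup>2 + (exp (- (s * x)))\<^sup>2)"
        using zero_le_power2[of "exp (s * x) - exp (- (s * x))"]
        by (simp add: power2_sum power2_diff)
      then show "(exp (s * x) + exp (- (s * x)))\<^sup>2 \<le> 2 * (exp (2 * s * x) + exp (- (2 * s) * x))"
        by (simp add: exp_double[symmetric] mult.assoc)
    qed (use s in auto)
    also have "\<dots> = c * (exp (2 * s * x) + exp (- (2 * s) * x))" by (simp add: c_def)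
    finally show ?thesis
      using c by (simp add: ennreal_mult' ennreal_leI)
  qed
  then have "(\<integral>\<^sup>+r. \<integral>\<^sup>+x. (abs_moment n x)\<^sup>2 * ennreal ((u n x r)\<^sup>2) \<partial>std_normal \<partial>\<nu>) \<le>
      (\<integral>\<^sup>+r. \<integral>\<^sup>+x. ennreal c * (ennreal (exp (2 * s * x)) + ennreal (exp (- (2 * s) * x))) * ennreal ((u n x r)\<^sup>2) \<partial>std_normal \<partial>\<nu>)"
    by (intro nn_integral_mono mult_right_mono) auto
  also have "\<dots> = ennreal c *
      ((\<integral>\<^sup>+r. \<integral>\<^sup>+x. ennreal (exp (2 * s * x)) * ennreal ((u n x r)\<^sup>2) \<partial>std_normal \<partial>\<nu>) +
       (\<integral>\<^sup>+r. \<integral>\<^sup>+x. ennreal (exp (- (2 * s) * x)) * ennreal ((u n x r)\<^sup>2) \<partial>std_normal \<partial>\<nu>))"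
    by (simp add: mult.assoc nn_integral_cmult nn_integral_add distrib_right)
  also have "\<dots> \<le> ennreal c * (ennreal (exp ((2 * s)\<^sup>2) * tail_const n) + ennreal (exp ((- (2 * s))\<^sup>2) * tail_const n))"
    using s by (intro mult_left_mono add_mono nn_integral_exp_weight_le) auto
  also have "\<dots> = ennreal (c * (2 * (exp (4 * s\<^sup>2) * tail_const n)))"
    using c C_nonneg by (simp add: ennreal_mult'[symmetric] tail_const_def flip: ennreal_plus)
  also have "c * (2 * (exp (4 * s\<^sup>2) * tail_const n)) = 4 * exp (5 * s\<^sup>2) / s ^ (2 * n) * tail_const n"
  proof -
    have "exp (5 * s\<^sup>2) = exp (s\<^sup>2) * exp (4 * s\<^sup>2)" by (simp add: exp_add[symmetric])
    then show ?thesis by (simp add: c_def)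
  qed
  finally show ?thesis .
qed

text \<open>The choice s^2 = n/5 minimises exp(5 s^2) / s^(2 n) and turns it into (5 e / n)^n.
  Stirling cancels this against n! up to a factor of order n, leaving the rate 5 * (2/15) * (15/11)
  = 10/11.\<close>

lemma nn_integral_abs_moment_geometric:
  obtains K where "K \<ge> 0" "\<And>n. (\<integral>\<^sup>+r. \<integral>\<^sup>+x. (abs_moment n x)\<^sup>2 * ennreal ((u n x r)\<^sup>2) \<partial>std_normal \<partial>\<nu>) \<le>
    ennreal (K * (real n + 1) * (10/11) ^ n)"
proof
  \<comment> \<open>The factor exp 5 is dictated by n = 0, where s = n/5 is not positive in the
    square and s = 1 is taken instead.\<close>
  define K where "K = 4 * exp 5 * C * 15/11"
  show "K \<ge> 0" using C_nonneg by (simp add: K_def)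
  fix n
  show "(\<integral>\<^sup>+r. \<integral>\<^sup>+x. (abs_moment n x)\<^sup>2 * ennreal ((u n x r)\<^sup>2) \<partial>std_normal \<partial>\<nu>) \<le>
    ennreal (K * (real n + 1) * (10/11) ^ n)"
  proof (cases "n = 0")
    case True
    then show ?thesis using nn_integral_abs_moment_le[of 1 0] by (simp add: K_def tail_const_def)
  next
    case False
    define s where "s = sqrt (real n / 5)"
    have s: "s > 0" and s2: "s\<^sup>2 = real n / 5" using False by (auto simp: s_def)
    have "4 * exp (5 * s\<^sup>2) / s ^ (2 * n) * tail_const n =
        4 * C * 15/11 * (exp (real n) * 5 ^ n / real n ^ n * (2/15) ^ n * (15/11) ^ n * fact n)"
      unfolding power_mult s2 tail_const_def by (simp add: power_divide ac_simps)
    also have "exp (real n) * 5 ^ n / real n ^ n * (2/15) ^ n * (15/11) ^ n * fact n =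
        (10/11) ^ n * (fact n * (exp 1 / real n) ^ n)"
    proof -
      have 1: "(10/11 :: real) ^ n = 5 ^ n * (2/15) ^ n * (15/11) ^ n"
        by (simp only: power_mult_distrib[symmetric]) simp
      have 2: "exp (real n) = exp 1 ^ n" using exp_of_nat_mult[of n 1] by simp
      show ?thesis unfolding 1 2 power_divide[of "exp 1" "real n"]
        by (simp only: times_divide_eq_right times_divide_eq_left mult_ac)
    qed
    finally have eq: "4 * exp (5 * s\<^sup>2) / s ^ (2 * n) * tail_const n =
        4 * C * 15/11 * ((10/11) ^ n * (fact n * (exp 1 / real n) ^ n))" .
    have "fact n * (exp 1 / real n) ^ n \<le> exp 1 * real n * (real n / exp 1) ^ n * (exp 1 / real n) ^ n"
      using False by (intro mult_right_mono fact_le_stirling) auto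
    also have "\<dots> = exp 1 * real n * ((real n / exp 1) * (exp 1 / real n)) ^ n"
      by (simp only: power_mult_distrib mult.assoc)
    also have "\<dots> = exp 1 * real n" using False by simp
    also have "\<dots> \<le> exp 5 * (real n + 1)" by (intro mult_mono) auto
    finally have le: "fact n * (exp 1 / real n) ^ n \<le> exp 5 * (real n + 1)" .
    have "4 * C * 15/11 * ((10/11) ^ n * (fact n * (exp 1 / real n) ^ n)) \<le>
        4 * C * 15/11 * ((10/11) ^ n * (exp 5 * (real n + 1)))"
      using C_nonneg by (intro mult_left_mono le) auto
    also have "\<dots> = K * (real n + 1) * (10/11) ^ n" by (simp add: K_def)
    finally have "ennreal (4 * exp (5 * s\<^sup>2) / s ^ (2 * n) * tail_const n) \<le> ennreal (K * (real n + 1) * (10/11) ^ n)"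
      unfolding eq by (rule ennreal_leI)
    with nn_integral_abs_moment_le[OF s, of n] show ?thesis by (rule order_trans)
  qed
qed

end

text \<open>The signed counterpart of \<open>abs_moment\<close>. Up to the factor sqrt \<Delta>^n it
  is gamma(m,n) as a function of the standardised increment.\<close>

definition taylor_weight :: "nat \<Rightarrow> real \<Rightarrow> real" where
  "taylor_weight n x = (\<integral>z. (z - x) ^ n / fact n \<partial>std_normal)"

lemma borel_measurable_taylor_weight [measurable]: "taylor_weight n \<in> borel_measurable borel"
  unfolding taylor_weight_def by measurable

lemma abs_moment_finite: "abs_moment n x < \<infinity>"
  by (rule order.strict_trans1[OF abs_moment_le[of 1]]) auto

lemma integrable_taylor_weight: "integrable std_normal (\<lambda>z. (z - x) ^ n / fact n)"
  using abs_moment_finite[of n x]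
  by (intro integrableI_bounded) (auto simp: abs_moment_def power_abs abs_mult)

lemma ennreal_taylor_weight_le: "ennreal \<bar>taylor_weight n x\<bar> \<le> abs_moment n x"
  unfolding taylor_weight_def abs_moment_def
  using integral_norm_bound_ennreal[OF integrable_taylor_weight, of x n]
  by (simp add: power_abs abs_mult)

lemma taylor_weight_le: "\<bar>taylor_weight n x\<bar> \<le> enn2real (abs_moment n x)"
  using enn2real_mono[OF ennreal_taylor_weight_le] abs_moment_finite[of n x] by simp

section \<open>Averaged Taylor expansion and its remainder\<close>

context derivative_chain
begin

text \<open>The rate splits as 10/11 = (20/21) * (21/22). The first factor pays for the geometric
  Cauchy-Schwarz weights, whose sum is 21, and leaves (20/21)^n; the second keeps the sum of (j + 1)
  (21/22)^j finite.\<close>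

lemma nn_integral_tail_le:
  obtains K where "K \<ge> 0"
    "\<And>n. (\<integral>\<^sup>+r. \<integral>\<^sup>+x. (\<Sum>l. ennreal (enn2real (abs_moment (l + n) x) * \<bar>u (l + n) x r\<bar>))\<^sup>2 \<partial>std_normal \<partial>\<nu>) \<le>
      ennreal (K * (20/21) ^ n)"
proof -
  obtain K where K: "K \<ge> 0" "\<And>n. (\<integral>\<^sup>+r. \<integral>\<^sup>+x. (abs_moment n x)\<^sup>2 * ennreal ((u n x r)\<^sup>2) \<partial>std_normal \<partial>\<nu>) \<le>
    ennreal (K * (real n + 1) * (10/11) ^ n)"
    using nn_integral_abs_moment_geometric by blast
  have [measurable]: "(\<lambda>x. u k x r) \<in> borel_measurable borel" for k r by (rule measurable_u_section)
  define w :: "nat \<Rightarrow> real" where "w l = (20/21) ^ l" for l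
  have w: "w l > 0" for l by (simp add: w_def)
  have ws: "w sums 21" unfolding w_def using geometric_sums[of "20/21::real"] by simp
  define q :: "nat \<Rightarrow> real" where "q j = K * ((real j + 1) * (21/22) ^ j)" for j
  have q: "q j \<ge> 0" for j using K by (simp add: q_def)
  have qs: "summable q"
    unfolding q_def using geometric_deriv_sums[of "21/22::real"]
    by (intro summable_mult) (auto simp: sums_iff add.commute)
  define a where "a l x r = enn2real (abs_moment l x) * \<bar>u l x r\<bar>" for l x r
  have a0: "a l x r \<ge> 0" for l x r by (simp add: a_def)
  have [measurable]: "(\<lambda>x. a l x r) \<in> borel_measurable borel" for l r unfolding a_def by measurable
  have am [measurable (raw)]: "(\<lambda>z. a l (f z) (h z)) \<in> borel_measurable M"
    if [measurable]: "f \<in> borel_measurable M" "h \<in> measurable M \<nu>" for l f h and M :: "'z measure" unfolding a_def by measurable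
  have bound: "(\<integral>\<^sup>+r. \<integral>\<^sup>+x. (\<Sum>l. ennreal (a (l + n) x r))\<^sup>2 \<partial>std_normal \<partial>\<nu>) \<le> ennreal (21 * suminf q * (20/21) ^ n)" for n
  proof -
    have "(\<integral>\<^sup>+r. \<integral>\<^sup>+x. (\<Sum>l. ennreal (a (l + n) x r))\<^sup>2 \<partial>std_normal \<partial>\<nu>) \<le>
        (\<integral>\<^sup>+r. \<integral>\<^sup>+x. ennreal 21 * (\<Sum>l. ennreal ((a (l + n) x r)\<^sup>2 / w l)) \<partial>std_normal \<partial>\<nu>)"
    proof (intro nn_integral_mono)
      fix r x
      show "(\<Sum>l. ennreal (a (l + n) x r))\<^sup>2 \<le> ennreal 21 * (\<Sum>l. ennreal ((a (l + n) x r)\<^sup>2 / w l))"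
        using suminf_square_le[OF a0 w sums_summable[OF ws], of "\<lambda>l. l + n" "\<lambda>l. x" "\<lambda>l. r"]
        unfolding sums_unique[OF ws, symmetric] .
    qed
    also have "\<dots> = ennreal 21 * (\<Sum>l. \<integral>\<^sup>+r. \<integral>\<^sup>+x. ennreal ((a (l + n) x r)\<^sup>2 / w l) \<partial>std_normal \<partial>\<nu>)"
      by (simp add: nn_integral_cmult nn_integral_suminf)
    also have "\<dots> \<le> ennreal 21 * (\<Sum>l. ennreal ((20/21) ^ n * q (l + n)))"
    proof (intro mult_left_mono suminf_le)
      fix l
      let ?j = "l + n"
      have "(\<integral>\<^sup>+r. \<integral>\<^sup>+x. ennreal ((a ?j x r)\<^sup>2 / w l) \<partial>std_normal \<partial>\<nu>) =
          (\<integral>\<^sup>+r. \<integral>\<^sup>+x. ennreal (1 / w l) * ((abs_moment ?j x)\<^sup>2 * ennreal ((u ?j x r)\<^sup>2)) \<partial>std_normal \<partial>\<nu>)"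
      proof (intro nn_integral_cong)
        fix x r
        have "(abs_moment ?j x)\<^sup>2 * ennreal ((u ?j x r)\<^sup>2) = ennreal ((a ?j x r)\<^sup>2)"
        proof -
          have "abs_moment ?j x = ennreal (enn2real (abs_moment ?j x))"
            using abs_moment_finite[of ?j x] by simp
          then have "(abs_moment ?j x)\<^sup>2 = ennreal ((enn2real (abs_moment ?j x))\<^sup>2)"
            by (metis enn2real_nonneg ennreal_power)
          then show ?thesis by (simp add: a_def power_mult_distrib ennreal_mult')
        qed
        then show "ennreal ((a ?j x r)\<^sup>2 / w l) = ennreal (1 / w l) * ((abs_moment ?j x)\<^sup>2 * ennreal ((u ?j x r)\<^sup>2))"
          using w[of l] by (simp add: ennreal_mult'[symmetric])
      qed
      also have "\<dots> = ennreal (1 / w l) * (\<integral>\<^sup>+r. \<integral>\<^sup>+x. (abs_moment ?j x)\<^sup>2 * ennreal ((u ?j x r)\<^sup>2) \<partial>std_normal \<partial>\<nu>)"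
        by (simp add: nn_integral_cmult)
      also have "\<dots> \<le> ennreal (1 / w l) * ennreal (K * (real ?j + 1) * (10/11) ^ ?j)"
        by (intro mult_left_mono K) auto
      also have "\<dots> = ennreal (1 / w l * (K * (real ?j + 1) * (10/11) ^ ?j))"
        using w[of l] by (intro ennreal_mult'[symmetric]) auto
      also have "1 / w l * (K * (real ?j + 1) * (10/11) ^ ?j) = (20/21) ^ n * q ?j"
      proof -
        have 1: "(10/11 :: real) ^ ?j = (21/22) ^ ?j * (20/21) ^ ?j"
          by (simp only: power_mult_distrib[symmetric]) simp
        show ?thesis unfolding 1 q_def w_def by (simp add: power_add)
      qed
      finally show "(\<integral>\<^sup>+r. \<integral>\<^sup>+x. ennreal ((a ?j x r)\<^sup>2 / w l) \<partial>std_normal \<partial>\<nu>) \<le> ennreal ((20/21) ^ n * q ?j)" .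
    qed auto
    also have "\<dots> = ennreal 21 * ennreal (\<Sum>l. (20/21) ^ n * q (l + n))"
      using q qs by (subst suminf_ennreal2) (auto intro!: summable_mult simp: summable_iff_shift)
    also have "\<dots> = ennreal (21 * (\<Sum>l. (20/21) ^ n * q (l + n)))"
      by (rule ennreal_mult'[symmetric]) auto
    also have "\<dots> \<le> ennreal (21 * suminf q * (20/21) ^ n)"
    proof (rule ennreal_leI)
      have "(\<Sum>l. q (l + n)) \<le> suminf q"
        using suminf_split_initial_segment[OF qs, of n] q by (simp add: sum_nonneg)
      then have "(20/21) ^ n * (\<Sum>l. q (l + n)) \<le> (20/21) ^ n * suminf q"
        by (rule mult_left_mono) auto
      moreover have "(\<Sum>l. (20/21) ^ n * q (l + n)) = (20/21) ^ n * (\<Sum>l. q (l + n))"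
        using qs by (intro suminf_mult) (auto simp: summable_iff_shift)
      ultimately show "21 * (\<Sum>l. (20/21) ^ n * q (l + n)) \<le> 21 * suminf q * (20/21) ^ n"
        by (simp add: mult.commute mult.left_commute)
    qed
    finally show ?thesis .
  qed
  show thesis
    by (rule that[of "21 * suminf q"]) (use bound[unfolded a_def] qs q in \<open>auto simp: suminf_nonneg\<close>)
qed

text \<open>The Taylor series about x is integrated term by term over its endpoint z. Its majorant
  after integration is the series of \<open>abs_moment\<close> times the derivative, which the tail
  estimate for n = 0 makes finite almost everywhere.\<close>

lemma AE_expansion:
  "AE r in \<nu>. AE x in std_normal. summable (\<lambda>l. enn2real (abs_moment l x) * \<bar>u l x r\<bar>) \<and>
    (\<lambda>l. taylor_weight l x * u l x r) sums (\<integral>z. u 0 z r \<partial>std_normal)"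
proof -
  obtain K where K: "K \<ge> 0"
    "\<And>n. (\<integral>\<^sup>+r. \<integral>\<^sup>+x. (\<Sum>l. ennreal (enn2real (abs_moment (l + n) x) * \<bar>u (l + n) x r\<bar>))\<^sup>2 \<partial>std_normal \<partial>\<nu>) \<le>
      ennreal (K * (20/21) ^ n)"
    using nn_integral_tail_le by blast
  have [measurable]: "(\<lambda>x. u k x r) \<in> borel_measurable borel" for k r by (rule measurable_u_section)
  have fin: "(\<integral>\<^sup>+r. \<integral>\<^sup>+x. (\<Sum>l. ennreal (enn2real (abs_moment l x) * \<bar>u l x r\<bar>))\<^sup>2 \<partial>std_normal \<partial>\<nu>) \<noteq> \<infinity>"
    using K(2)[of 0] by (auto simp: top_unique)
  have "AE r in \<nu>. (\<integral>\<^sup>+x. (\<Sum>l. ennreal (enn2real (abs_moment l x) * \<bar>u l x r\<bar>))\<^sup>2 \<partial>std_normal) \<noteq> \<infinity>"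
    by (rule nn_integral_PInf_AE[OF _ fin]) measurable
  then show ?thesis using AE_taylor_sums
  proof eventually_elim
    case (elim r)
    have "AE x in std_normal. (\<Sum>l. ennreal (enn2real (abs_moment l x) * \<bar>u l x r\<bar>))\<^sup>2 \<noteq> \<infinity>"
      by (rule nn_integral_PInf_AE[OF _ elim(1)]) measurable
    then show ?case
    proof eventually_elim
      case (elim x)
      have "(\<Sum>l. ennreal (enn2real (abs_moment l x) * \<bar>u l x r\<bar>)) \<noteq> top"
        using elim by (auto simp: power2_eq_square)
      then have summ: "summable (\<lambda>l. enn2real (abs_moment l x) * \<bar>u l x r\<bar>)"
        by (intro summable_suminf_not_top) auto
      have taylor: "(\<lambda>l. u l x r / fact l * (z - x) ^ l) sums u 0 z r" for z
        using \<open>\<forall>n a b. (\<lambda>k. u (n + k) a r * (b - a) ^ k / fact k) sums u n b r\<close>[rule_format, of 0 x z] by simp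
      have int: "integrable std_normal (\<lambda>z. u l x r / fact l * (z - x) ^ l)" for l
        using integrable_mult_right[OF integrable_taylor_weight[of x l], of "u l x r"] by simp
      have nint: "(\<integral>z. norm (u l x r / fact l * (z - x) ^ l) \<partial>std_normal) = enn2real (abs_moment l x) * \<bar>u l x r\<bar>" for l
      proof -
        have "(\<integral>z. norm (u l x r / fact l * (z - x) ^ l) \<partial>std_normal) =
            (\<integral>z. \<bar>u l x r\<bar> * (\<bar>z - x\<bar> ^ l / fact l) \<partial>std_normal)"
          by (simp add: abs_mult power_abs)
        also have "\<dots> = \<bar>u l x r\<bar> * (\<integral>z. \<bar>z - x\<bar> ^ l / fact l \<partial>std_normal)"
          by (rule integral_mult_right_zero)
        also have "(\<integral>z. \<bar>z - x\<bar> ^ l / fact l \<partial>std_normal) = enn2real (abs_moment l x)"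
          unfolding abs_moment_def by (rule integral_eq_nn_integral) auto
        finally show ?thesis by simp
      qed
      have "(\<lambda>l. \<integral>z. u l x r / fact l * (z - x) ^ l \<partial>std_normal) sums
          (\<integral>z. (\<Sum>l. u l x r / fact l * (z - x) ^ l) \<partial>std_normal)"
      proof (rule sums_integral)
        show "AE z in std_normal. summable (\<lambda>l. norm (u l x r / fact l * (z - x) ^ l))"
        proof (rule AE_I2)
          fix z
          \<comment> \<open>Convergence at distance |z - x| + 1 from the centre gives absolute
            convergence at z, which lies strictly inside that radius.\<close>
          have "summable (\<lambda>l. u l x r / fact l * ((x + (\<bar>z - x\<bar> + 1)) - x) ^ l)"
            using taylor by (rule sums_summable)
          then have "summable (\<lambda>l. u l x r / fact l * (\<bar>z - x\<bar> + 1) ^ l)" by simp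
          then show "summable (\<lambda>l. norm (u l x r / fact l * (z - x) ^ l))"
            by (rule powser_insidea) simp
        qed
      qed (use int nint summ in auto)
      moreover have "(\<integral>z. u l x r / fact l * (z - x) ^ l \<partial>std_normal) = taylor_weight l x * u l x r" for l
        unfolding taylor_weight_def
        by (subst mult.commute, subst integral_mult_right_zero[symmetric]) (simp add: ac_simps)
      ultimately show ?case
        using summ taylor by (simp add: sums_iff)
    qed
  qed
qed

text \<open>By the pointwise expansion the remainder is a tail of the series, and
  \<open>abs_moment\<close> dominates the absolute value of each weight.\<close>

lemma nn_integral_remainder_le:
  obtains K where "K \<ge> 0"
    "\<And>n. (\<integral>\<^sup>+r. \<integral>\<^sup>+x. ennreal (((\<integral>z. u 0 z r \<partial>std_normal) - (\<Sum>l<n. taylor_weight l x * u l x r))\<^sup>2) \<partial>std_normal \<partial>\<nu>) \<le>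
      ennreal (K * (20/21) ^ n)"
proof -
  obtain K where K: "K \<ge> 0"
    "\<And>n. (\<integral>\<^sup>+r. \<integral>\<^sup>+x. (\<Sum>l. ennreal (enn2real (abs_moment (l + n) x) * \<bar>u (l + n) x r\<bar>))\<^sup>2 \<partial>std_normal \<partial>\<nu>) \<le>
      ennreal (K * (20/21) ^ n)"
    using nn_integral_tail_le by blast
  have "(\<integral>\<^sup>+r. \<integral>\<^sup>+x. ennreal (((\<integral>z. u 0 z r \<partial>std_normal) - (\<Sum>l<n. taylor_weight l x * u l x r))\<^sup>2) \<partial>std_normal \<partial>\<nu>) \<le>
      ennreal (K * (20/21) ^ n)" for n
  proof (rule order_trans[OF _ K(2)], rule nn_integral_mono_AE)
    show "AE r in \<nu>. (\<integral>\<^sup>+x. ennreal (((\<integral>z. u 0 z r \<partial>std_normal) - (\<Sum>l<n. taylor_weight l x * u l x r))\<^sup>2) \<partial>std_normal)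
      \<le> (\<integral>\<^sup>+x. (\<Sum>l. ennreal (enn2real (abs_moment (l + n) x) * \<bar>u (l + n) x r\<bar>))\<^sup>2 \<partial>std_normal)"
      using AE_expansion
    proof eventually_elim
      case (elim r)
      show ?case
      proof (rule nn_integral_mono_AE, use elim in eventually_elim)
        case (elim x)
        let ?R = "(\<integral>z. u 0 z r \<partial>std_normal) - (\<Sum>l<n. taylor_weight l x * u l x r)"
        from elim have "(\<lambda>l. taylor_weight (l + n) x * u (l + n) x r) sums ?R"
          by (subst sums_iff_shift) auto
        then have "ennreal \<bar>?R\<bar> \<le> (\<Sum>l. ennreal \<bar>taylor_weight (l + n) x * u (l + n) x r\<bar>)"
          by (rule ennreal_abs_sums_le)
        also have "\<dots> \<le> (\<Sum>l. ennreal (enn2real (abs_moment (l + n) x) * \<bar>u (l + n) x r\<bar>))"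
          unfolding abs_mult by (intro suminf_le ennreal_leI mult_right_mono taylor_weight_le) auto
        finally have "(ennreal \<bar>?R\<bar>)\<^sup>2 \<le> (\<Sum>l. ennreal (enn2real (abs_moment (l + n) x) * \<bar>u (l + n) x r\<bar>))\<^sup>2"
          by (intro power_mono) auto
        then show ?case by (simp add: ennreal_power)
      qed
    qed
  qed
  with K(1) show thesis by (rule that)
qed

lemma nn_integral_term_finite:
  "(\<integral>\<^sup>+r. \<integral>\<^sup>+x. ennreal ((taylor_weight n x * u n x r)\<^sup>2) \<partial>std_normal \<partial>\<nu>) < \<infinity>"
proof -
  obtain K where K: "\<And>n. (\<integral>\<^sup>+r. \<integral>\<^sup>+x. (abs_moment n x)\<^sup>2 * ennreal ((u n x r)\<^sup>2) \<partial>std_normal \<partial>\<nu>) \<le>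
    ennreal (K * (real n + 1) * (10/11) ^ n)"
    using nn_integral_abs_moment_geometric by blast
  have "(\<integral>\<^sup>+r. \<integral>\<^sup>+x. ennreal ((taylor_weight n x * u n x r)\<^sup>2) \<partial>std_normal \<partial>\<nu>) \<le>
      (\<integral>\<^sup>+r. \<integral>\<^sup>+x. (abs_moment n x)\<^sup>2 * ennreal ((u n x r)\<^sup>2) \<partial>std_normal \<partial>\<nu>)"
  proof (intro nn_integral_mono)
    fix r x
    have "(ennreal \<bar>taylor_weight n x\<bar>)\<^sup>2 \<le> (abs_moment n x)\<^sup>2"
      by (intro power_mono ennreal_taylor_weight_le) auto
    then show "ennreal ((taylor_weight n x * u n x r)\<^sup>2) \<le> (abs_moment n x)\<^sup>2 * ennreal ((u n x r)\<^sup>2)"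
      by (simp add: power_mult_distrib ennreal_mult' ennreal_power mult_right_mono)
  qed
  also have "\<dots> \<le> ennreal (K * (real n + 1) * (10/11) ^ n)" by (rule K)
  finally show ?thesis by (simp add: order.strict_trans1)
qed

end

section \<open>Hermite polynomials as Gaussian moments\<close>

text \<open>The three-term recurrence is easier to differentiate than the iterated
  \<open>deriv\<close> in \<open>hermite\<close>; the rule He_n' = n He_(n-1) follows by
  induction.\<close>

fun hermite_rec :: "nat \<Rightarrow> real \<Rightarrow> real" where
  "hermite_rec 0 x = 1"
| "hermite_rec (Suc 0) x = x"
| "hermite_rec (Suc (Suc n)) x = x * hermite_rec (Suc n) x - real (Suc n) * hermite_rec n x"

lemma hermite_rec_Suc: "hermite_rec (Suc n) x = x * hermite_rec n x - real n * hermite_rec (n - 1) x"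
  by (cases n) auto

lemma DERIV_hermite_rec:
  "(hermite_rec n has_real_derivative real n * hermite_rec (n - 1) x) (at x)"
proof (induction n x rule: hermite_rec.induct)
  case (3 n x)
  have "((\<lambda>x. x * hermite_rec (Suc n) x - real (Suc n) * hermite_rec n x) has_real_derivative
      (1 * hermite_rec (Suc n) x + (real (Suc n) * hermite_rec (Suc n - 1) x) * x) -
      real (Suc n) * (real n * hermite_rec (n - 1) x)) (at x)"
    by (intro DERIV_diff DERIV_mult DERIV_cmult DERIV_ident 3)
  moreover have "(1 * hermite_rec (Suc n) x + (real (Suc n) * hermite_rec (Suc n - 1) x) * x) -
      real (Suc n) * (real n * hermite_rec (n - 1) x) = real (Suc (Suc n)) * hermite_rec (Suc (Suc n) - 1) x"
    using arg_cong[OF hermite_rec_Suc[of n x], of "\<lambda>y. (1 + real n) * y"] by (simp add: algebra_simps)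
  ultimately show ?case by (simp add: fun_eq_iff[symmetric])
qed (auto intro!: derivative_eq_intros simp: fun_eq_iff)

text \<open>Induction on Rodrigues' formula: differentiating He_n(x) exp(-x^2/2) produces the factor
  n He_(n-1) - x He_n = -He_(n+1).\<close>

lemma hermite_eq_rec: "hermite n x = hermite_rec n x"
proof -
  have "(deriv ^^ n) (\<lambda>y. exp (- y\<^sup>2 / 2)) = (\<lambda>x. (-1) ^ n * hermite_rec n x * exp (- x\<^sup>2 / 2))"
  proof (induction n)
    case (Suc n)
    have "deriv (\<lambda>x. (-1) ^ n * hermite_rec n x * exp (- x\<^sup>2 / 2)) x =
        (-1) ^ Suc n * hermite_rec (Suc n) x * exp (- x\<^sup>2 / 2)" for x
    proof (rule DERIV_imp_deriv)
      have "((\<lambda>x::real. exp (- x\<^sup>2 / 2)) has_real_derivative - x * exp (- x\<^sup>2 / 2)) (at x)"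
        by (auto intro!: derivative_eq_intros)
      from DERIV_mult[OF DERIV_cmult[OF DERIV_hermite_rec] this]
      have "((\<lambda>x. (-1) ^ n * hermite_rec n x * exp (- x\<^sup>2 / 2)) has_real_derivative
          (-1) ^ n * (real n * hermite_rec (n - 1) x) * exp (- x\<^sup>2 / 2) +
          - x * exp (- x\<^sup>2 / 2) * ((-1) ^ n * hermite_rec n x)) (at x)" .
      then show "((\<lambda>x. (-1) ^ n * hermite_rec n x * exp (- x\<^sup>2 / 2)) has_real_derivative
          (-1) ^ Suc n * hermite_rec (Suc n) x * exp (- x\<^sup>2 / 2)) (at x)"
        unfolding hermite_rec_Suc by (rule DERIV_cong) (simp add: algebra_simps)
    qed
    then show ?case unfolding funpow.simps comp_apply Suc by (rule ext)
  qed simp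
  note deriv = this
  show ?thesis
  proof (cases "n = 0")
    case False
    have "hermite n x = ((-1) ^ n * (-1) ^ n) * (exp (x\<^sup>2 / 2) * exp (- x\<^sup>2 / 2)) * hermite_rec n x"
      using False by (simp only: hermite_def if_False deriv mult_ac)
    also have "(-1) ^ n * (-1) ^ n = (1::real)" by (simp only: power_mult_distrib[symmetric]) simp
    also have "exp (x\<^sup>2 / 2) * exp (- x\<^sup>2 / 2) = 1" by (simp add: exp_add[symmetric])
    finally show ?thesis by simp
  qed (simp add: hermite_def)
qed

text \<open>The bridge between Hermite sums and Gaussian moments: both satisfy this recurrence. The
  case l = 0 is split off because l - 1 would be 0 in the natural numbers and add a spurious
  term.\<close>

lemma eq_if_same_recurrence:
  fixes p q :: "nat \<Rightarrow> real"
  assumes p: "\<And>l. real (Suc l) * p (Suc l) = - x * p l + (if l = 0 then 0 else p (l - 1))"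
    and q: "\<And>l. real (Suc l) * q (Suc l) = - x * q l + (if l = 0 then 0 else q (l - 1))"
    and 0: "p 0 = q 0"
  shows "p l = q l"
proof (induction l rule: less_induct)
  case (less l)
  show ?case
  proof (cases l)
    case (Suc k)
    have "real (Suc k) * p (Suc k) = real (Suc k) * q (Suc k)"
      unfolding p q using less Suc by auto
    then show ?thesis using Suc by simp
  qed (use 0 in simp)
qed

text \<open>Generating functions in t: \<open>A\<close> is exp(x t - t^2/2), \<open>E\<close> is
  exp(t^2), and their product exp(x t + t^2/2) has the coefficients B l x. Its derivative is (x + t)
  times itself; the recurrence compares coefficients.\<close>

lemma bte_coefficient_recurrence:
  defines "B \<equiv> \<lambda>l x. \<Sum>j=0..l div 2. 1 / (fact j * fact (l - 2 * j)) * hermite (l - 2 * j) x"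
  shows "real (Suc l) * B (Suc l) x = x * B l x + (if l = 0 then 0 else B (l - 1) x)"
proof -
  define A where "A = Abs_fps (\<lambda>k. hermite_rec k x / fact k)"
  define E where "E = Abs_fps (\<lambda>i. if even i then 1 / fact (i div 2) else 0 :: real)"
  have A: "fps_deriv A = (fps_const x - fps_X) * A"
  proof (rule fps_ext)
    fix n
    show "fps_nth (fps_deriv A) n = fps_nth ((fps_const x - fps_X) * A) n"
      by (cases n) (simp_all add: A_def ring_distribs divide_simps del: of_nat_Suc)
  qed
  have E: "fps_deriv E = 2 * fps_X * E"
  proof (rule fps_ext)
    fix n
    show "fps_nth (fps_deriv E) n = fps_nth (2 * fps_X * E) n"
    proof (cases n)
      case (Suc k)
      show ?thesis
      proof (cases "even k")
        case True
        then obtain j where "k = 2 * j" by blast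
        then show ?thesis using Suc
          by (simp add: E_def mult.assoc fps_numeral_fps_const divide_simps)
      qed (use Suc in \<open>simp add: E_def mult.assoc fps_numeral_fps_const\<close>)
    qed (simp add: E_def mult.assoc fps_numeral_fps_const)
  qed
  have EA: "fps_nth (E * A) l = B l x" for l
  proof -
    have "fps_nth (E * A) l = (\<Sum>i\<in>{i\<in>{0..l}. even i}. 1 / fact (i div 2) * (hermite_rec (l - i) x / fact (l - i)))"
      unfolding fps_mult_nth by (subst sum.inter_filter) (auto simp: E_def A_def intro!: sum.cong)
    also have "\<dots> = (\<Sum>j=0..l div 2. 1 / fact j * (hermite_rec (l - 2 * j) x / fact (l - 2 * j)))"
      by (rule sum.reindex_bij_witness[of _ "\<lambda>j. 2 * j" "\<lambda>i. i div 2"]) auto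
    finally show ?thesis by (simp add: B_def hermite_eq_rec)
  qed
  have "fps_deriv (E * A) = (fps_const x + fps_X) * (E * A)"
    unfolding fps_deriv_mult A E by (simp add: algebra_simps)
  then have "fps_nth (fps_deriv (E * A)) l = fps_nth ((fps_const x + fps_X) * (E * A)) l" by simp
  moreover have "fps_nth (fps_deriv (E * A)) l = real (Suc l) * B (Suc l) x"
    by (simp only: fps_deriv_nth EA Suc_eq_plus1)
  ultimately show ?thesis by (simp only:) (simp add: EA ring_distribs)
qed

text \<open>This is Gaussian integration by parts, read off here from the closed forms of the even
  and odd moments.\<close>

lemma std_normal_moment_recurrence:
  "(\<integral>z. z ^ Suc k \<partial>std_normal) = (if k = 0 then 0 else real k * (\<integral>z. z ^ (k - 1) \<partial>std_normal))"
proof -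
  have *: "(\<integral>z. z ^ k \<partial>std_normal) = (\<integral>z. std_normal_density z * z ^ k \<partial>lborel)" for k
    by (subst integral_density) auto
  have odd: "(\<integral>z. z ^ (2 * j + 1) \<partial>std_normal) = 0" for j
    unfolding * by (rule integral_std_normal_moment_odd)
  have even: "(\<integral>z. z ^ (2 * j) \<partial>std_normal) = fact (2 * j) / (2 ^ j * fact j)" for j
    unfolding * by (rule integral_std_normal_moment_even)
  show ?thesis
  proof (cases "even k")
    case True
    then obtain j where j: "k = 2 * j" by blast
    then have k: "Suc k = 2 * j + 1" by simp
    show ?thesis
    proof (cases j)
      case 0
      then show ?thesis unfolding k odd using j by simp
    next
      case (Suc i)
      then have "k - 1 = 2 * i + 1" "k \<noteq> 0" using j by auto
      then show ?thesis unfolding k by (simp only: odd) simp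
    qed
  next
    case False
    then obtain j where j: "k = 2 * j + 1" by (rule oddE)
    then have k: "Suc k = 2 * Suc j" "k - 1 = 2 * j" "k \<noteq> 0" by auto
    have "(fact (2 * Suc j) / (2 ^ Suc j * fact (Suc j)) :: real) = real k * (fact (2 * j) / (2 ^ j * fact j))"
      using j by (simp add: divide_simps)
    then show ?thesis unfolding k(1,2) even using k(3) by simp
  qed
qed

text \<open>The generating function in t is E exp((Z - x) t), that is, exp(t^2/2 - x t). It appears
  as the product \<open>Q\<close> of the moment series of Z with exp(-x t), by the binomial theorem,
  and satisfies Q' = (t - x) Q.\<close>

lemma taylor_weight_recurrence:
  "real (Suc l) * taylor_weight (Suc l) x = - x * taylor_weight l x + (if l = 0 then 0 else taylor_weight (l - 1) x)"
proof -
  define m where "m k = (\<integral>z. z ^ k \<partial>std_normal)" for k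
  have int: "integrable std_normal (\<lambda>z. z ^ k)" for k
    using integrable_mult_right[OF integrable_taylor_weight[of 0 k], of "fact k"] by simp
  define Q where "Q = Abs_fps (\<lambda>k. m k / fact k) * fps_exp (- x)"
  have Q: "fps_nth Q l = taylor_weight l x" for l
  proof -
    have "taylor_weight l x = (\<integral>z. (\<Sum>k\<le>l. z ^ k * ((- x) ^ (l - k) / fact (l - k) / fact k)) \<partial>std_normal)"
      unfolding taylor_weight_def
    proof (intro Bochner_Integration.integral_cong refl)
      fix z
      have "(z - x) ^ l / fact l = (\<Sum>k\<le>l. real (l choose k) * z ^ k * (- x) ^ (l - k)) / fact l"
        using binomial_ring[of z "- x" l] by simp
      also have "\<dots> = (\<Sum>k\<le>l. z ^ k * ((- x) ^ (l - k) / fact (l - k) / fact k))"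
        unfolding sum_divide_distrib by (intro sum.cong refl) (auto simp: binomial_fact field_simps)
      finally show "(z - x) ^ l / fact l = (\<Sum>k\<le>l. z ^ k * ((- x) ^ (l - k) / fact (l - k) / fact k))" .
    qed
    also have "\<dots> = (\<Sum>k\<le>l. m k * ((- x) ^ (l - k) / fact (l - k) / fact k))"
      unfolding m_def by (subst Bochner_Integration.integral_sum) (auto intro!: int integrable_mult_left)
    also have "\<dots> = fps_nth Q l"
      unfolding Q_def fps_mult_nth atLeast0AtMost by (intro sum.cong) (simp_all add: ac_simps)
    finally show ?thesis by simp
  qed
  have "fps_deriv (Abs_fps (\<lambda>k. m k / fact k)) = fps_X * Abs_fps (\<lambda>k. m k / fact k)"
  proof (rule fps_ext)
    fix n
    show "fps_nth (fps_deriv (Abs_fps (\<lambda>k. m k / fact k))) n = fps_nth (fps_X * Abs_fps (\<lambda>k. m k / fact k)) n"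
      using std_normal_moment_recurrence[of n] unfolding m_def[symmetric]
      by (cases n) (simp_all add: divide_simps del: of_nat_Suc)
  qed
  then have "fps_deriv Q = (fps_X + fps_const (- x)) * Q"
    by (simp add: Q_def algebra_simps)
  then have "fps_nth (fps_deriv Q) l = fps_nth ((fps_X + fps_const (- x)) * Q) l" by simp
  then show ?thesis by (simp add: Q ring_distribs)
qed

text \<open>The sign (-1)^l replaces t by -t in the generating function exp(x t + t^2/2) and turns
  it into that of the Gaussian moments.\<close>

lemma bte_gamma_eq_taylor_weight:
  assumes "\<Delta> > 0"
  shows "bte_gamma W \<Delta> m l \<omega> =
    sqrt \<Delta> ^ l * taylor_weight l ((W (real (m + 1) * \<Delta>) \<omega> - W (real m * \<Delta>) \<omega>) / sqrt \<Delta>)"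
proof -
  define x where "x = (W (real (m + 1) * \<Delta>) \<omega> - W (real m * \<Delta>) \<omega>) / sqrt \<Delta>"
  define B where "B l = (\<Sum>j=0..l div 2. 1 / (fact j * fact (l - 2 * j)) * hermite (l - 2 * j) x)" for l
  have "(-1) ^ l * B l = taylor_weight l x" for l
  proof (rule eq_if_same_recurrence[OF _ taylor_weight_recurrence])
    fix l
    have "real (Suc l) * ((-1) ^ Suc l * B (Suc l)) = (-1) ^ Suc l * (real (Suc l) * B (Suc l))" by simp
    also have "real (Suc l) * B (Suc l) = x * B l + (if l = 0 then 0 else B (l - 1))"
      unfolding B_def by (rule bte_coefficient_recurrence)
    finally show "real (Suc l) * ((-1) ^ Suc l * B (Suc l)) =
        - x * ((-1) ^ l * B l) + (if l = 0 then 0 else (-1) ^ (l - 1) * B (l - 1))"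
      by (cases l) (auto simp: algebra_simps)
    show "(-1) ^ 0 * B 0 = taylor_weight 0 x"
      by (simp add: B_def hermite_def taylor_weight_def std_normal.prob_space[simplified])
  qed
  moreover have "\<Delta> powr (real l / 2) = sqrt \<Delta> ^ l"
    using assms by (simp add: powr_half_sqrt[symmetric] powr_powr powr_realpow[symmetric])
  moreover have "B 0 = 1" by (simp add: B_def hermite_def)
  moreover have "taylor_weight 0 x = 1"
    by (simp add: taylor_weight_def std_normal.prob_space[simplified])
  ultimately show ?thesis
    unfolding bte_gamma_def x_def[symmetric] B_def[symmetric] by (auto simp: mult.assoc[symmetric] mult.commute)
qed

section \<open>Growth of the derivatives\<close>

lemma geometric_bound_if_ratio:
  fixes e :: "nat \<Rightarrow> real"
  assumes r: "r > 0" and ev: "eventually (\<lambda>p. e (Suc p) \<le> r * e p) at_top"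
  obtains C where "C \<ge> 0" "\<And>p. e p \<le> C * r ^ p"
proof -
  from ev obtain N where N: "\<And>p. p \<ge> N \<Longrightarrow> e (Suc p) \<le> r * e p"
    by (auto simp: eventually_at_top_linorder)
  define C where "C = (\<Sum>p\<le>N. \<bar>e p\<bar> / r ^ p)"
  have C: "C \<ge> 0" using r by (auto simp: C_def intro!: sum_nonneg)
  have "e p \<le> C * r ^ p" for p
  proof (induction p)
    case 0
    have "\<bar>e 0\<bar> / r ^ 0 \<le> C" unfolding C_def by (rule member_le_sum) (use r in auto)
    then show ?case by simp
  next
    case (Suc p)
    show ?case
    proof (cases "p \<ge> N")
      case True
      have "e (Suc p) \<le> r * e p" by (rule N[OF True])
      also have "\<dots> \<le> r * (C * r ^ p)" using Suc r by (intro mult_left_mono) auto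
      finally show ?thesis by (simp add: mult.left_commute)
    next
      case False
      have "\<bar>e (Suc p)\<bar> / r ^ Suc p \<le> C" unfolding C_def by (rule member_le_sum) (use r False in auto)
      then have "\<bar>e (Suc p)\<bar> \<le> C * r ^ Suc p" using r by (subst (asm) pos_divide_le_eq) auto
      then show ?thesis by linarith
    qed
  qed
  with C show thesis by (rule that)
qed

text \<open>\<open>(L!)\<^sup>2 / (binom(L,i)^4 i! (2L - i)!)\<close> for \<open>L = i + j\<close>, simplified: the reciprocal of the weight of
  \<open>\<parallel>D\<^sup>n F\<parallel>\<^sup>2 / n!\<close>, \<open>n = 2L - i = i + 2j\<close>, in the hypothesis of the theorem.\<close>
definition growth_coeff :: "nat \<Rightarrow> nat \<Rightarrow> real" where
  "growth_coeff i j = fact i ^ 3 * fact j ^ 4 / (fact (i + j) ^ 2 * fact (i + 2 * j))"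

lemma growth_coeff_pos: "growth_coeff i j > 0"
  by (simp add: growth_coeff_def)

lemma growth_coeff_Suc:
  "growth_coeff (Suc i) (Suc j) = growth_coeff i j *
    ((real i + 1) ^ 3 * (real j + 1) ^ 4 /
     ((real i + real j + 1) ^ 2 * (real i + real j + 2) ^ 2 *
      ((real i + 2 * real j + 1) * (real i + 2 * real j + 2) * (real i + 2 * real j + 3))))"
proof -
  have 1: "fact (Suc i + Suc j) = (real i + real j + 2) * ((real i + real j + 1) * fact (i + j))"
    by (simp add: algebra_simps)
  have 2: "fact (Suc i + 2 * Suc j) =
      (real i + 2 * real j + 3) * ((real i + 2 * real j + 2) * ((real i + 2 * real j + 1) * fact (i + 2 * j)))"
    by (simp add: algebra_simps)
  have 3: "fact (Suc i) = (real i + 1) * fact i" "fact (Suc j) = (real j + 1) * fact j"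
    by (simp_all add: algebra_simps)
  show ?thesis
    unfolding growth_coeff_def 1 2 3 power_mult_distrib times_divide_times_eq
    by (rule arg_cong2[where f="(/)"]) (simp_all only: mult_ac)
qed

text \<open>Raising i and j together raises n = i + 2 j by 3, so the rate per step is the cube of
  the rate in n. The offsets a and b do not affect the limiting ratio.\<close>

lemma growth_coeff_bound:
  obtains C where "C \<ge> 0" "\<And>p. growth_coeff (p + a) (p + b) \<le> C * ((2/15) ^ 3) ^ p"
proof (rule geometric_bound_if_ratio)
  show "(0::real) < (2/15) ^ 3" by simp
  let ?q = "\<lambda>p. (real (p + a) + 1) ^ 3 * (real (p + b) + 1) ^ 4 /
     ((real (p + a) + real (p + b) + 1) ^ 2 * (real (p + a) + real (p + b) + 2) ^ 2 *
      ((real (p + a) + 2 * real (p + b) + 1) * (real (p + a) + 2 * real (p + b) + 2) * (real (p + a) + 2 * real (p + b) + 3)))"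
  \<comment> \<open>With i and j both of size p the ratio behaves like p^7 / ((2 p)^4 (3 p)^3), and
    1/432 is just below (2/15)^3 = 8/3375.\<close>
  have "?q \<longlonglongrightarrow> 1 / 432" unfolding of_nat_add by real_asymp
  then have "eventually (\<lambda>p. ?q p < (2/15) ^ 3) at_top"
    by (rule order_tendstoD(2)) (simp add: power3_eq_cube)
  then show "eventually (\<lambda>p. growth_coeff (Suc p + a) (Suc p + b) \<le> (2/15) ^ 3 * growth_coeff (p + a) (p + b)) at_top"
  proof eventually_elim
    case (elim p)
    then have "growth_coeff (p + a) (p + b) * ?q p \<le> growth_coeff (p + a) (p + b) * (2/15) ^ 3"
      using growth_coeff_pos[of "p + a" "p + b"] by (intro mult_left_mono) auto
    then show ?case using growth_coeff_Suc[of "p + a" "p + b"] by (simp only: add_Suc mult.commute)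
  qed
qed (use that in blast)

text \<open>Only the terms with \<open>i\<close> next to \<open>L / 2\<close> are used; they give the rate \<open>432 powr (- 1/3) < 2/15\<close>.\<close>
lemma derivative_growth:
  fixes c :: "nat \<Rightarrow> real"
  assumes c: "\<And>n. c n \<ge> 0"
    and lim: "(\<lambda>L. \<Sum>i=0..L. c (2 * L - i) * real (L choose i) ^ 4 * (fact i / (fact L)\<^sup>2)) \<longlonglongrightarrow> 0"
  obtains C where "C \<ge> 0" "\<And>n. c n \<le> C * fact n * (2/15) ^ n"
proof -
  \<comment> \<open>Convergence enters only through boundedness: since all summands are nonnegative,
    each of them is at most K.\<close>
  obtain K where K: "\<And>L. \<bar>\<Sum>i=0..L. c (2 * L - i) * real (L choose i) ^ 4 * (fact i / (fact L)\<^sup>2)\<bar> \<le> K"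
    using Bseq_eq_bounded convergent_imp_Bseq[OF convergentI[OF lim]] by (auto simp: Bseq_def)
  have K0: "K \<ge> 0" using K[of 0] by linarith
  have summand_le: "c (i + 2 * j) \<le> K * fact (i + 2 * j) * growth_coeff i j" for i j
  proof -
    let ?L = "i + j"
    let ?b = "real (?L choose i) ^ 4 * (fact i / (fact ?L)\<^sup>2)"
    have "c (2 * ?L - i) * real (?L choose i) ^ 4 * (fact i / (fact ?L)\<^sup>2) \<le>
        (\<Sum>i=0..?L. c (2 * ?L - i) * real (?L choose i) ^ 4 * (fact i / (fact ?L)\<^sup>2))"
      by (rule member_le_sum) (use c in auto)
    also have "\<dots> \<le> K" using K[of ?L] by linarith
    finally have "c (i + 2 * j) * ?b \<le> K" by (simp add: mult.assoc)
    moreover have b: "?b > 0" by (simp add: zero_less_binomial_iff)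
    ultimately have "c (i + 2 * j) \<le> K / ?b" by (simp only: pos_le_divide_eq)
    also have "1 / ?b = fact (i + 2 * j) * growth_coeff i j"
    proof -
      have 1: "real (?L choose i) = fact ?L / (fact i * fact j)" by (subst binomial_fact) auto
      have 2: "1 / ((z / (x * y)) ^ 4 * (x / z\<^sup>2)) = v * (x ^ 3 * y ^ 4 / (z\<^sup>2 * v))"
        if "x \<noteq> 0" "y \<noteq> 0" "z \<noteq> 0" "v \<noteq> 0" for x y z v :: real
        using that by (simp add: divide_simps) (simp add: eval_nat_numeral)
      show ?thesis unfolding growth_coeff_def 1 by (rule 2) simp_all
    qed
    then have "K / ?b = K * fact (i + 2 * j) * growth_coeff i j" by (simp add: divide_inverse)
    finally show ?thesis .
  qed
  \<comment> \<open>The pairs (p, p), (p+1, p) and (p, p+1) give n = i + 2 j equal to 3 p, 3 p + 1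
    and 3 p + 2, so every n is reached.\<close>
  obtain C0 where C0: "C0 \<ge> 0" "\<And>p. growth_coeff (p + 0) (p + 0) \<le> C0 * ((2/15) ^ 3) ^ p"
    using growth_coeff_bound by blast
  obtain C1 where C1: "C1 \<ge> 0" "\<And>p. growth_coeff (p + 1) (p + 0) \<le> C1 * ((2/15) ^ 3) ^ p"
    using growth_coeff_bound by blast
  obtain C2 where C2: "C2 \<ge> 0" "\<And>p. growth_coeff (p + 0) (p + 1) \<le> C2 * ((2/15) ^ 3) ^ p"
    using growth_coeff_bound by blast
  \<comment> \<open>The powers of 15/2 make up for the residue of n modulo 3, which (2/15)^(3 p)
    leaves out.\<close>
  define C where "C = K * (C0 + C1 * (15/2) + C2 * (15/2)\<^sup>2)"
  have "C \<ge> 0" using K0 C0 C1 C2 by (simp add: C_def)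
  moreover have "c n \<le> C * fact n * (2/15) ^ n" for n
  proof -
    have *: "c n \<le> C * fact n * (2/15) ^ n"
      if n: "n = 3 * p + s" and g: "c n \<le> K * fact n * g" and gb: "g \<le> D * ((2/15) ^ 3) ^ p"
        and D: "D * (15/2) ^ s \<le> C0 + C1 * (15/2) + C2 * (15/2)\<^sup>2" for p s g D
    proof -
      have "D * ((2/15) ^ 3) ^ p = D * (15/2) ^ s * (2/15) ^ n"
      proof -
        have "(15/2 :: real) ^ s * (2/15) ^ s = 1" by (simp only: power_mult_distrib[symmetric]) simp
        then show ?thesis unfolding n power_add power_mult by (simp add: mult.assoc mult.left_commute)
      qed
      also have "\<dots> \<le> (C0 + C1 * (15/2) + C2 * (15/2)\<^sup>2) * (2/15) ^ n"
        by (intro mult_right_mono D) auto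
      finally have "K * fact n * g \<le> K * fact n * ((C0 + C1 * (15/2) + C2 * (15/2)\<^sup>2) * (2/15) ^ n)"
        using gb K0 by (intro mult_left_mono) auto
      then show ?thesis using g by (simp add: C_def mult_ac)
    qed
    have "n mod 3 = 0 \<or> n mod 3 = 1 \<or> n mod 3 = 2" by linarith
    then show ?thesis
    proof (elim disjE)
      assume "n mod 3 = 0"
      then have n: "n = 3 * (n div 3) + 0" using mult_div_mod_eq[of 3 n] by simp
      show ?thesis
        by (rule *[OF n _ C0(2)[of "n div 3"]])
           (use summand_le[of "n div 3" "n div 3"] n C0 C1 C2 in auto)
    next
      assume "n mod 3 = 1"
      then have n: "n = 3 * (n div 3) + 1" using mult_div_mod_eq[of 3 n] by simp
      then have "n div 3 + 1 + 2 * (n div 3 + 0) = n" by presburger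
      then show ?thesis
        using summand_le[of "n div 3 + 1" "n div 3 + 0"]
        by (intro *[OF n _ C1(2)[of "n div 3"]]) (use C0 C1 C2 in auto)
    next
      assume "n mod 3 = 2"
      then have n: "n = 3 * (n div 3) + 2" using mult_div_mod_eq[of 3 n] by simp
      then have "n div 3 + 0 + 2 * (n div 3 + 1) = n" by presburger
      then show ?thesis
        using summand_le[of "n div 3 + 0" "n div 3 + 1"]
        by (intro *[OF n _ C2(2)[of "n div 3"]]) (use C0 C1 C2 in auto)
    qed
  qed
  ultimately show thesis by (rule that)
qed

section \<open>Independence of a sigma-algebra\<close>

context prob_space
begin

definition indep_of_algebra :: "'a measure \<Rightarrow> 'b measure \<Rightarrow> ('a \<Rightarrow> 'b) \<Rightarrow> bool" where
  "indep_of_algebra F S X \<longleftrightarrow> X \<in> measurable M S \<and>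
     (\<forall>A\<in>sets F. \<forall>C\<in>sets S. prob (A \<inter> (X -` C \<inter> space M)) = prob A * prob (X -` C \<inter> space M))"

lemma indep_of_algebra_compose:
  assumes "indep_of_algebra F S X" and f [measurable]: "f \<in> measurable S T"
  shows "indep_of_algebra F T (\<lambda>\<omega>. f (X \<omega>))"
proof -
  have X [measurable]: "X \<in> measurable M S" using assms by (simp add: indep_of_algebra_def)
  have eq: "(\<lambda>\<omega>. f (X \<omega>)) -` C \<inter> space M = X -` (f -` C \<inter> space S) \<inter> space M" for C
    using measurable_space[OF X] by auto
  show ?thesis
    unfolding indep_of_algebra_def eq
  proof (intro conjI ballI)
    fix A C assume "A \<in> sets F" "C \<in> sets T"
    moreover have "f -` C \<inter> space S \<in> sets S" using \<open>C \<in> sets T\<close> by measurable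
    ultimately show "prob (A \<inter> (X -` (f -` C \<inter> space S) \<inter> space M)) = prob A * prob (X -` (f -` C \<inter> space S) \<inter> space M)"
      using assms(1) unfolding indep_of_algebra_def by blast
  qed measurable
qed

text \<open>The identity is read as a random element of the space with sigma-algebra
  \<open>F\<close>. Independence then says that its joint law with X is a product, checked on
  rectangles, so integrands that depend on \<omega> through \<open>F\<close> fall under
  Fubini.\<close>

lemma distr_indep_of_algebra:
  assumes F: "subalgebra M F" and X: "indep_of_algebra F S X"
  shows "distr M (F \<Otimes>\<^sub>M S) (\<lambda>\<omega>. (\<omega>, X \<omega>)) = restr_to_subalg M F \<Otimes>\<^sub>M distr M S X"
proof (rule pair_measure_eqI[symmetric])
  have [measurable]: "X \<in> measurable M S" using X by (simp add: indep_of_algebra_def)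
  have id [measurable]: "(\<lambda>\<omega>. \<omega>) \<in> measurable M F"
    by (rule measurable_from_subalg[OF F]) simp
  show "sigma_finite_measure (restr_to_subalg M F)"
    using finite_measure_restr_to_subalg[OF F] emeasure_space_1
    by (intro finite_measure.sigma_finite_measure) (auto simp: infinity_ennreal_def)
  show "sigma_finite_measure (distr M S X)"
    by (intro prob_space_imp_sigma_finite prob_space_distr) measurable
  show "sets (restr_to_subalg M F \<Otimes>\<^sub>M distr M S X) = sets (distr M (F \<Otimes>\<^sub>M S) (\<lambda>\<omega>. (\<omega>, X \<omega>)))"
    by (simp cong: sets_pair_measure_cong add: sets_restr_to_subalg[OF F])
  fix A B assume A: "A \<in> sets (restr_to_subalg M F)" and B: "B \<in> sets (distr M S X)"
  then have [measurable]: "A \<in> sets F" "B \<in> sets S" by (auto simp: sets_restr_to_subalg[OF F])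
  have AM: "A \<in> events" "A \<subseteq> space M"
    using F sets.sets_into_space[OF \<open>A \<in> sets F\<close>] \<open>A \<in> sets F\<close> by (auto simp: subalgebra_def)
  have "emeasure (distr M (F \<Otimes>\<^sub>M S) (\<lambda>\<omega>. (\<omega>, X \<omega>))) (A \<times> B) = emeasure M ((\<lambda>\<omega>. (\<omega>, X \<omega>)) -` (A \<times> B) \<inter> space M)"
    by (rule emeasure_distr) measurable
  also have "(\<lambda>\<omega>. (\<omega>, X \<omega>)) -` (A \<times> B) \<inter> space M = A \<inter> (X -` B \<inter> space M)" using AM by auto
  also have "emeasure M \<dots> = ennreal (prob A * prob (X -` B \<inter> space M))"
    using X by (simp add: emeasure_eq_measure indep_of_algebra_def)
  also have "\<dots> = emeasure (restr_to_subalg M F) A * emeasure (distr M S X) B"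
    by (simp add: emeasure_restr_to_subalg[OF F] emeasure_distr emeasure_eq_measure ennreal_mult)
  finally show "emeasure (restr_to_subalg M F) A * emeasure (distr M S X) B =
      emeasure (distr M (F \<Otimes>\<^sub>M S) (\<lambda>\<omega>. (\<omega>, X \<omega>))) (A \<times> B)" by simp
qed

lemma nn_integral_indep_of_algebra:
  fixes h :: "'a \<times> 'b \<Rightarrow> ennreal"
  assumes F: "subalgebra M F" and X: "indep_of_algebra F S X"
    and h [measurable]: "h \<in> borel_measurable (F \<Otimes>\<^sub>M S)"
  shows "(\<integral>\<^sup>+\<omega>. h (\<omega>, X \<omega>) \<partial>M) = (\<integral>\<^sup>+\<omega>. \<integral>\<^sup>+q. h (\<omega>, q) \<partial>distr M S X \<partial>M)"
proof -
  have [measurable]: "X \<in> measurable M S" using X by (simp add: indep_of_algebra_def)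
  have id [measurable]: "(\<lambda>\<omega>. \<omega>) \<in> measurable M F"
    by (rule measurable_from_subalg[OF F]) simp
  interpret Q: prob_space "distr M S X" by (rule prob_space_distr) measurable
  have [measurable]: "h \<in> borel_measurable (restr_to_subalg M F \<Otimes>\<^sub>M distr M S X)"
    using h by (simp cong: measurable_cong_sets sets_pair_measure_cong add: sets_restr_to_subalg[OF F])
  have "(\<integral>\<^sup>+\<omega>. h (\<omega>, X \<omega>) \<partial>M) = (\<integral>\<^sup>+p. h p \<partial>distr M (F \<Otimes>\<^sub>M S) (\<lambda>\<omega>. (\<omega>, X \<omega>)))"
    by (subst nn_integral_distr) auto
  also have "\<dots> = (\<integral>\<^sup>+\<omega>. \<integral>\<^sup>+q. h (\<omega>, q) \<partial>distr M S X \<partial>restr_to_subalg M F)"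
    unfolding distr_indep_of_algebra[OF F X] by (rule Q.nn_integral_fst[symmetric]) measurable
  also have "\<dots> = (\<integral>\<^sup>+\<omega>. \<integral>\<^sup>+q. h (\<omega>, q) \<partial>distr M S X \<partial>M)"
  proof (rule nn_integral_subalgebra2[OF F])
    have "h \<in> borel_measurable (F \<Otimes>\<^sub>M distr M S X)"
      using h by (simp cong: measurable_cong_sets sets_pair_measure_cong)
    then show "(\<lambda>\<omega>. \<integral>\<^sup>+q. h (\<omega>, q) \<partial>distr M S X) \<in> borel_measurable F"
      by (rule Q.borel_measurable_nn_integral_fst)
  qed
  finally show ?thesis .
qed

text \<open>The freezing lemma: the \<open>F\<close>-measurable argument is held fixed and X is
  integrated out. Putting the indicator of a test set into the integrand reduces it to Fubini. The
  second claim supplies the integrability needed to split the law of X further.\<close>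

lemma real_cond_exp_indep_of_algebra:
  fixes h :: "'a \<times> 'b \<Rightarrow> real"
  assumes F: "subalgebra M F" and X: "indep_of_algebra F S X"
    and h [measurable]: "h \<in> borel_measurable (F \<Otimes>\<^sub>M S)"
    and int: "integrable M (\<lambda>\<omega>. h (\<omega>, X \<omega>))"
  shows "AE \<omega> in M. real_cond_exp M F (\<lambda>\<omega>. h (\<omega>, X \<omega>)) \<omega> = (\<integral>q. h (\<omega>, q) \<partial>distr M S X)"
    and "AE \<omega> in M. integrable (distr M S X) (\<lambda>q. h (\<omega>, q))"
proof -
  have X' [measurable]: "X \<in> measurable M S" using X by (simp add: indep_of_algebra_def)
  have id [measurable]: "(\<lambda>\<omega>. \<omega>) \<in> measurable M F"
    by (rule measurable_from_subalg[OF F]) simp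
  interpret Q: prob_space "distr M S X" by (rule prob_space_distr) measurable
  interpret R: prob_space "restr_to_subalg M F" by (rule prob_space_restr_to_subalg[OF F]) unfold_locales
  interpret RQ: pair_sigma_finite "restr_to_subalg M F" "distr M S X" ..
  interpret sigma_finite_subalgebra M F
    by (intro finite_measure_subalgebra_is_sigma_finite finite_measure_subalgebra.intro
      finite_measure_subalgebra_axioms.intro F) unfold_locales
  have hQ [measurable]: "h \<in> borel_measurable (F \<Otimes>\<^sub>M distr M S X)"
    using h by (simp cong: measurable_cong_sets sets_pair_measure_cong)
  have joint: "distr M (F \<Otimes>\<^sub>M S) (\<lambda>\<omega>. (\<omega>, X \<omega>)) = restr_to_subalg M F \<Otimes>\<^sub>M distr M S X"
    by (rule distr_indep_of_algebra[OF F X])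
  have pint: "integrable (restr_to_subalg M F \<Otimes>\<^sub>M distr M S X) k"
    if k: "k \<in> borel_measurable (F \<Otimes>\<^sub>M S)" "integrable M (\<lambda>\<omega>. k (\<omega>, X \<omega>))" for k :: "_ \<Rightarrow> real"
    unfolding joint[symmetric] using k by (subst integrable_distr_eq) auto
  have meas: "(\<lambda>\<omega>. \<integral>q. h (\<omega>, q) \<partial>distr M S X) \<in> borel_measurable F"
    by measurable
  have "AE \<omega> in restr_to_subalg M F. integrable (distr M S X) (\<lambda>q. h (\<omega>, q))"
    by (rule RQ.AE_integrable_fst'[OF pint[OF h int]])
  then show "AE \<omega> in M. integrable (distr M S X) (\<lambda>q. h (\<omega>, q))"
    by (rule AE_restr_to_subalg[OF F])
  show "AE \<omega> in M. real_cond_exp M F (\<lambda>\<omega>. h (\<omega>, X \<omega>)) \<omega> = (\<integral>q. h (\<omega>, q) \<partial>distr M S X)"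
  proof (rule real_cond_exp_charact)
    show "integrable M (\<lambda>\<omega>. \<integral>q. h (\<omega>, q) \<partial>distr M S X)"
      by (rule integrable_from_subalg[OF F]) (rule RQ.integrable_fst'[OF pint[OF h int]])
    fix A assume A [measurable]: "A \<in> sets F"
    then have [measurable]: "A \<in> events" using F by (auto simp: subalgebra_def)
    let ?k = "\<lambda>p. indicator A (fst p) * h p"
    have k: "?k \<in> borel_measurable (F \<Otimes>\<^sub>M S)" by measurable
    have ki: "integrable M (\<lambda>\<omega>. ?k (\<omega>, X \<omega>))"
      using integrable_mult_indicator[OF \<open>A \<in> events\<close> int] by simp
    have "(\<integral>\<omega>\<in>A. h (\<omega>, X \<omega>) \<partial>M) = (\<integral>\<omega>. ?k (\<omega>, X \<omega>) \<partial>M)"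
      by (simp add: set_lebesgue_integral_def)
    also have "\<dots> = (\<integral>p. ?k p \<partial>distr M (F \<Otimes>\<^sub>M S) (\<lambda>\<omega>. (\<omega>, X \<omega>)))"
      using k by (subst integral_distr) auto
    also have "\<dots> = (\<integral>\<omega>. \<integral>q. ?k (\<omega>, q) \<partial>distr M S X \<partial>restr_to_subalg M F)"
      unfolding joint by (rule RQ.integral_fst'[OF pint[OF k ki], symmetric])
    also have "\<dots> = (\<integral>\<omega>. \<integral>q. ?k (\<omega>, q) \<partial>distr M S X \<partial>M)"
      by (rule integral_subalgebra2[OF F]) measurable
    also have "\<dots> = (\<integral>\<omega>\<in>A. (\<integral>q. h (\<omega>, q) \<partial>distr M S X) \<partial>M)"
      by (simp add: set_lebesgue_integral_def)
    finally show "(\<integral>\<omega>\<in>A. h (\<omega>, X \<omega>) \<partial>M) = (\<integral>\<omega>\<in>A. (\<integral>q. h (\<omega>, q) \<partial>distr M S X) \<partial>M)" .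
  qed (use int meas in auto)
qed

text \<open>Independence passes to almost sure limits through bounded continuous functions.
  Dominated convergence in k transfers it to \<open>Q'\<close> for f n, which is 1 on D and 0 at
  distance 1/n or more; letting n grow gives closed sets D, an intersection-stable generator of the
  Borel sets.\<close>

lemma indep_of_algebra_limit:
  fixes Q :: "nat \<Rightarrow> 'a \<Rightarrow> 'b :: metric_space"
  assumes F: "sets F \<subseteq> events"
    and Qk: "\<And>k. indep_of_algebra F borel (Q k)"
    and Q' [measurable]: "Q' \<in> borel_measurable M"
    and lim: "AE \<omega> in M. (\<lambda>k. Q k \<omega>) \<longlonglongrightarrow> Q' \<omega>"
  shows "indep_of_algebra F borel Q'"
  unfolding indep_of_algebra_def
proof (intro conjI ballI)
  fix A and C :: "'b set" assume A: "A \<in> sets F" and C: "C \<in> sets borel"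
  then have [measurable]: "A \<in> events" using F by auto
  have [measurable]: "Q k \<in> borel_measurable M" for k using Qk by (simp add: indep_of_algebra_def)
  \<comment> \<open>As measures: restricting to A before taking the law of \<open>Q k\<close> only
    scales that law by prob A.\<close>
  have fac: "(\<integral>\<^sup>+\<omega>. indicator A \<omega> * f (Q k \<omega>) \<partial>M) = ennreal (prob A) * (\<integral>\<^sup>+\<omega>. f (Q k \<omega>) \<partial>M)"
    if [measurable]: "f \<in> borel_measurable borel" for f :: "'b \<Rightarrow> ennreal" and k
  proof -
    have "distr (density M (indicator A)) borel (Q k) = scale_measure (ennreal (prob A)) (distr M borel (Q k))"
    proof (rule measure_eqI)
      fix B assume "B \<in> sets (distr (density M (indicator A)) borel (Q k))"
      then have [measurable]: "B \<in> sets borel" by simp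
      have "emeasure (distr (density M (indicator A)) borel (Q k)) B = emeasure M (A \<inter> (Q k -` B \<inter> space M))"
        by (simp add: emeasure_distr emeasure_density indicator_inter_arith[symmetric])
      also have "\<dots> = ennreal (prob A) * emeasure M (Q k -` B \<inter> space M)"
        using Qk[of k] A \<open>B \<in> sets borel\<close> unfolding indep_of_algebra_def
        by (simp add: emeasure_eq_measure ennreal_mult)
      finally show "emeasure (distr (density M (indicator A)) borel (Q k)) B =
          emeasure (scale_measure (ennreal (prob A)) (distr M borel (Q k))) B"
        by (simp add: emeasure_distr)
    qed simp
    then have "(\<integral>\<^sup>+x. f x \<partial>distr (density M (indicator A)) borel (Q k)) =
        (\<integral>\<^sup>+x. f x \<partial>scale_measure (ennreal (prob A)) (distr M borel (Q k)))" by simp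
    then show ?thesis
      by (simp add: nn_integral_distr nn_integral_density nn_integral_scale_measure)
  qed
  have closed_case: "emeasure M (A \<inter> (Q' -` D \<inter> space M)) = ennreal (prob A) * emeasure M (Q' -` D \<inter> space M)"
    if D: "closed D" for D :: "'b set"
  \<comment> \<open>By convention \<open>infdist\<close> to the empty set is 0, so the functions
    below would approximate the wrong indicator.\<close>
  proof (cases "D = {}")
    case False
    define f where "f n x = max 0 (1 - real n * infdist x D)" for n x
    have [measurable]: "f n \<in> borel_measurable borel" for n
      unfolding f_def by (intro borel_measurable_continuous_onI continuous_intros)
    have f01: "0 \<le> f n x" "f n x \<le> 1" for n x
      by (auto simp: f_def infdist_nonneg)
    have flim: "(\<lambda>n. ennreal (f n x)) \<longlonglongrightarrow> indicator D x" for x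
    proof (cases "x \<in> D")
      case True
      then show ?thesis by (simp add: f_def)
    next
      case False
      then have "infdist x D > 0"
        using D \<open>D \<noteq> {}\<close> in_closed_iff_infdist_zero[of D x] infdist_nonneg[of x D] by (auto simp: less_le)
      then obtain N where N: "1 < real N * infdist x D" using reals_Archimedean3 by blast
      have "eventually (\<lambda>n. ennreal (f n x) = 0) sequentially"
        using eventually_ge_at_top[of N]
      proof eventually_elim
        case (elim n)
        have "real N * infdist x D \<le> real n * infdist x D"
          using elim infdist_nonneg by (intro mult_right_mono) auto
        with N show ?case by (simp add: f_def)
      qed
      with False show ?thesis by (simp add: tendsto_eventually)
    qed
    have fin: "(\<integral>\<^sup>+\<omega>. 1 \<partial>M) < \<infinity>" by (simp add: emeasure_space_1)
    have 1: "(\<integral>\<^sup>+\<omega>. indicator A \<omega> * ennreal (f n (Q' \<omega>)) \<partial>M) = ennreal (prob A) * (\<integral>\<^sup>+\<omega>. ennreal (f n (Q' \<omega>)) \<partial>M)" for n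
    proof (rule LIMSEQ_unique)
      have cont: "AE \<omega> in M. (\<lambda>k. f n (Q k \<omega>)) \<longlonglongrightarrow> f n (Q' \<omega>)"
        using lim unfolding f_def by eventually_elim (intro tendsto_intros)
      show "(\<lambda>k. \<integral>\<^sup>+\<omega>. indicator A \<omega> * ennreal (f n (Q k \<omega>)) \<partial>M) \<longlonglongrightarrow> (\<integral>\<^sup>+\<omega>. indicator A \<omega> * ennreal (f n (Q' \<omega>)) \<partial>M)"
      proof (rule nn_integral_dominated_convergence[OF _ _ _ _ fin])
        show "AE \<omega> in M. (\<lambda>k. indicator A \<omega> * ennreal (f n (Q k \<omega>))) \<longlonglongrightarrow> indicator A \<omega> * ennreal (f n (Q' \<omega>))"
          using cont by eventually_elim (auto simp: indicator_def intro!: tendsto_ennrealI)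
        show "AE \<omega> in M. indicator A \<omega> * ennreal (f n (Q k \<omega>)) \<le> 1" for k
          using f01 by (auto simp: indicator_def)
      qed auto
      have "(\<lambda>k. \<integral>\<^sup>+\<omega>. ennreal (f n (Q k \<omega>)) \<partial>M) \<longlonglongrightarrow> (\<integral>\<^sup>+\<omega>. ennreal (f n (Q' \<omega>)) \<partial>M)"
      proof (rule nn_integral_dominated_convergence[OF _ _ _ _ fin])
        show "AE \<omega> in M. (\<lambda>k. ennreal (f n (Q k \<omega>))) \<longlonglongrightarrow> ennreal (f n (Q' \<omega>))"
          using cont by eventually_elim (auto intro!: tendsto_ennrealI)
        show "AE \<omega> in M. ennreal (f n (Q k \<omega>)) \<le> 1" for k using f01 by auto
      qed auto
      then have "(\<lambda>k. ennreal (prob A) * (\<integral>\<^sup>+\<omega>. ennreal (f n (Q k \<omega>)) \<partial>M)) \<longlonglongrightarrow>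
          ennreal (prob A) * (\<integral>\<^sup>+\<omega>. ennreal (f n (Q' \<omega>)) \<partial>M)"
        by (intro ennreal_tendsto_cmult) auto
      then show "(\<lambda>k. \<integral>\<^sup>+\<omega>. indicator A \<omega> * ennreal (f n (Q k \<omega>)) \<partial>M) \<longlonglongrightarrow>
          ennreal (prob A) * (\<integral>\<^sup>+\<omega>. ennreal (f n (Q' \<omega>)) \<partial>M)"
        by (subst fac) auto
    qed
    have [measurable]: "D \<in> sets borel" using D by auto
    have "(\<integral>\<^sup>+\<omega>. indicator A \<omega> * indicator D (Q' \<omega>) \<partial>M) = ennreal (prob A) * (\<integral>\<^sup>+\<omega>. indicator D (Q' \<omega>) \<partial>M)"
    proof (rule LIMSEQ_unique)
      show "(\<lambda>n. \<integral>\<^sup>+\<omega>. indicator A \<omega> * ennreal (f n (Q' \<omega>)) \<partial>M) \<longlonglongrightarrow> (\<integral>\<^sup>+\<omega>. indicator A \<omega> * indicator D (Q' \<omega>) \<partial>M)"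
      proof (rule nn_integral_dominated_convergence[OF _ _ _ _ fin])
        show "AE \<omega> in M. (\<lambda>n. indicator A \<omega> * ennreal (f n (Q' \<omega>))) \<longlonglongrightarrow> indicator A \<omega> * indicator D (Q' \<omega>)"
          using flim by (intro AE_I2) (auto simp: indicator_def[of A])
        show "AE \<omega> in M. indicator A \<omega> * ennreal (f n (Q' \<omega>)) \<le> 1" for n
          using f01 by (auto simp: indicator_def)
      qed auto
      have "(\<lambda>n. \<integral>\<^sup>+\<omega>. ennreal (f n (Q' \<omega>)) \<partial>M) \<longlonglongrightarrow> (\<integral>\<^sup>+\<omega>. indicator D (Q' \<omega>) \<partial>M)"
        by (rule nn_integral_dominated_convergence[OF _ _ _ _ fin]) (use flim f01 in auto)
      then show "(\<lambda>n. \<integral>\<^sup>+\<omega>. indicator A \<omega> * ennreal (f n (Q' \<omega>)) \<partial>M) \<longlonglongrightarrow>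
          ennreal (prob A) * (\<integral>\<^sup>+\<omega>. indicator D (Q' \<omega>) \<partial>M)"
        unfolding 1 by (intro ennreal_tendsto_cmult) auto
    qed
    moreover have "(\<integral>\<^sup>+\<omega>. indicator A \<omega> * indicator D (Q' \<omega>) \<partial>M) =
        (\<integral>\<^sup>+\<omega>. indicator (A \<inter> (Q' -` D \<inter> space M)) \<omega> \<partial>M)"
      by (intro nn_integral_cong) (auto split: split_indicator)
    moreover have "(\<integral>\<^sup>+\<omega>. indicator (A \<inter> (Q' -` D \<inter> space M)) \<omega> \<partial>M) = emeasure M (A \<inter> (Q' -` D \<inter> space M))"
      by (rule nn_integral_indicator) measurable
    moreover have "(\<integral>\<^sup>+\<omega>. indicator D (Q' \<omega>) \<partial>M) = (\<integral>\<^sup>+\<omega>. indicator (Q' -` D \<inter> space M) \<omega> \<partial>M)"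
      by (intro nn_integral_cong) (auto split: split_indicator)
    moreover have "(\<integral>\<^sup>+\<omega>. indicator (Q' -` D \<inter> space M) \<omega> \<partial>M) = emeasure M (Q' -` D \<inter> space M)"
      by (rule nn_integral_indicator) measurable
    ultimately show ?thesis by simp
  qed simp
  have "distr (density M (indicator A)) borel Q' = scale_measure (ennreal (prob A)) (distr M borel Q')"
  proof (rule measure_eqI_generator_eq)
    show "Int_stable (Collect closed :: 'b set set)" by (auto simp: Int_stable_def)
    show "Collect closed \<subseteq> Pow (UNIV :: 'b set)" by auto
    show "sets (distr (density M (indicator A)) borel Q') = sigma_sets UNIV (Collect closed)"
      by (simp add: borel_eq_closed)
    show "sets (scale_measure (ennreal (prob A)) (distr M borel Q')) = sigma_sets UNIV (Collect closed)"
      by (simp add: borel_eq_closed)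
    show "range (\<lambda>_::nat. UNIV :: 'b set) \<subseteq> Collect closed" by auto
    have em: "emeasure (distr (density M (indicator A)) borel Q') D = emeasure M (A \<inter> (Q' -` D \<inter> space M))"
      if "D \<in> sets borel" for D
      using that by (simp add: emeasure_distr emeasure_density indicator_inter_arith[symmetric])
    show "emeasure (distr (density M (indicator A)) borel Q') UNIV \<noteq> \<infinity>" by (simp add: em)
    fix D :: "'b set" assume "D \<in> Collect closed"
    then show "emeasure (distr (density M (indicator A)) borel Q') D =
        emeasure (scale_measure (ennreal (prob A)) (distr M borel Q')) D"
      using closed_case[of D] by (simp only: em borel_closed mem_Collect_eq) (simp add: emeasure_distr)
  qed auto
  then have "emeasure (distr (density M (indicator A)) borel Q') C = emeasure (scale_measure (ennreal (prob A)) (distr M borel Q')) C"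
    by simp
  then have "emeasure M (A \<inter> (Q' -` C \<inter> space M)) = ennreal (prob A) * emeasure M (Q' -` C \<inter> space M)"
    using C by (simp add: emeasure_distr emeasure_density indicator_inter_arith[symmetric])
  then show "prob (A \<inter> (Q' -` C \<inter> space M)) = prob A * prob (Q' -` C \<inter> space M)"
    by (simp add: emeasure_eq_measure ennreal_mult[symmetric])
qed simp

end

section \<open>Brownian increments and the augmented filtration\<close>

locale brownian =
  fixes P :: "'a measure" and W :: "real \<Rightarrow> 'a \<Rightarrow> real"
  assumes bm: "brownian_motion P W"
begin

sublocale prob_space P
  using bm by (simp add: brownian_motion_def)

lemma W_measurable: "0 \<le> t \<Longrightarrow> W t \<in> borel_measurable P"
  and W_0: "AE \<omega> in P. W 0 \<omega> = 0"
  and W_continuous: "AE \<omega> in P. continuous_on {0..} (\<lambda>t. W t \<omega>)"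
  using bm by (auto simp: brownian_motion_def)

lemma past_event_measurable:
  assumes "finite S" "S \<subseteq> {0..u}" "\<And>s. s \<in> S \<Longrightarrow> B s \<in> sets borel"
  shows "{\<omega>\<in>space P. \<forall>s\<in>S. W s \<omega> \<in> B s} \<in> events"
proof (rule sets.sets_Collect_finite_All[OF _ assms(1)])
  fix s assume "s \<in> S"
  then have "W s -` B s \<inter> space P \<in> events"
    using assms by (intro measurable_sets[OF W_measurable]) auto
  moreover have "{\<omega>\<in>space P. W s \<omega> \<in> B s} = W s -` B s \<inter> space P" by auto
  ultimately show "{\<omega>\<in>space P. W s \<omega> \<in> B s} \<in> events" by simp
qed

text \<open>All times are merged into one increasing grid. The past event is a function of the grid
  increments before u and the other event of those after u, so independence of disjoint blocks of
  increments applies.\<close>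

lemma prob_past_future:
  assumes S: "finite S" "S \<subseteq> {0..u}" and u: "0 \<le> u" and B: "\<And>s. s \<in> S \<Longrightarrow> B s \<in> sets borel"
    and t: "\<And>i. i < M \<Longrightarrow> u \<le> t i" and C: "C \<in> sets (borel :: (nat \<Rightarrow> real) measure)"
  shows "prob ({\<omega>\<in>space P. \<forall>s\<in>S. W s \<omega> \<in> B s} \<inter>
      {\<omega>\<in>space P. (\<lambda>i. if i < M then W (t i) \<omega> - W u \<omega> else 0) \<in> C}) =
    prob {\<omega>\<in>space P. \<forall>s\<in>S. W s \<omega> \<in> B s} *
    prob {\<omega>\<in>space P. (\<lambda>i. if i < M then W (t i) \<omega> - W u \<omega> else 0) \<in> C}"
proof -
  \<comment> \<open>Time 0 makes W s - W 0 a sum of grid increments; time u makes the grid split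
    exactly at u.\<close>
  define J where "J = insert 0 (insert u (S \<union> t ` {..<M}))"
  have J: "finite J" "0 \<in> J" "u \<in> J" "S \<subseteq> J" "\<And>i. i < M \<Longrightarrow> t i \<in> J" "\<And>s. s \<in> J \<Longrightarrow> 0 \<le> s"
    using S u t by (auto simp: J_def intro: order_trans)
  define \<tau> where "\<tau> i = sorted_list_of_set J ! i" for i
  define N where "N = card J - 1"
  have "card J \<noteq> 0" using J(1,2) by auto
  then have cardJ: "card J = Suc N" by (simp add: N_def)
  have len: "length (sorted_list_of_set J) = Suc N" using J cardJ by simp
  have mono: "\<tau> i < \<tau> j" if "i < j" "j \<le> N" for i j
  proof -
    have "sorted_wrt (<) (sorted_list_of_set J)" by simp
    then show ?thesis unfolding \<tau>_def by (rule sorted_wrt_nth_less) (use that len in auto)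
  qed
  have mono': "i < j" if "\<tau> i < \<tau> j" "i \<le> N" "j \<le> N" for i j
    using mono[of j i] that by (cases i j rule: linorder_cases) auto
  have "\<forall>s\<in>J. \<exists>k\<le>N. \<tau> k = s"
  proof
    fix s assume "s \<in> J"
    then have "s \<in> set (sorted_list_of_set J)" using J by simp
    then show "\<exists>k\<le>N. \<tau> k = s" using len by (auto simp: \<tau>_def in_set_conv_nth less_Suc_eq_le)
  qed
  then obtain k where k: "\<And>s. s \<in> J \<Longrightarrow> k s \<le> N" "\<And>s. s \<in> J \<Longrightarrow> \<tau> (k s) = s" by metis
  have tauJ: "\<tau> i \<in> J" if "i \<le> N" for i
    using that len J nth_mem[of i "sorted_list_of_set J"] by (simp add: \<tau>_def less_Suc_eq_le)
  have tau0: "\<tau> 0 = 0"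
  proof -
    have "k 0 = 0" using mono[of 0 "k 0"] k[OF J(2)] J(6)[OF tauJ[of 0]] by (cases "k 0 = 0") auto
    then show ?thesis using k(2)[OF J(2)] by simp
  qed
  define n where "n = k u"
  have n: "n \<le> N" "\<tau> n = u" using k J by (auto simp: n_def)
  have kS: "k s \<le> n" if "s \<in> S" for s
  proof (rule ccontr)
    assume "\<not> k s \<le> n"
    moreover have "s \<in> J" "s \<le> u" using that S J(4) by auto
    ultimately show False using mono[of n "k s"] k[of s] n by auto
  qed
  have kt: "n \<le> k (t i)" "k (t i) \<le> N" if "i < M" for i
    using mono[of "k (t i)" n] k[of "t i"] n that t[of i] J(5) by (cases "n \<le> k (t i)", auto)
  define \<xi> where "\<xi> i \<omega> = W (\<tau> (Suc i)) \<omega> - W (\<tau> i) \<omega>" for i \<omega>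
  have sum: "(\<Sum>i\<in>{a..<b}. \<xi> i \<omega>) = W (\<tau> b) \<omega> - W (\<tau> a) \<omega>" if "a \<le> b" for a b \<omega>
    unfolding \<xi>_def using that by (rule sum_Suc_diff')
  have "indep_vars (\<lambda>_. borel) \<xi> {..<N}"
    using bm tau0 mono unfolding brownian_motion_def \<xi>_def by auto
  then have ind: "indep_var (PiM {..<n} (\<lambda>_. borel)) (\<lambda>\<omega>. restrict (\<lambda>i. \<xi> i \<omega>) {..<n})
      (PiM {n..<N} (\<lambda>_. borel)) (\<lambda>\<omega>. restrict (\<lambda>i. \<xi> i \<omega>) {n..<N})"
    by (rule indep_var_restrict) (use n in auto)
  define Xa where "Xa = {f \<in> space (PiM {..<n} (\<lambda>_. borel :: real measure)). \<forall>s\<in>S. (\<Sum>i\<in>{0..<k s}. f i) \<in> B s}"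
  define G :: "(nat \<Rightarrow> real) \<Rightarrow> nat \<Rightarrow> real"
    where "G f = (\<lambda>i. if i < M then (\<Sum>j\<in>{n..<k (t i)}. f j) else 0)" for f
  define Xb where "Xb = G -` C \<inter> space (PiM {n..<N} (\<lambda>_. borel :: real measure))"
  have Xa: "Xa \<in> sets (PiM {..<n} (\<lambda>_. borel))"
  proof -
    have "(\<lambda>f. \<Sum>i\<in>{0..<k s}. f i) \<in> borel_measurable (PiM {..<n} (\<lambda>_. borel :: real measure))" if "s \<in> S" for s
      using kS[OF that] by (intro borel_measurable_sum measurable_component_singleton) auto
    then show ?thesis unfolding Xa_def using S(1) B
      by (intro sets.sets_Collect_finite_All) (auto intro!: measurable_sets_Collect[of _ _ borel])
  qed
  have "G \<in> borel_measurable (PiM {n..<N} (\<lambda>_. borel :: real measure))"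
  proof (rule measurable_coordinatewise_then_product)
    fix i
    show "(\<lambda>f. G f i) \<in> borel_measurable (PiM {n..<N} (\<lambda>_. borel :: real measure))"
    proof (cases "i < M")
      case True
      then show ?thesis unfolding G_def using kt[OF True]
        by (auto intro!: borel_measurable_sum measurable_component_singleton)
    qed (simp add: G_def)
  qed
  then have Xb: "Xb \<in> sets (PiM {n..<N} (\<lambda>_. borel))" unfolding Xb_def using C by (rule measurable_sets)
  let ?R1 = "\<lambda>\<omega>. restrict (\<lambda>i. \<xi> i \<omega>) {..<n}" and ?R2 = "\<lambda>\<omega>. restrict (\<lambda>i. \<xi> i \<omega>) {n..<N}"
  define A where "A = {\<omega>\<in>space P. \<forall>s\<in>S. W s \<omega> \<in> B s}"
  define D where "D = {\<omega>\<in>space P. (\<lambda>i. if i < M then W (t i) \<omega> - W u \<omega> else 0) \<in> C}"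
  have D: "?R2 -` Xb \<inter> space P = D"
  proof -
    have "G (?R2 \<omega>) = (\<lambda>i. if i < M then W (t i) \<omega> - W u \<omega> else 0)" for \<omega>
    proof
      fix i
      have "(\<Sum>j\<in>{n..<k (t i)}. ?R2 \<omega> j) = (\<Sum>j\<in>{n..<k (t i)}. \<xi> j \<omega>)" if "i < M"
        using kt[OF that] by (intro sum.cong) auto
      then show "G (?R2 \<omega>) i = (if i < M then W (t i) \<omega> - W u \<omega> else 0)"
        using kt[of i] sum[of n "k (t i)" \<omega>] k(2)[OF J(5)] n(2) by (auto simp: G_def)
    qed
    then show ?thesis by (auto simp: Xb_def D_def space_PiM)
  qed
  have A: "?R1 -` Xa \<inter> space P = {\<omega>\<in>space P. \<forall>s\<in>S. W s \<omega> - W 0 \<omega> \<in> B s}"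
  proof -
    have "(\<Sum>i\<in>{0..<k s}. ?R1 \<omega> i) = W s \<omega> - W 0 \<omega>" if "s \<in> S" for s \<omega>
    proof -
      have "(\<Sum>i\<in>{0..<k s}. ?R1 \<omega> i) = (\<Sum>i\<in>{0..<k s}. \<xi> i \<omega>)"
        using kS[OF that] by (intro sum.cong) auto
      then show ?thesis using sum[of 0 "k s" \<omega>] k(2)[of s] that J(4) tau0 by auto
    qed
    then show ?thesis by (auto simp: Xa_def space_PiM)
  qed
  have A'm: "{\<omega>\<in>space P. \<forall>s\<in>S. W s \<omega> - W 0 \<omega> \<in> B s} \<in> events"
    unfolding A[symmetric] by (rule measurable_sets[OF indep_var_rv1[OF ind] Xa])
  have Am: "A \<in> events"
    unfolding A_def by (rule past_event_measurable[OF S B])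
  have Dm: "D \<in> events" unfolding D[symmetric] by (rule measurable_sets[OF indep_var_rv2[OF ind] Xb])
  have "prob ((\<lambda>\<omega>. (?R1 \<omega>, ?R2 \<omega>)) -` (Xa \<times> Xb) \<inter> space P) = prob (?R1 -` Xa \<inter> space P) * prob (?R2 -` Xb \<inter> space P)"
    by (rule indep_varD[OF ind Xa Xb])
  also have "(\<lambda>\<omega>. (?R1 \<omega>, ?R2 \<omega>)) -` (Xa \<times> Xb) \<inter> space P = (?R1 -` Xa \<inter> space P) \<inter> (?R2 -` Xb \<inter> space P)" by auto
  finally have eq: "prob ({\<omega>\<in>space P. \<forall>s\<in>S. W s \<omega> - W 0 \<omega> \<in> B s} \<inter> D) =
      prob {\<omega>\<in>space P. \<forall>s\<in>S. W s \<omega> - W 0 \<omega> \<in> B s} * prob D" unfolding A D .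
  have "prob {\<omega>\<in>space P. \<forall>s\<in>S. W s \<omega> - W 0 \<omega> \<in> B s} = prob A"
    using W_0 by (intro finite_measure_eq_AE A'm Am) (auto simp: A_def)
  moreover have "prob ({\<omega>\<in>space P. \<forall>s\<in>S. W s \<omega> - W 0 \<omega> \<in> B s} \<inter> D) = prob (A \<inter> D)"
    using W_0 by (intro finite_measure_eq_AE sets.Int A'm Am Dm) (auto simp: A_def)
  ultimately show ?thesis using eq unfolding A_def D_def by simp
qed

abbreviation "G \<equiv> generated_filtration P W"
abbreviation "\<F> \<equiv> brownian_filtration P W"

lemma space_G [simp]: "space (G t) = space P"
  and sets_G: "sets (G t) = sigma_sets (space P) {W s -` B \<inter> space P | s B. 0 \<le> s \<and> s \<le> t \<and> B \<in> sets borel}"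
  unfolding generated_filtration_def by (auto simp: space_measure_of_conv intro!: sets_measure_of)

lemma sets_G_subset: "sets (G t) \<subseteq> events"
  unfolding sets_G by (rule sets.sigma_sets_subset) (auto intro: measurable_sets[OF W_measurable])

text \<open>One random element of the sequence space, padded with 0 from M on, so that a single
  independence statement covers the joint law.\<close>

definition increments :: "nat \<Rightarrow> (nat \<Rightarrow> real) \<Rightarrow> real \<Rightarrow> 'a \<Rightarrow> nat \<Rightarrow> real" where
  "increments M t u \<omega> = (\<lambda>i. if i < M then W (t i) \<omega> - W u \<omega> else 0)"

lemma increments_measurable:
  assumes "0 \<le> u" "\<And>i. i < M \<Longrightarrow> u \<le> t i"
  shows "increments M t u \<in> borel_measurable P"
proof (rule measurable_coordinatewise_then_product)
  fix i
  show "(\<lambda>\<omega>. increments M t u \<omega> i) \<in> borel_measurable P"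
    unfolding increments_def using assms order_trans[OF assms]
    by (cases "i < M") (auto intro!: borel_measurable_diff W_measurable)
qed

text \<open>Finite-dimensional events of the past are stable under intersection and generate
  \<open>G u\<close>, so independence extends from them to the sigma-algebra.\<close>

lemma indep_G_increments:
  assumes u: "0 \<le> u" and t: "\<And>i. i < M \<Longrightarrow> u \<le> t i"
  shows "indep_of_algebra (G u) borel (increments M t u)"
proof -
  define K where "K = {{\<omega>\<in>space P. \<forall>s\<in>S. W s \<omega> \<in> B s} | S B. finite S \<and> S \<subseteq> {0..u} \<and> (\<forall>s. B s \<in> sets (borel :: real measure))}"
  define L where "L = {increments M t u -` C \<inter> space P | C. C \<in> sets borel}"
  have KI: "{\<omega>\<in>space P. \<forall>s\<in>S. W s \<omega> \<in> B s} \<in> K"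
    if "finite S" "S \<subseteq> {0..u}" "\<And>s. B s \<in> sets borel" for S B
    using that unfolding K_def by blast
  have Kev: "K \<subseteq> events"
  proof
    fix a assume "a \<in> K"
    then obtain S B where a: "a = {\<omega>\<in>space P. \<forall>s\<in>S. W s \<omega> \<in> B s}" and S: "finite S" "S \<subseteq> {0..u}"
      and B: "\<And>s. B s \<in> sets borel" unfolding K_def by blast
    show "a \<in> events" unfolding a by (rule past_event_measurable[OF S B])
  qed
  have Lev: "L \<subseteq> events" unfolding L_def using measurable_sets[OF increments_measurable[OF assms]] by auto
  have "indep_set K L"
  proof (rule indep_setI[OF Kev Lev])
    fix a b assume "a \<in> K" "b \<in> L"
    then obtain S B C where a: "a = {\<omega>\<in>space P. \<forall>s\<in>S. W s \<omega> \<in> B s}" and S: "finite S" "S \<subseteq> {0..u}"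
      and B: "\<And>s. B s \<in> sets borel" and b: "b = increments M t u -` C \<inter> space P" and C: "C \<in> sets borel"
      unfolding K_def L_def by blast
    have b': "b = {\<omega>\<in>space P. (\<lambda>i. if i < M then W (t i) \<omega> - W u \<omega> else 0) \<in> C}"
      unfolding b increments_def by auto
    show "prob (a \<inter> b) = prob a * prob b"
      unfolding a b' by (rule prob_past_future[OF S u B t C])
  qed
  moreover have "Int_stable K"
  proof (rule Int_stableI)
    fix a b assume "a \<in> K" "b \<in> K"
    then obtain S B S' B' where a: "a = {\<omega>\<in>space P. \<forall>s\<in>S. W s \<omega> \<in> B s}" and S: "finite S" "S \<subseteq> {0..u}"
      and B: "\<And>s. B s \<in> sets borel"
      and b: "b = {\<omega>\<in>space P. \<forall>s\<in>S'. W s \<omega> \<in> B' s}" and S': "finite S'" "S' \<subseteq> {0..u}"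
      and B': "\<And>s. B' s \<in> sets borel" unfolding K_def by blast
    \<comment> \<open>Times that occur in only one of the two events receive the trivial condition
      UNIV from the other.\<close>
    define B'' where "B'' s = (if s \<in> S then B s else UNIV) \<inter> (if s \<in> S' then B' s else UNIV)" for s
    have "a \<inter> b = {\<omega>\<in>space P. \<forall>s\<in>S \<union> S'. W s \<omega> \<in> B'' s}" unfolding a b B''_def by auto
    moreover have "B'' s \<in> sets borel" for s using B B' by (simp add: B''_def)
    ultimately show "a \<inter> b \<in> K" using S S' by (auto intro!: KI)
  qed
  moreover have "Int_stable L"
  proof (rule Int_stableI)
    fix a b assume "a \<in> L" "b \<in> L"
    then obtain C C' where "a = increments M t u -` C \<inter> space P" "C \<in> sets borel"
      "b = increments M t u -` C' \<inter> space P" "C' \<in> sets borel" unfolding L_def by blast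
    then have "a \<inter> b = increments M t u -` (C \<inter> C') \<inter> space P" "C \<inter> C' \<in> sets borel" by auto
    then show "a \<inter> b \<in> L" unfolding L_def by blast
  qed
  ultimately have ind: "indep_set (sigma_sets (space P) K) (sigma_sets (space P) L)"
    by (rule indep_set_sigma_sets)
  have "sets (G u) \<subseteq> sigma_sets (space P) K"
    unfolding sets_G
  proof (rule sigma_sets_mono)
    show "{W s -` B \<inter> space P | s B. 0 \<le> s \<and> s \<le> u \<and> B \<in> sets borel} \<subseteq> sigma_sets (space P) K"
    proof clarify
      fix s and B :: "real set" assume s: "0 \<le> s" "s \<le> u" and B: "B \<in> sets borel"
      have "{\<omega>\<in>space P. \<forall>s'\<in>{s}. W s' \<omega> \<in> B} \<in> K" using s B by (intro KI) auto
      moreover have "{\<omega>\<in>space P. \<forall>s'\<in>{s}. W s' \<omega> \<in> B} = W s -` B \<inter> space P" by auto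
      ultimately show "W s -` B \<inter> space P \<in> sigma_sets (space P) K" by auto
    qed
  qed
  note sub = this
  show ?thesis
    unfolding indep_of_algebra_def
  proof (intro conjI ballI)
    show "increments M t u \<in> borel_measurable P" by (rule increments_measurable[OF assms])
    fix A C assume A: "A \<in> sets (G u)" and C: "C \<in> sets (borel :: (nat \<Rightarrow> real) measure)"
    show "prob (A \<inter> (increments M t u -` C \<inter> space P)) = prob A * prob (increments M t u -` C \<inter> space P)"
    proof (rule indep_setD[OF ind])
      show "A \<in> sigma_sets (space P) K" using A sub by blast
      show "increments M t u -` C \<inter> space P \<in> sigma_sets (space P) L"
        using C unfolding L_def by (intro sigma_sets.Basic) blast
    qed
  qed
qed

text \<open>Agreement with a set of \<open>G u\<close> up to a null set holds for the generators and
  survives complements and countable unions.\<close>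

lemma augmented_set_AE_eq:
  assumes "A \<in> sigma_sets (space P) (sets (G u) \<union> null_sets P)"
  shows "A \<in> events \<and> (\<exists>A'\<in>sets (G u). AE \<omega> in P. \<omega> \<in> A \<longleftrightarrow> \<omega> \<in> A')"
  using assms
proof (induction rule: sigma_sets.induct)
  case (Basic a)
  then show ?case
  proof
    assume "a \<in> null_sets P"
    then have "AE \<omega> in P. \<omega> \<in> a \<longleftrightarrow> \<omega> \<in> {}" using AE_not_in[of a P] by simp
    with \<open>a \<in> null_sets P\<close> show ?case by blast
  qed (use sets_G_subset in auto)
next
  case Empty
  show ?case by auto
next
  case (Compl a)
  then obtain a' where "a' \<in> sets (G u)" "AE \<omega> in P. \<omega> \<in> a \<longleftrightarrow> \<omega> \<in> a'" by blast
  moreover from this(2) have "AE \<omega> in P. \<omega> \<in> space P - a \<longleftrightarrow> \<omega> \<in> space P - a'" by eventually_elim auto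
  moreover have "space P - a' \<in> sets (G u)" using \<open>a' \<in> sets (G u)\<close> sets.compl_sets[of a' "G u"] by simp
  moreover have "space P - a \<in> events" using Compl.IH by (intro sets.compl_sets) blast
  ultimately show ?case by (intro conjI bexI[of _ "space P - a'"])
next
  case (Union a)
  then obtain a' where a': "\<And>i. a' i \<in> sets (G u)" "\<And>i. AE \<omega> in P. \<omega> \<in> a i \<longleftrightarrow> \<omega> \<in> a' i" by metis
  have "AE \<omega> in P. \<forall>i. \<omega> \<in> a i \<longleftrightarrow> \<omega> \<in> a' i" using a'(2) by (subst AE_all_countable) auto
  then have "AE \<omega> in P. \<omega> \<in> (\<Union>i. a i) \<longleftrightarrow> \<omega> \<in> (\<Union>i. a' i)" by eventually_elim auto
  moreover have "(\<Union>i. a' i) \<in> sets (G u)" using a'(1) by auto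
  moreover have "(\<Union>i. a i) \<in> events" using Union.IH by (intro sets.countable_UN) blast
  ultimately show ?case by (intro conjI bexI[of _ "\<Union>i. a' i"])
qed

lemma indep_augmented_increments:
  assumes u: "0 \<le> u" and t: "\<And>i. i < M \<Longrightarrow> u \<le> t i"
    and A: "A \<in> sigma_sets (space P) (sets (G u) \<union> null_sets P)" and C: "C \<in> sets borel"
  shows "prob (A \<inter> (increments M t u -` C \<inter> space P)) = prob A * prob (increments M t u -` C \<inter> space P)"
proof -
  obtain A' where A': "A' \<in> sets (G u)" "AE \<omega> in P. \<omega> \<in> A \<longleftrightarrow> \<omega> \<in> A'" and Aev: "A \<in> events"
    using augmented_set_AE_eq[OF A] by blast
  have A'ev: "A' \<in> events" using A' sets_G_subset by auto
  have Cev: "increments M t u -` C \<inter> space P \<in> events" by (rule measurable_sets[OF increments_measurable[OF u t] C])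
  have "prob (A \<inter> (increments M t u -` C \<inter> space P)) = prob (A' \<inter> (increments M t u -` C \<inter> space P))"
    using A'(2) by (intro finite_measure_eq_AE sets.Int Aev A'ev Cev) auto
  moreover have "prob A = prob A'" using A'(2) by (intro finite_measure_eq_AE Aev A'ev) auto
  ultimately show ?thesis
    using indep_G_increments[OF u t] A'(1) C unfolding indep_of_algebra_def by simp
qed

lemma space_\<F> [simp]: "space (\<F> t) = space P"
  unfolding brownian_filtration_def usual_augmentation_def by (simp add: space_measure_of_conv)

text \<open>An intersection of sigma-algebras is already one, so the outer \<open>sigma\<close> of
  the augmentation adds no sets.\<close>

lemma sets_\<F>: "sets (\<F> t) = (\<Inter>u\<in>{t<..}. sigma_sets (space P) (sets (G u) \<union> null_sets P))"
proof -
  let ?A = "\<lambda>u. sigma_sets (space P) (sets (G u) \<union> null_sets P)"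
  have Pow: "sets (G u) \<union> null_sets P \<subseteq> Pow (space P)" for u
    using sets_G_subset sets.sets_into_space by blast
  have alg: "sigma_algebra (space P) (?A u)" for u by (rule sigma_algebra_sigma_sets[OF Pow])
  have "sigma_algebra (space P) (\<Inter>u\<in>{t<..}. ?A u)"
    unfolding sigma_algebra_iff2
  proof (intro conjI ballI allI impI)
    show "(\<Inter>u\<in>{t<..}. ?A u) \<subseteq> Pow (space P)"
      using sigma_sets_into_sp[OF Pow[of "t + 1"]] by (auto dest!: INT_D[of _ _ _ "t + 1"])
  qed (auto intro: sigma_sets.intros)
  then show ?thesis
    unfolding brownian_filtration_def usual_augmentation_def
    by (intro sigma_algebra.sets_measure_of_eq)
qed

lemma subalgebra_\<F>: "subalgebra P (\<F> t)"
proof -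
  have "sets (\<F> t) \<subseteq> events"
  proof
    fix A assume "A \<in> sets (\<F> t)"
    then have "A \<in> sigma_sets (space P) (sets (G (t + 1)) \<union> null_sets P)"
      unfolding sets_\<F> by (rule INT_D) simp
    then show "A \<in> events" using augmented_set_AE_eq by blast
  qed
  then show ?thesis by (simp add: subalgebra_def)
qed

lemma \<F>_mono: "s \<le> t \<Longrightarrow> sets (\<F> s) \<subseteq> sets (\<F> t)"
  unfolding sets_\<F> by auto

lemma W_measurable_\<F>: "0 \<le> s \<Longrightarrow> s \<le> t \<Longrightarrow> W s \<in> borel_measurable (\<F> t)"
proof (rule measurableI)
  fix B :: "real set" assume "0 \<le> s" "s \<le> t" "B \<in> sets borel"
  then have "W s -` B \<inter> space P \<in> sets (G u)" if "u > t" for u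
    unfolding sets_G using that by (intro sigma_sets.Basic) force
  then show "W s -` B \<inter> space (\<F> t) \<in> sets (\<F> t)" unfolding sets_\<F> by (auto intro: sigma_sets.Basic)
qed simp

text \<open>\<open>\<F> u\<close> may look infinitesimally beyond u, but it lies in the augmented
  \<open>G (u + e)\<close> for every e > 0 and so is independent of the increments shifted by e.
  Path continuity brings these back to the original increments as e tends to 0.\<close>

lemma indep_\<F>_increments:
  assumes u: "0 \<le> u" and t: "\<And>i. i < M \<Longrightarrow> u \<le> t i"
  shows "indep_of_algebra (\<F> u) borel (increments M t u)"
proof (rule indep_of_algebra_limit)
  define e where "e k = inverse (real (Suc k))" for k
  have e: "e k > 0" for k by (simp add: e_def)
  have e0: "e \<longlonglongrightarrow> 0" unfolding e_def by (rule LIMSEQ_inverse_real_of_nat)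
  show "sets (\<F> u) \<subseteq> events" using subalgebra_\<F> by (simp add: subalgebra_def)
  show "increments M t u \<in> borel_measurable P" by (rule increments_measurable[OF assms])
  show "indep_of_algebra (\<F> u) borel (increments M (\<lambda>i. t i + e k) (u + e k))" for k
    unfolding indep_of_algebra_def
  proof (intro conjI ballI)
    show "increments M (\<lambda>i. t i + e k) (u + e k) \<in> borel_measurable P"
      using u t e[of k] by (intro increments_measurable) auto
    fix A C assume "A \<in> sets (\<F> u)" "C \<in> sets (borel :: (nat \<Rightarrow> real) measure)"
    then show "prob (A \<inter> (increments M (\<lambda>i. t i + e k) (u + e k) -` C \<inter> space P)) =
        prob A * prob (increments M (\<lambda>i. t i + e k) (u + e k) -` C \<inter> space P)"
      using u t e[of k] by (intro indep_augmented_increments) (auto simp: sets_\<F>)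
  qed
  show "AE \<omega> in P. (\<lambda>k. increments M (\<lambda>i. t i + e k) (u + e k) \<omega>) \<longlonglongrightarrow> increments M t u \<omega>"
    using W_continuous
  proof eventually_elim
    case (elim \<omega>)
    have lim: "(\<lambda>k. W (s + e k) \<omega>) \<longlonglongrightarrow> W s \<omega>" if "0 \<le> s" for s
    proof (rule continuous_on_tendsto_compose[OF elim])
      show "(\<lambda>k. s + e k) \<longlonglongrightarrow> s" using tendsto_add[OF tendsto_const e0, of s] by simp
      have "0 \<le> s + e k" for k using that e[of k] by simp
      then show "\<forall>\<^sub>F k in sequentially. s + e k \<in> {0..}" by simp
    qed (use that in simp)
    have "limitin (product_topology (\<lambda>_. euclidean) UNIV)
        (\<lambda>k. increments M (\<lambda>i. t i + e k) (u + e k) \<omega>) (increments M t u \<omega>) sequentially"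
      unfolding limitin_componentwise
    proof (intro conjI ballI)
      fix i
      show "limitin euclidean (\<lambda>k. increments M (\<lambda>i. t i + e k) (u + e k) \<omega> i) (increments M t u \<omega> i) sequentially"
        using lim[of "t i"] lim[OF u] order_trans[OF u t[of i]]
        by (cases "i < M") (auto simp: increments_def limitin_canonical_iff intro!: tendsto_diff)
    qed (auto simp: extensional_def)
    then show ?case by (simp add: euclidean_product_topology limitin_canonical_iff)
  qed
qed

end

section \<open>One step of the backward Taylor expansion\<close>

lemma (in prob_space) L2_space_integrable: "f \<in> L2_space M \<Longrightarrow> integrable M f"
  unfolding L2_space_def by (auto intro: square_integrable_imp_integrable)

lemma L2_spaceI:
  assumes "f \<in> borel_measurable M" "(\<integral>\<^sup>+\<omega>. ennreal ((f \<omega>)\<^sup>2) \<partial>M) < \<infinity>"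
  shows "f \<in> L2_space M"
  unfolding L2_space_def using assms by (auto intro!: integrableI_nonneg)

lemma nn_integral_square_L2:
  assumes "f \<in> L2_space M"
  shows "(\<integral>\<^sup>+\<omega>. ennreal ((f \<omega>)\<^sup>2) \<partial>M) = ennreal ((L2_norm M f)\<^sup>2)"
  using assms unfolding L2_space_def L2_norm_def
  by (auto simp: nn_integral_eq_integral)

lemma L2_norm_cong_AE:
  assumes "AE \<omega> in M. f \<omega> = g \<omega>" "f \<in> borel_measurable M" "g \<in> borel_measurable M"
  shows "L2_norm M f = L2_norm M g"
proof -
  have [measurable]: "f \<in> borel_measurable M" "g \<in> borel_measurable M" by fact+
  have "(\<integral>\<omega>. (f \<omega>)\<^sup>2 \<partial>M) = (\<integral>\<omega>. (g \<omega>)\<^sup>2 \<partial>M)"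
    using assms(1) by (intro Bochner_Integration.integral_cong_AE) auto
  then show ?thesis by (simp add: L2_norm_def)
qed

lemma L2_space_cong_AE:
  assumes "AE \<omega> in M. f \<omega> = g \<omega>" "f \<in> L2_space M" "g \<in> borel_measurable M"
  shows "g \<in> L2_space M"
proof -
  have [measurable]: "f \<in> borel_measurable M" "g \<in> borel_measurable M" using assms by (auto simp: L2_space_def)
  have "integrable M (\<lambda>\<omega>. (f \<omega>)\<^sup>2) \<longleftrightarrow> integrable M (\<lambda>\<omega>. (g \<omega>)\<^sup>2)"
    using assms(1) by (intro integrable_cong_AE) auto
  then show ?thesis using assms by (auto simp: L2_space_def)
qed

text \<open>Conditional Jensen for the square, followed by integration.\<close>

lemma (in prob_space) real_cond_exp_L2:
  assumes F: "subalgebra M F" and f: "f \<in> L2_space M"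
  shows "real_cond_exp M F f \<in> L2_space M" "L2_norm M (real_cond_exp M F f) \<le> L2_norm M f"
proof -
  interpret sigma_finite_subalgebra M F
    by (intro finite_measure_subalgebra_is_sigma_finite finite_measure_subalgebra.intro
      finite_measure_subalgebra_axioms.intro F) unfold_locales
  have int: "integrable M f" by (rule L2_space_integrable[OF f])
  have int2: "integrable M (\<lambda>\<omega>. (f \<omega>)\<^sup>2)" using f by (simp add: L2_space_def)
  have conv: "convex_on UNIV (\<lambda>x::real. x\<^sup>2)" by (rule convex_power2)
  have J: "AE \<omega> in M. (real_cond_exp M F f \<omega>)\<^sup>2 \<le> real_cond_exp M F (\<lambda>\<omega>. (f \<omega>)\<^sup>2) \<omega>"
    by (rule real_cond_exp_jensens_inequality(2)[where I=UNIV and q="\<lambda>x. x\<^sup>2"]) (use int int2 conv in auto)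
  have int3: "integrable M (\<lambda>\<omega>. (real_cond_exp M F f \<omega>)\<^sup>2)"
    by (rule Bochner_Integration.integrable_bound[OF real_cond_exp_int(1)[OF int2]]) (use J in auto)
  then show "real_cond_exp M F f \<in> L2_space M" by (simp add: L2_space_def)
  have "(\<integral>\<omega>. (real_cond_exp M F f \<omega>)\<^sup>2 \<partial>M) \<le> (\<integral>\<omega>. real_cond_exp M F (\<lambda>\<omega>. (f \<omega>)\<^sup>2) \<omega> \<partial>M)"
    by (rule integral_mono_AE[OF int3 real_cond_exp_int(1)[OF int2] J])
  also have "\<dots> = (\<integral>\<omega>. (f \<omega>)\<^sup>2 \<partial>M)" by (rule real_cond_exp_int(2)[OF int2])
  finally show "L2_norm M (real_cond_exp M F f) \<le> L2_norm M f" by (simp add: L2_norm_def)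
qed

text \<open>With v i the indicator of {0..t i} at s this is D_s on the level of representing
  functions, so iterated Malliavin derivatives become iterates of one operator.\<close>

definition dir_deriv :: "nat \<Rightarrow> (nat \<Rightarrow> real) \<Rightarrow> ((nat \<Rightarrow> real) \<Rightarrow> real) \<Rightarrow> (nat \<Rightarrow> real) \<Rightarrow> real" where
  "dir_deriv n v g = (\<lambda>x. \<Sum>i<n. partial_deriv i g x * v i)"

lemma smooth_fun_dir_deriv: "smooth_fun n g \<Longrightarrow> smooth_fun n (dir_deriv n v g)"
  unfolding dir_deriv_def by (rule smooth_fun_derivation)

lemma smooth_fun_dir_deriv_iterate: "smooth_fun n g \<Longrightarrow> smooth_fun n ((dir_deriv n v ^^ l) g)"
  by (induction l) (simp_all add: smooth_fun_dir_deriv)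

lemma smooth_fun_continuous:
  assumes "smooth_fun n g"
  shows "continuous_on UNIV g"
proof -
  have "set [] \<subseteq> {..<n}" by simp
  then have "continuous_on UNIV (foldr partial_deriv [] g)" using assms unfolding smooth_fun_def by blast
  then show ?thesis by simp
qed

lemma smooth_fun_cong: "smooth_fun n g \<Longrightarrow> (\<And>i. i < n \<Longrightarrow> x i = y i) \<Longrightarrow> g x = g y"
  unfolding smooth_fun_def by blast

lemma DERIV_along_line:
  assumes "smooth_fun n g"
  shows "((\<lambda>x. g (\<lambda>i. y i + x * v i)) has_real_derivative dir_deriv n v g (\<lambda>i. y i + x * v i)) (at x)"
proof -
  have "((\<lambda>e. g (\<lambda>i. (y i + x * v i) + e * v i)) has_real_derivative dir_deriv n v g (\<lambda>i. y i + x * v i)) (at 0)"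
    unfolding dir_deriv_def by (rule smooth_fun_directional_deriv[OF assms])
  then have "((\<lambda>e. g (\<lambda>i. y i + (e + x) * v i)) has_real_derivative dir_deriv n v g (\<lambda>i. y i + x * v i)) (at 0)"
    by (simp add: algebra_simps)
  then show ?thesis using DERIV_shift[of "\<lambda>x. g (\<lambda>i. y i + x * v i)" _ 0 x] by simp
qed

lemma malliavin_deriv_iterate:
  assumes W: "brownian_motion P W" and r: "cylindrical_rep P W n t g F"
  shows "cylindrical_rep P W n t ((dir_deriv n (\<lambda>i. indicator {0..t i} s) ^^ l) g) ((malliavin_deriv P W s ^^ l) F)"
proof (induction l)
  case (Suc l)
  from cylindrical_rep_malliavin_deriv[OF W this, of s] show ?case
    unfolding dir_deriv_def[symmetric] by simp
qed (use r in simp)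

text \<open>The vector \<open>(W(\<Delta>), \<dots>, W(M\<Delta>))\<close> is \<open>Y + sqrt \<Delta> * \<xi> * v\<close> with \<open>\<xi>\<close> standard normal and independent
  of \<open>Y = past + future\<close>; the factor \<open>sqrt \<Delta> ^ l\<close> in \<open>u l\<close> makes \<open>u (Suc l)\<close> the derivative of \<open>u l\<close>.\<close>
locale backward_step = brownian P W for P :: "'a measure" and W +
  fixes M m :: nat and \<Delta> :: real and F :: "'a \<Rightarrow> real" and g :: "(nat \<Rightarrow> real) \<Rightarrow> real"
  assumes \<Delta>: "\<Delta> > 0" and m: "m < M"
    and smooth: "smooth_fun M g" and F: "F \<in> malliavin_D_infty P W (real M * \<Delta>)"
    and rep: "\<omega> \<in> space P \<Longrightarrow> F \<omega> = g (\<lambda>i. W (real (i + 1) * \<Delta>) \<omega>)"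
begin

text \<open>Coordinate i belongs to time (i+1)\<Delta>, so \<open>T1\<close> is the time of
  coordinate m, and the increment from \<open>T0\<close> to \<open>T1\<close> moves exactly the
  coordinates i >= m.\<close>

definition "time i = real (i + 1) * \<Delta>"
definition "T0 = real m * \<Delta>"
definition "T1 = real (m + 1) * \<Delta>"
definition v :: "nat \<Rightarrow> real" where "v i = indicator {0..time i} T1"
definition "D l = (malliavin_deriv P W T1 ^^ l) F"
definition "\<xi> \<omega> = (W T1 \<omega> - W T0 \<omega>) / sqrt \<Delta>"
text \<open>Coordinates from m on are frozen at the value at \<open>T0\<close>, which makes the
  whole vector \<open>\<F> T0\<close>-measurable.\<close>

definition "past \<omega> i = (if i < m then W (time i) \<omega> else W T0 \<omega>)"
text \<open>The maximum keeps all times at or after \<open>T1\<close>, so the coordinates i <= m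
  vanish.\<close>

definition "future = increments M (\<lambda>i. max (time i) T1) T1"
definition "Y \<omega> = (\<lambda>i. past \<omega> i + future \<omega> i)"
definition u :: "nat \<Rightarrow> real \<Rightarrow> (nat \<Rightarrow> real) \<Rightarrow> real" where
  "u l x y = sqrt \<Delta> ^ l * (dir_deriv M v ^^ l) g (\<lambda>i. y i + sqrt \<Delta> * x * v i)"

lemma v_eq: "v i = (if m \<le> i then 1 else 0)"
  using \<Delta> by (auto simp: v_def time_def T1_def indicator_def)

lemma T_nonneg: "0 \<le> T0" "0 \<le> T1" "T0 \<le> T1" "0 \<le> time i"
  using \<Delta> by (auto simp: T0_def T1_def time_def)

lemma Y_eq: "i < M \<Longrightarrow> Y \<omega> i + sqrt \<Delta> * \<xi> \<omega> * v i = W (time i) \<omega>"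
proof -
  assume i: "i < M"
  have "time i \<le> T1 \<longleftrightarrow> i \<le> m" "time m = T1" using \<Delta> by (auto simp: time_def T1_def)
  then show ?thesis
    using i \<Delta> by (auto simp: Y_def past_def future_def increments_def \<xi>_def v_eq max_def)
qed

lemma D_u: "\<omega> \<in> space P \<Longrightarrow> u l (\<xi> \<omega>) (Y \<omega>) = sqrt \<Delta> ^ l * D l \<omega>"
proof -
  assume \<omega>: "\<omega> \<in> space P"
  have "cylindrical_rep P W M time g F"
    unfolding cylindrical_rep_def using smooth rep \<Delta> by (auto simp: time_def)
  from malliavin_deriv_iterate[OF bm this, where s=T1 and l=l]
  have "cylindrical_rep P W M time ((dir_deriv M v ^^ l) g) (D l)"
    unfolding D_def v_def[abs_def] .
  with \<omega> have *: "D l \<omega> = (dir_deriv M v ^^ l) g (\<lambda>i. W (time i) \<omega>)" by (simp add: cylindrical_rep_def)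
  show "u l (\<xi> \<omega>) (Y \<omega>) = sqrt \<Delta> ^ l * D l \<omega>"
    unfolding * u_def
    by (intro arg_cong2[where f="(*)"] refl smooth_fun_cong[OF smooth_fun_dir_deriv_iterate[OF smooth]] Y_eq)
qed

lemma DERIV_u: "((\<lambda>x. u l x y) has_real_derivative u (Suc l) x y) (at x)"
proof -
  let ?h = "(dir_deriv M v ^^ l) g"
  have "((\<lambda>x. ?h (\<lambda>i. y i + x * v i)) has_real_derivative dir_deriv M v ?h (\<lambda>i. y i + (sqrt \<Delta> * x) * v i)) (at (sqrt \<Delta> * x))"
    by (rule DERIV_along_line[OF smooth_fun_dir_deriv_iterate[OF smooth]])
  then have "((\<lambda>x. ?h (\<lambda>i. y i + (sqrt \<Delta> * x) * v i)) has_real_derivative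
      dir_deriv M v ?h (\<lambda>i. y i + (sqrt \<Delta> * x) * v i) * sqrt \<Delta>) (at x)"
    by (rule DERIV_chain2) (auto intro!: derivative_eq_intros)
  from DERIV_cmult[OF this, of "sqrt \<Delta> ^ l"] show ?thesis by (simp add: u_def mult_ac)
qed

lemma W_time_measurable [measurable]:
  "W T0 \<in> borel_measurable P" "W T1 \<in> borel_measurable P" "W (time i) \<in> borel_measurable P"
  using T_nonneg by (auto intro: W_measurable)

lemma \<xi>_measurable [measurable]: "\<xi> \<in> borel_measurable P"
  unfolding \<xi>_def by measurable

lemma past_measurable_\<F>: "past \<in> borel_measurable (\<F> T0)"
proof (rule measurable_coordinatewise_then_product)
  fix i
  have "time i \<le> T0" if "i < m" using that \<Delta> by (simp add: time_def T0_def)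
  then show "(\<lambda>\<omega>. past \<omega> i) \<in> borel_measurable (\<F> T0)"
    unfolding past_def using T_nonneg by (cases "i < m") (auto intro: W_measurable_\<F>)
qed

lemma future_measurable [measurable]: "future \<in> borel_measurable P"
  unfolding future_def using T_nonneg by (intro increments_measurable) auto

lemma past_measurable [measurable]: "past \<in> borel_measurable P"
  using past_measurable_\<F> by (rule measurable_from_subalg[OF subalgebra_\<F>])

lemma measurable_add_vec [measurable (raw)]:
  fixes a b :: "'z \<Rightarrow> nat \<Rightarrow> real"
  assumes "a \<in> borel_measurable N" "b \<in> borel_measurable N"
  shows "(\<lambda>z i. a z i + b z i) \<in> borel_measurable N"
proof (rule measurable_coordinatewise_then_product)
  fix i
  have "(\<lambda>x. x i) \<in> borel_measurable (borel :: (nat \<Rightarrow> real) measure)"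
    by (intro borel_measurable_continuous_onI continuous_on_product_coordinates)
  with assms show "(\<lambda>z. a z i + b z i) \<in> borel_measurable N"
    by (intro borel_measurable_add measurable_compose[OF _ \<open>(\<lambda>x. x i) \<in> borel_measurable borel\<close>]) auto
qed

lemma Y_measurable [measurable]: "Y \<in> borel_measurable P"
  unfolding Y_def by measurable

lemma u_measurable_raw [measurable (raw)]:
  fixes f :: "'z \<Rightarrow> real" and h :: "'z \<Rightarrow> nat \<Rightarrow> real"
  assumes [measurable]: "f \<in> borel_measurable N" "h \<in> borel_measurable N"
  shows "(\<lambda>z. u l (f z) (h z)) \<in> borel_measurable N"
proof -
  have "(\<lambda>z i. sqrt \<Delta> * f z * v i) \<in> borel_measurable N"
    by (rule measurable_coordinatewise_then_product) measurable
  then have "(\<lambda>z i. h z i + sqrt \<Delta> * f z * v i) \<in> borel_measurable N"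
    by (rule measurable_add_vec[OF assms(2)])
  moreover have "(dir_deriv M v ^^ l) g \<in> borel_measurable borel"
    by (rule borel_measurable_continuous_onI[OF smooth_fun_continuous[OF smooth_fun_dir_deriv_iterate[OF smooth]]])
  ultimately have "(\<lambda>z. (dir_deriv M v ^^ l) g (\<lambda>i. h z i + sqrt \<Delta> * f z * v i)) \<in> borel_measurable N"
    by (rule measurable_compose)
  then show ?thesis unfolding u_def by (intro borel_measurable_times borel_measurable_const)
qed

lemma indep_future: "indep_of_algebra (\<F> T1) borel future"
  unfolding future_def using T_nonneg by (intro indep_\<F>_increments) auto

text \<open>Both come from one vector of increments started at \<open>T0\<close>: its coordinate m
  is the increment up to \<open>T1\<close>, and subtracting it from the later coordinates leaves
  increments started at \<open>T1\<close>.\<close>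

lemma indep_\<xi>_future: "indep_of_algebra (\<F> T0) (borel \<Otimes>\<^sub>M borel) (\<lambda>\<omega>. (\<xi> \<omega>, future \<omega>))"
proof -
  let ?I = "increments M (\<lambda>i. max (time i) T0) T0"
  define f :: "(nat \<Rightarrow> real) \<Rightarrow> real \<times> (nat \<Rightarrow> real)"
    where "f x = (x m / sqrt \<Delta>, \<lambda>i. if i < M \<and> m \<le> i then x i - x m else 0)" for x
  have [measurable]: "(\<lambda>x. x i) \<in> borel_measurable (borel :: (nat \<Rightarrow> real) measure)" for i
    by (intro borel_measurable_continuous_onI continuous_on_product_coordinates)
  have "(\<lambda>x i. if i < M \<and> m \<le> i then x i - x m else 0) \<in> borel_measurable (borel :: (nat \<Rightarrow> real) measure)"
  proof (rule measurable_coordinatewise_then_product)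
    fix i show "(\<lambda>x. if i < M \<and> m \<le> i then x i - x m else 0) \<in> borel_measurable (borel :: (nat \<Rightarrow> real) measure)"
      by (cases "i < M \<and> m \<le> i") auto
  qed
  then have f: "f \<in> measurable borel (borel \<Otimes>\<^sub>M borel)" unfolding f_def by measurable
  have I: "indep_of_algebra (\<F> T0) borel ?I"
    using T_nonneg by (intro indep_\<F>_increments) auto
  have tm: "time i \<le> T1 \<longleftrightarrow> i \<le> m" "time i \<le> T0 \<longleftrightarrow> i < m" "time m = T1" for i
    using \<Delta> by (auto simp: time_def T1_def T0_def)
  have "f (?I \<omega>) = (\<xi> \<omega>, future \<omega>)" for \<omega>
    using m tm T_nonneg by (auto simp: f_def \<xi>_def future_def increments_def max_def fun_eq_iff)
  with indep_of_algebra_compose[OF I f] show ?thesis by simp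
qed

lemma distr_\<xi>: "distr P borel \<xi> = std_normal"
proof -
  have "distributed P lborel (\<lambda>\<omega>. W T1 \<omega> - W T0 \<omega>) (normal_density 0 (sqrt (T1 - T0)))"
    using bm T_nonneg \<Delta> unfolding brownian_motion_def by (auto simp: T0_def T1_def)
  moreover have "T1 - T0 = \<Delta>" by (simp add: T0_def T1_def algebra_simps)
  ultimately have "distributed P lborel (\<lambda>\<omega>. W T1 \<omega> - W T0 \<omega>) (normal_density 0 (sqrt \<Delta>))" by simp
  then have "distributed P lborel \<xi> std_normal_density"
    using normal_standard_normal_convert[of "sqrt \<Delta>" "\<lambda>\<omega>. W T1 \<omega> - W T0 \<omega>" 0] \<Delta> by (simp add: \<xi>_def[abs_def])
  then show ?thesis by (simp add: distributed_distr_eq_density[symmetric] cong: distr_cong)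
qed

end

section \<open>Joint law of the increment and the other coordinates\<close>

context backward_step
begin

lemma past_measurable_\<F>1: "past \<in> borel_measurable (\<F> T1)"
  by (rule measurable_from_subalg[OF _ past_measurable_\<F>])
     (use \<F>_mono[OF T_nonneg(3)] in \<open>simp add: subalgebra_def\<close>)

text \<open>\<xi> is \<open>\<F> T1\<close>-measurable, and \<open>future\<close> is independent of
  \<open>\<F> T1\<close>.\<close>

lemma distr_\<xi>_future:
  "distr P (borel \<Otimes>\<^sub>M borel) (\<lambda>\<omega>. (\<xi> \<omega>, future \<omega>)) = std_normal \<Otimes>\<^sub>M distr P borel future"
proof (rule pair_measure_eqI[symmetric])
  interpret R: prob_space "distr P borel future" by (rule prob_space_distr) measurable
  show "sigma_finite_measure std_normal" "sigma_finite_measure (distr P borel future)" by unfold_locales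
  show "sets (std_normal \<Otimes>\<^sub>M distr P borel future) = sets (distr P (borel \<Otimes>\<^sub>M borel) (\<lambda>\<omega>. (\<xi> \<omega>, future \<omega>)))"
    by (simp cong: sets_pair_measure_cong)
  have \<xi>F: "\<xi> \<in> borel_measurable (\<F> T1)"
    unfolding \<xi>_def using T_nonneg by (intro borel_measurable_divide borel_measurable_diff W_measurable_\<F> measurable_const) auto
  fix A :: "real set" and B :: "(nat \<Rightarrow> real) set" assume "A \<in> sets std_normal" "B \<in> sets (distr P borel future)"
  then have [measurable]: "A \<in> sets borel" "B \<in> sets borel" by auto
  have "\<xi> -` A \<inter> space P \<in> sets (\<F> T1)" using measurable_sets[OF \<xi>F, of A] by simp
  then have "prob ((\<xi> -` A \<inter> space P) \<inter> (future -` B \<inter> space P)) = prob (\<xi> -` A \<inter> space P) * prob (future -` B \<inter> space P)"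
    using indep_future \<open>B \<in> sets borel\<close> unfolding indep_of_algebra_def by blast
  moreover have "(\<lambda>\<omega>. (\<xi> \<omega>, future \<omega>)) -` (A \<times> B) \<inter> space P = (\<xi> -` A \<inter> space P) \<inter> (future -` B \<inter> space P)" by auto
  ultimately show "emeasure std_normal A * emeasure (distr P borel future) B =
      emeasure (distr P (borel \<Otimes>\<^sub>M borel) (\<lambda>\<omega>. (\<xi> \<omega>, future \<omega>))) (A \<times> B)"
    unfolding distr_\<xi>[symmetric]
    by (simp add: emeasure_distr emeasure_eq_measure ennreal_mult)
qed

text \<open>\<xi> is independent of \<open>Y\<close> although \<open>Y\<close> mixes times before
  and after it. With the past frozen, \<xi> and \<open>future\<close> are split by their product law
  and \<xi> is integrated out; the freezing is then undone.\<close>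

lemma nn_integral_joint:
  fixes H :: "real \<times> (nat \<Rightarrow> real) \<Rightarrow> ennreal"
  assumes [measurable]: "H \<in> borel_measurable (borel \<Otimes>\<^sub>M borel)"
  shows "(\<integral>\<^sup>+\<omega>. H (\<xi> \<omega>, Y \<omega>) \<partial>P) = (\<integral>\<^sup>+y. \<integral>\<^sup>+x. H (x, y) \<partial>std_normal \<partial>distr P borel Y)"
proof -
  interpret R: prob_space "distr P borel future" by (rule prob_space_distr) measurable
  interpret NR: pair_sigma_finite std_normal "distr P borel future" ..
  note [measurable] = past_measurable_\<F> past_measurable_\<F>1
  have "(\<integral>\<^sup>+\<omega>. H (\<xi> \<omega>, Y \<omega>) \<partial>P) =
      (\<integral>\<^sup>+\<omega>. (\<lambda>(\<omega>, p). H (fst p, \<lambda>i. past \<omega> i + snd p i)) (\<omega>, (\<xi> \<omega>, future \<omega>)) \<partial>P)"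
    by (simp add: Y_def)
  also have "\<dots> = (\<integral>\<^sup>+\<omega>. \<integral>\<^sup>+p. (\<lambda>(\<omega>, p). H (fst p, \<lambda>i. past \<omega> i + snd p i)) (\<omega>, p)
      \<partial>distr P (borel \<Otimes>\<^sub>M borel) (\<lambda>\<omega>. (\<xi> \<omega>, future \<omega>)) \<partial>P)"
    by (rule nn_integral_indep_of_algebra[OF subalgebra_\<F> indep_\<xi>_future]) measurable
  also have "\<dots> = (\<integral>\<^sup>+\<omega>. \<integral>\<^sup>+q. \<integral>\<^sup>+x. H (x, \<lambda>i. past \<omega> i + q i) \<partial>std_normal \<partial>distr P borel future \<partial>P)"
    unfolding distr_\<xi>_future
  proof (intro nn_integral_cong)
    fix \<omega> assume "\<omega> \<in> space P"
    have "(\<lambda>p. H (fst p, \<lambda>i. past \<omega> i + snd p i)) \<in> borel_measurable (std_normal \<Otimes>\<^sub>M distr P borel future)"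
      by measurable
    from NR.nn_integral_snd[OF this]
    show "(\<integral>\<^sup>+p. (\<lambda>(\<omega>, p). H (fst p, \<lambda>i. past \<omega> i + snd p i)) (\<omega>, p) \<partial>(std_normal \<Otimes>\<^sub>M distr P borel future)) =
        (\<integral>\<^sup>+q. \<integral>\<^sup>+x. H (x, \<lambda>i. past \<omega> i + q i) \<partial>std_normal \<partial>distr P borel future)" by simp
  qed
  also have "\<dots> = (\<integral>\<^sup>+\<omega>. \<integral>\<^sup>+q. (\<lambda>(\<omega>, q). \<integral>\<^sup>+x. H (x, \<lambda>i. past \<omega> i + q i) \<partial>std_normal) (\<omega>, q) \<partial>distr P borel future \<partial>P)"
    by simp
  \<comment> \<open>The same independence formula read backwards, now at \<open>T1\<close>, where
    the past is measurable as well.\<close>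
  also have "\<dots> = (\<integral>\<^sup>+\<omega>. (\<lambda>(\<omega>, q). \<integral>\<^sup>+x. H (x, \<lambda>i. past \<omega> i + q i) \<partial>std_normal) (\<omega>, future \<omega>) \<partial>P)"
    by (rule nn_integral_indep_of_algebra[OF subalgebra_\<F> indep_future, symmetric]) measurable
  also have "\<dots> = (\<integral>\<^sup>+\<omega>. (\<integral>\<^sup>+x. H (x, Y \<omega>) \<partial>std_normal) \<partial>P)" by (simp add: Y_def)
  also have "\<dots> = (\<integral>\<^sup>+y. \<integral>\<^sup>+x. H (x, y) \<partial>std_normal \<partial>distr P borel Y)"
    by (subst nn_integral_distr) auto
  finally show ?thesis .
qed

text \<open>F with the increment over the step integrated out and past and future kept: the limit of
  the series before conditioning on \<open>\<F> T1\<close>.\<close>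

definition "averaged \<omega> = (\<integral>z. u 0 z (Y \<omega>) \<partial>std_normal)"

lemma averaged_measurable [measurable]: "averaged \<in> borel_measurable P"
  unfolding averaged_def by measurable

lemma F_eq_u: "\<omega> \<in> space P \<Longrightarrow> F \<omega> = u 0 (\<xi> \<omega>) (Y \<omega>)"
  using D_u[of \<omega> 0] by (simp add: D_def)

text \<open>By freezing, both sides integrate F over independent copies of \<xi> and
  \<open>future\<close> with the past held fixed: on the left first over \<xi> and then over
  \<open>future\<close>, on the right jointly. Fubini identifies them.\<close>

lemma cond_exp_averaged:
  assumes intF: "integrable P F" and inta: "integrable P averaged"
  shows "AE \<omega> in P. real_cond_exp P (\<F> T1) averaged \<omega> = real_cond_exp P (\<F> T0) F \<omega>"
proof -
  interpret R: prob_space "distr P borel future" by (rule prob_space_distr) measurable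
  interpret NR: pair_sigma_finite std_normal "distr P borel future" ..
  interpret F0: sigma_finite_subalgebra P "\<F> T0"
    by (intro finite_measure_subalgebra_is_sigma_finite finite_measure_subalgebra.intro
      finite_measure_subalgebra_axioms.intro subalgebra_\<F>) unfold_locales
  note [measurable] = past_measurable_\<F> past_measurable_\<F>1
  have [measurable]: "F \<in> borel_measurable P" using intF by (rule borel_measurable_integrable)
  define h where "h = (\<lambda>(\<omega>, p). u 0 (fst p) (\<lambda>i. past \<omega> i + snd p i))"
  have h: "h \<in> borel_measurable (\<F> T0 \<Otimes>\<^sub>M (borel \<Otimes>\<^sub>M borel))" unfolding h_def by measurable
  have hF: "h (\<omega>, (\<xi> \<omega>, future \<omega>)) = F \<omega>" if "\<omega> \<in> space P" for \<omega>
    using F_eq_u[OF that] by (simp add: h_def Y_def)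
  have hint: "integrable P (\<lambda>\<omega>. h (\<omega>, (\<xi> \<omega>, future \<omega>)))"
    using intF by (subst Bochner_Integration.integrable_cong[OF refl hF]) auto
  note h_exp = real_cond_exp_indep_of_algebra[OF subalgebra_\<F> indep_\<xi>_future h hint]
  have 1: "AE \<omega> in P. real_cond_exp P (\<F> T0) F \<omega> = real_cond_exp P (\<F> T0) (\<lambda>\<omega>. h (\<omega>, (\<xi> \<omega>, future \<omega>))) \<omega>"
    by (rule F0.real_cond_exp_cong) (use hF hint in \<open>auto simp: borel_measurable_integrable\<close>)
  define k where "k = (\<lambda>(\<omega>, q). \<integral>z. u 0 z (\<lambda>i. past \<omega> i + q i) \<partial>std_normal)"
  have k: "k \<in> borel_measurable (\<F> T1 \<Otimes>\<^sub>M borel)" unfolding k_def by measurable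
  have ka: "(\<lambda>\<omega>. k (\<omega>, future \<omega>)) = averaged" by (simp add: k_def averaged_def Y_def fun_eq_iff)
  have 2: "AE \<omega> in P. real_cond_exp P (\<F> T1) averaged \<omega> = (\<integral>q. k (\<omega>, q) \<partial>distr P borel future)"
    using real_cond_exp_indep_of_algebra(1)[OF subalgebra_\<F> indep_future k] inta unfolding ka by simp
  show ?thesis using 1 2 h_exp
  proof eventually_elim
    case (elim \<omega>)
    have "integrable (std_normal \<Otimes>\<^sub>M distr P borel future) (case_prod (\<lambda>z q. u 0 z (\<lambda>i. past \<omega> i + q i)))"
      using elim(4) unfolding distr_\<xi>_future h_def by (simp add: case_prod_beta')
    from NR.integral_snd[OF this]
    have "(\<integral>q. k (\<omega>, q) \<partial>distr P borel future) = (\<integral>p. h (\<omega>, p) \<partial>distr P (borel \<Otimes>\<^sub>M borel) (\<lambda>\<omega>. (\<xi> \<omega>, future \<omega>)))"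
      unfolding distr_\<xi>_future h_def k_def by (simp add: case_prod_beta')
    with elim show ?case by simp
  qed
qed

lemma D_measurable [measurable]: "D l \<in> borel_measurable P"
proof -
  have "(\<lambda>\<omega>. u l (\<xi> \<omega>) (Y \<omega>) / sqrt \<Delta> ^ l) \<in> borel_measurable P" by measurable
  then show ?thesis by (rule measurable_cong[THEN iffD1, rotated]) (use D_u \<Delta> in auto)
qed

text \<open>The constant list of l copies of \<open>T1\<close> is admissible in the supremum,
  because \<open>T1\<close> is at most M\<Delta>. The supremum bounds start at order 1, so order 0
  relies on F itself being in L2.\<close>

lemma D_L2: "D l \<in> L2_space P"
proof (cases "l = 0")
  case True
  then show ?thesis using F by (simp add: D_def malliavin_D_infty_def)
next
  case False
  let ?ss = "replicate l T1"
  have "real (m + 1) \<le> real M" using m by simp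
  then have T1: "T1 \<le> real M * \<Delta>" unfolding T1_def using \<Delta> by (intro mult_right_mono) auto
  have "(\<integral>\<^sup>+\<omega>. ennreal ((D l \<omega>)\<^sup>2) \<partial>P) \<le> (\<integral>\<^sup>+\<omega>. (SUP ss\<in>{ss. length ss = l \<and> set ss \<subseteq> {0..real M * \<Delta>}}.
                     ennreal \<bar>foldr (malliavin_deriv P W) ss F \<omega>\<bar>)\<^sup>2 \<partial>P)"
  proof (intro nn_integral_mono)
    fix \<omega>
    have "ennreal \<bar>foldr (malliavin_deriv P W) ?ss F \<omega>\<bar> \<le> (SUP ss\<in>{ss. length ss = l \<and> set ss \<subseteq> {0..real M * \<Delta>}}.
                     ennreal \<bar>foldr (malliavin_deriv P W) ss F \<omega>\<bar>)"
      using T1 T_nonneg by (intro SUP_upper) auto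
    then have "(ennreal \<bar>D l \<omega>\<bar>)\<^sup>2 \<le> (SUP ss\<in>{ss. length ss = l \<and> set ss \<subseteq> {0..real M * \<Delta>}}.
                     ennreal \<bar>foldr (malliavin_deriv P W) ss F \<omega>\<bar>)\<^sup>2"
      by (intro power_mono) (auto simp: D_def)
    then show "ennreal ((D l \<omega>)\<^sup>2) \<le> (SUP ss\<in>{ss. length ss = l \<and> set ss \<subseteq> {0..real M * \<Delta>}}.
                     ennreal \<bar>foldr (malliavin_deriv P W) ss F \<omega>\<bar>)\<^sup>2"
      by (simp add: ennreal_power)
  qed
  also have "\<dots> < \<infinity>" using F False unfolding malliavin_D_infty_def by auto
  finally show ?thesis by (intro L2_spaceI D_measurable)
qed

lemma gamma_D: "\<omega> \<in> space P \<Longrightarrow> bte_gamma W \<Delta> m l \<omega> * D l \<omega> = taylor_weight l (\<xi> \<omega>) * u l (\<xi> \<omega>) (Y \<omega>)"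
  using bte_gamma_eq_taylor_weight[OF \<Delta>, of W m l \<omega>] D_u[of \<omega> l] by (simp add: \<xi>_def T0_def T1_def)

text \<open>This is what allows gamma to be pulled out of the conditional expectation at
  \<open>T1\<close>.\<close>

lemma gamma_measurable_\<F>: "bte_gamma W \<Delta> m l \<in> borel_measurable (\<F> T1)"
proof -
  have "\<xi> \<in> borel_measurable (\<F> T1)"
    unfolding \<xi>_def using T_nonneg by (intro borel_measurable_divide borel_measurable_diff W_measurable_\<F> measurable_const) auto
  then have "(\<lambda>\<omega>. sqrt \<Delta> ^ l * taylor_weight l (\<xi> \<omega>)) \<in> borel_measurable (\<F> T1)" by measurable
  moreover have "bte_gamma W \<Delta> m l = (\<lambda>\<omega>. sqrt \<Delta> ^ l * taylor_weight l (\<xi> \<omega>))"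
    using bte_gamma_eq_taylor_weight[OF \<Delta>, of W m l] by (simp add: fun_eq_iff \<xi>_def T0_def T1_def)
  ultimately show ?thesis by simp
qed

text \<open>The error before conditioning is \<open>R n\<close>. Conditioning on
  \<open>\<F> T1\<close> turns it into the error of the claimed series without increasing its norm,
  so its geometric decay is inherited.\<close>

lemma sums_in_L2_cond_exp:
  assumes lim: "(\<lambda>L. \<Sum>i=0..L. (L2_norm P (D (2 * L - i)))\<^sup>2 *
      real (L choose i) ^ 4 * (fact i / (fact L)\<^sup>2) * \<Delta> ^ (2 * L - i)) \<longlonglongrightarrow> 0"
  shows "sums_in_L2 P (\<lambda>l \<omega>. bte_gamma W \<Delta> m l \<omega> * real_cond_exp P (\<F> T1) (D l) \<omega>) (real_cond_exp P (\<F> T0) F)"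
proof -
  \<comment> \<open>The factor \<Delta>^l makes this the squared norm of \<open>u l\<close>, in
    exactly the form in which it enters the hypothesis.\<close>
  define c where "c l = (L2_norm P (D l))\<^sup>2 * \<Delta> ^ l" for l
  have "(\<lambda>L. \<Sum>i=0..L. c (2 * L - i) * real (L choose i) ^ 4 * (fact i / (fact L)\<^sup>2)) \<longlonglongrightarrow> 0"
    using lim by (simp add: c_def mult_ac)
  then obtain C where C: "C \<ge> 0" "\<And>n. c n \<le> C * fact n * (2/15) ^ n"
    using derivative_growth[of c] \<Delta> by (auto simp: c_def)
  interpret Ysp: prob_space "distr P borel Y" by (rule prob_space_distr) measurable
  interpret derivative_chain "distr P borel Y" u C
  proof
    show "(\<lambda>p. u l (fst p) (snd p)) \<in> borel_measurable (borel \<Otimes>\<^sub>M distr P borel Y)" for l by measurable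
    show "((\<lambda>x. u l x r) has_real_derivative u (Suc l) x r) (at x)" for l x r by (rule DERIV_u)
    show "C \<ge> 0" by (rule C)
    fix l
    have "(\<integral>\<^sup>+y. \<integral>\<^sup>+x. ennreal ((u l x y)\<^sup>2) \<partial>std_normal \<partial>distr P borel Y) = (\<integral>\<^sup>+\<omega>. ennreal ((u l (\<xi> \<omega>) (Y \<omega>))\<^sup>2) \<partial>P)"
      using nn_integral_joint[of "\<lambda>p. ennreal ((u l (fst p) (snd p))\<^sup>2)"] by simp
    also have "\<dots> = (\<integral>\<^sup>+\<omega>. ennreal (\<Delta> ^ l) * ennreal ((D l \<omega>)\<^sup>2) \<partial>P)"
    proof (intro nn_integral_cong)
      fix \<omega> assume "\<omega> \<in> space P"
      have "(sqrt \<Delta> ^ l)\<^sup>2 = \<Delta> ^ l" using \<Delta> by (simp add: power_mult[symmetric] mult.commute[of l 2]) (simp add: power_mult)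
      then show "ennreal ((u l (\<xi> \<omega>) (Y \<omega>))\<^sup>2) = ennreal (\<Delta> ^ l) * ennreal ((D l \<omega>)\<^sup>2)"
        using D_u[OF \<open>\<omega> \<in> space P\<close>] \<Delta> by (simp add: power_mult_distrib ennreal_mult')
    qed
    also have "\<dots> = ennreal (\<Delta> ^ l) * ennreal ((L2_norm P (D l))\<^sup>2)"
      by (subst nn_integral_cmult) (auto simp: nn_integral_square_L2[OF D_L2])
    also have "\<dots> = ennreal (c l)" using \<Delta> by (simp add: c_def ennreal_mult'[symmetric] mult.commute)
    also have "\<dots> \<le> ennreal (C * fact l * (2/15) ^ l)" by (intro ennreal_leI C)
    finally show "(\<integral>\<^sup>+y. \<integral>\<^sup>+x. ennreal ((u l x y)\<^sup>2) \<partial>std_normal \<partial>distr P borel Y) \<le> ennreal (C * fact l * (2/15) ^ l)" .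
  qed
  define S where "S l \<omega> = bte_gamma W \<Delta> m l \<omega> * D l \<omega>" for l \<omega>
  have gm [measurable]: "bte_gamma W \<Delta> m l \<in> borel_measurable P" for l
    using gamma_measurable_\<F> by (rule measurable_from_subalg[OF subalgebra_\<F>])
  have S_measurable [measurable]: "S l \<in> borel_measurable P" for l unfolding S_def by measurable
  have S_L2: "S l \<in> L2_space P" for l
  proof (rule L2_spaceI[OF S_measurable])
    have "(\<integral>\<^sup>+\<omega>. ennreal ((S l \<omega>)\<^sup>2) \<partial>P) = (\<integral>\<^sup>+\<omega>. ennreal ((taylor_weight l (\<xi> \<omega>) * u l (\<xi> \<omega>) (Y \<omega>))\<^sup>2) \<partial>P)"
      by (intro nn_integral_cong) (simp add: S_def gamma_D)
    also have "\<dots> = (\<integral>\<^sup>+y. \<integral>\<^sup>+x. ennreal ((taylor_weight l x * u l x y)\<^sup>2) \<partial>std_normal \<partial>distr P borel Y)"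
      using nn_integral_joint[of "\<lambda>p. ennreal ((taylor_weight l (fst p) * u l (fst p) (snd p))\<^sup>2)"] by simp
    also have "\<dots> < \<infinity>" by (rule nn_integral_term_finite)
    finally show "(\<integral>\<^sup>+\<omega>. ennreal ((S l \<omega>)\<^sup>2) \<partial>P) < \<infinity>" .
  qed
  obtain K where K: "K \<ge> 0" and K_le:
    "\<And>n. (\<integral>\<^sup>+y. \<integral>\<^sup>+x. ennreal (((\<integral>z. u 0 z y \<partial>std_normal) - (\<Sum>l<n. taylor_weight l x * u l x y))\<^sup>2) \<partial>std_normal \<partial>distr P borel Y) \<le>
      ennreal (K * (20/21) ^ n)"
    using nn_integral_remainder_le by blast
  define R where "R n \<omega> = averaged \<omega> - (\<Sum>l<n. S l \<omega>)" for n \<omega>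
  have R_measurable [measurable]: "R n \<in> borel_measurable P" for n unfolding R_def by measurable
  have R_le: "(\<integral>\<^sup>+\<omega>. ennreal ((R n \<omega>)\<^sup>2) \<partial>P) \<le> ennreal (K * (20/21) ^ n)" for n
  proof -
    have "(\<integral>\<^sup>+\<omega>. ennreal ((R n \<omega>)\<^sup>2) \<partial>P) =
        (\<integral>\<^sup>+\<omega>. ennreal (((\<integral>z. u 0 z (Y \<omega>) \<partial>std_normal) - (\<Sum>l<n. taylor_weight l (\<xi> \<omega>) * u l (\<xi> \<omega>) (Y \<omega>)))\<^sup>2) \<partial>P)"
      by (intro nn_integral_cong) (simp add: R_def S_def gamma_D averaged_def)
    also have "\<dots> = (\<integral>\<^sup>+y. \<integral>\<^sup>+x. ennreal (((\<integral>z. u 0 z y \<partial>std_normal) - (\<Sum>l<n. taylor_weight l x * u l x y))\<^sup>2) \<partial>std_normal \<partial>distr P borel Y)"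
      using nn_integral_joint[of "\<lambda>p. ennreal (((\<integral>z. u 0 z (snd p) \<partial>std_normal) - (\<Sum>l<n. taylor_weight l (fst p) * u l (fst p) (snd p)))\<^sup>2)"]
      by simp
    finally show ?thesis using K_le by simp
  qed
  have R_L2: "R n \<in> L2_space P" for n
    using R_le[of n] by (intro L2_spaceI R_measurable) (simp add: order.strict_trans1)
  have R_norm: "L2_norm P (R n) \<le> sqrt (K * (20/21) ^ n)" for n
  proof -
    have "ennreal ((L2_norm P (R n))\<^sup>2) \<le> ennreal (K * (20/21) ^ n)"
      using R_le[of n] nn_integral_square_L2[OF R_L2] by simp
    then have "(L2_norm P (R n))\<^sup>2 \<le> K * (20/21) ^ n" using K by (simp add: ennreal_le_iff)
    then show ?thesis by (rule real_le_rsqrt)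
  qed
  have intF: "integrable P F" using L2_space_integrable[OF D_L2[of 0]] by (simp add: D_def)
  \<comment> \<open>With no terms subtracted, \<open>R 0\<close> is \<open>averaged\<close>
    itself.\<close>
  have averaged_L2: "averaged \<in> L2_space P" using R_L2[of 0] by (simp add: R_def[abs_def])
  have inta: "integrable P averaged" by (rule L2_space_integrable[OF averaged_L2])
  have intS: "integrable P (S l)" for l by (rule L2_space_integrable[OF S_L2])
  interpret F1: sigma_finite_subalgebra P "\<F> T1"
    by (intro finite_measure_subalgebra_is_sigma_finite finite_measure_subalgebra.intro
      finite_measure_subalgebra_axioms.intro subalgebra_\<F>) unfold_locales
  define E1 where "E1 = real_cond_exp P (\<F> T1)"
  have E1_measurable [measurable]: "E1 f \<in> borel_measurable P" for f unfolding E1_def by (rule borel_measurable_cond_exp2)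
  have E0_measurable [measurable]: "real_cond_exp P (\<F> T0) F \<in> borel_measurable P" by (rule borel_measurable_cond_exp2)
  have term_eq: "AE \<omega> in P. E1 (S l) \<omega> = bte_gamma W \<Delta> m l \<omega> * E1 (D l) \<omega>" for l
    unfolding E1_def S_def[abs_def]
    by (rule F1.real_cond_exp_mult[OF gamma_measurable_\<F> D_measurable]) (use intS[of l] in \<open>simp add: S_def[abs_def]\<close>)
  have lim_eq: "AE \<omega> in P. E1 averaged \<omega> = real_cond_exp P (\<F> T0) F \<omega>"
    unfolding E1_def by (rule cond_exp_averaged[OF intF inta])
  have rem_eq: "AE \<omega> in P. E1 (R n) \<omega> = real_cond_exp P (\<F> T0) F \<omega> - (\<Sum>l<n. bte_gamma W \<Delta> m l \<omega> * E1 (D l) \<omega>)" for n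
  proof -
    have 1: "AE \<omega> in P. E1 (R n) \<omega> = E1 averaged \<omega> - E1 (\<lambda>\<omega>. \<Sum>l<n. S l \<omega>) \<omega>"
      unfolding E1_def R_def[abs_def] by (rule F1.real_cond_exp_diff) (use inta intS in auto)
    have 2: "AE \<omega> in P. E1 (\<lambda>\<omega>. \<Sum>l<n. S l \<omega>) \<omega> = (\<Sum>l<n. E1 (S l) \<omega>)"
      unfolding E1_def by (rule F1.real_cond_exp_sum) (rule intS)
    have 3: "AE \<omega> in P. \<forall>l. E1 (S l) \<omega> = bte_gamma W \<Delta> m l \<omega> * E1 (D l) \<omega>"
      using term_eq by (subst AE_all_countable) auto
    show ?thesis using 1 2 3 lim_eq by eventually_elim simp
  qed
  show ?thesis
    unfolding sums_in_L2_def E1_def[symmetric]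
  proof (intro conjI allI)
    show "(\<lambda>\<omega>. bte_gamma W \<Delta> m l \<omega> * E1 (D l) \<omega>) \<in> L2_space P" for l
      by (rule L2_space_cong_AE[OF term_eq]) (auto simp: E1_def intro: real_cond_exp_L2(1)[OF subalgebra_\<F> S_L2])
    show "real_cond_exp P (\<F> T0) F \<in> L2_space P"
      using real_cond_exp_L2(1)[OF subalgebra_\<F> D_L2[of 0]] by (simp add: D_def)
    show "(\<lambda>n. L2_norm P (\<lambda>\<omega>. real_cond_exp P (\<F> T0) F \<omega> - (\<Sum>l<n. bte_gamma W \<Delta> m l \<omega> * E1 (D l) \<omega>))) \<longlonglongrightarrow> 0"
    proof (rule Lim_null_comparison)
      have "L2_norm P (\<lambda>\<omega>. real_cond_exp P (\<F> T0) F \<omega> - (\<Sum>l<n. bte_gamma W \<Delta> m l \<omega> * E1 (D l) \<omega>)) = L2_norm P (E1 (R n))" for n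
        by (rule L2_norm_cong_AE[OF AE_symmetric[OF rem_eq]]) measurable
      also have "L2_norm P (E1 (R n)) \<le> L2_norm P (R n)" for n
        unfolding E1_def by (rule real_cond_exp_L2(2)[OF subalgebra_\<F> R_L2])
      also note R_norm
      finally show "\<forall>\<^sub>F n in sequentially. norm (L2_norm P (\<lambda>\<omega>. real_cond_exp P (\<F> T0) F \<omega> - (\<Sum>l<n. bte_gamma W \<Delta> m l \<omega> * E1 (D l) \<omega>))) \<le> sqrt (K * (20/21) ^ n)"
        by (auto simp: L2_norm_def)
      have "(\<lambda>n. sqrt (K * (20/21) ^ n)) \<longlonglongrightarrow> sqrt (K * 0)"
        by (intro tendsto_real_sqrt tendsto_mult_left LIMSEQ_power_zero) auto
      then show "(\<lambda>n. sqrt (K * (20/21) ^ n)) \<longlonglongrightarrow> 0" by simp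
    qed
  qed
qed

end

theorem theorem2p1:
  fixes P :: "'a measure" and W :: "real \<Rightarrow> 'a \<Rightarrow> real"
    and M :: nat and \<Delta> :: real
    and F :: "'a \<Rightarrow> real" and g :: "(nat \<Rightarrow> real) \<Rightarrow> real"
  assumes "prob_space P" and "complete_measure P" and "brownian_motion P W"
    and "M \<ge> 1" and "\<Delta> > 0"
    and "F \<in> malliavin_D_infty P W (real M * \<Delta>)"
    and "smooth_fun M g"
    and "\<forall>\<omega>\<in>space P. F \<omega> = g (\<lambda>i. W (real (i + 1) * \<Delta>) \<omega>)"
    and "\<forall>m<M. (\<lambda>L. \<Sum>i=0..L.
           (L2_norm P ((malliavin_deriv P W (real (m + 1) * \<Delta>) ^^ (2 * L - i)) F))\<^sup>2 *
           real (L choose i) ^ 4 * (fact i / (fact L)\<^sup>2) * \<Delta> ^ (2 * L - i)) \<longlonglongrightarrow> 0"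
  shows "\<forall>m<M. sums_in_L2 P
           (\<lambda>l \<omega>. bte_gamma W \<Delta> m l \<omega> *
              real_cond_exp P (brownian_filtration P W (real (m + 1) * \<Delta>))
                ((malliavin_deriv P W (real (m + 1) * \<Delta>) ^^ l) F) \<omega>)
           (real_cond_exp P (brownian_filtration P W (real m * \<Delta>)) F)"
proof (intro allI impI)
  fix m assume m: "m < M"
  interpret backward_step P W M m \<Delta> F g
    by unfold_locales (use assms m in auto)
  show "sums_in_L2 P
           (\<lambda>l \<omega>. bte_gamma W \<Delta> m l \<omega> *
              real_cond_exp P (brownian_filtration P W (real (m + 1) * \<Delta>))
                ((malliavin_deriv P W (real (m + 1) * \<Delta>) ^^ l) F) \<omega>)
           (real_cond_exp P (brownian_filtration P W (real m * \<Delta>)) F)"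
    using sums_in_L2_cond_exp assms(9) m unfolding D_def T0_def T1_def by blast
qed

end
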